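(* Assume that $\delta>0$, $S>0$, $0\le P<\lambda_1$ and that $g\in C^0(\mathbb{R}_+,L^2(\Omega))$ is even with respect to $y$. There exists $\chi=\chi(\delta,S,P,\lambda_1)>0$ such that if a solution $u$ of the plate problem satisfies $$\limsup_{t\to\infty}\|u_x(t)\|_{L^2}^2<\chi,$$ then its torsional component vanishes exponentially as $t\to\infty$; more precisely, there exists $\eta>0$ such that $$\lim_{t\to\infty}e^{\eta t}\left(\|u^T(t)\|_{H^2_*}^2+\|u^T_t(t)\|_{L^2}^2\right)=0.$$
   Context: Domain and spaces: $\Omega=(0,\pi)\times(-\ell,\ell)\subset\mathbb{R}^2$ with $0<\ell\ll\pi$ fixed, $\xi=(x,y)\in\Omega$, and the Poisson ratio is $\sigma=0.2$. $H^2_*(\Omega)=\{U\in H^2(\Omega):U=0\text{ on }\{0,\pi\}\times[-\ell,\ell]\}$, a Hilbert space with inner product $(U,V)_{H^2_*}=\int_\Omega\big(\Delta U\Delta V-(1-\sigma)(U_{xx}V_{yy}+U_{yy}V_{xx}-2U_{xy}V_{xy})\big)$ and norm $\|\cdot\|_{H^2_*}$; $(H^2_*(\Omega))'$ is its dual, $\langle\cdot,\cdot\rangle$ the duality pairing, $(\cdot,\cdot)_{L^2}$ the inner product of $L^2(\Omega)$. $\lambda_1=\min_{0\ne v\in H^2_*(\Omega)}\|v\|_{H^2_*}^2/\|v\|_{L^2}^2$. Plate problem: $u_{tt}+\delta u_t+\Delta^2u+\big[P-S\int_\Omega u_x^2\big]u_{xx}=g(\xi,t)$ in $\Omega$, with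 boundary conditions $u=u_{xx}=0$ on $\{0,\pi\}\times[-\ell,\ell]$ and $u_{yy}+\sigma u_{xx}=u_{yyy}+(2-\sigma)u_{xxy}=0$ on $[0,\pi]\times\{-\ell,\ell\}$. Solution means (global) weak solution: $u\in C^0(\mathbb{R}_+,H^2_*(\Omega))\cap C^1(\mathbb{R}_+,L^2(\Omega))\cap C^2(\mathbb{R}_+,(H^2_*(\Omega))')$ with $\langle u_{tt},v\rangle+\delta(u_t,v)_{L^2}+(u,v)_{H^2_*}+\big[S\|u_x\|_{L^2}^2-P\big](u_x,v_x)_{L^2}=(g,v)_{L^2}$ for all $t\ge0$ and all $v\in H^2_*(\Omega)$ (no initial data prescribed). For a function $u$ of $(x,y,t)$, $u^T(x,y,t)=\frac{u(x,y,t)-u(x,-y,t)}2$ denotes its torsional component. *)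

theory Defs
  imports "HOL-Analysis.Analysis"
begin

text \<open>
  Elements of \<open>L\<^sup>2\<close>, \<open>H\<^sup>2\<close> and \<open>H\<^sup>2\<^sub>*\<close> are represented by functions on the plane, only their values on
  the plate \<open>Omega l\<close> (up to null sets) being relevant: all the pairings, norms and derivatives
  below are invariant under modification on a null set and outside the plate.
\<close>

definition Omega :: "real \<Rightarrow> (real \<times> real) set" where
  "Omega l = {0<..<pi} \<times> {-l<..<l}"

definition poisson :: real where
  "poisson = 2 / 10"

definition L2 :: "real \<Rightarrow> (real \<times> real \<Rightarrow> real) set" where
  "L2 l = {f. f \<in> borel_measurable (lebesgue_on (Omega l)) \<and>
              integrable (lebesgue_on (Omega l)) (\<lambda>\<xi>. (f \<xi>)\<^sup>2)}"

definition inner_L2 :: "real \<Rightarrow> (real \<times> real \<Rightarrow> real) \<Rightarrow> (real \<times> real \<Rightarrow> real) \<Rightarrow> real" where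
  "inner_L2 l f g = (\<integral>\<xi>. f \<xi> * g \<xi> \<partial>lebesgue_on (Omega l))"

definition norm_L2 :: "real \<Rightarrow> (real \<times> real \<Rightarrow> real) \<Rightarrow> real" where
  "norm_L2 l f = sqrt (inner_L2 l f f)"

definition Dx :: "(real \<times> real \<Rightarrow> real) \<Rightarrow> real \<times> real \<Rightarrow> real" where
  "Dx f = (\<lambda>(x, y). deriv (\<lambda>s. f (s, y)) x)"

definition Dy :: "(real \<times> real \<Rightarrow> real) \<Rightarrow> real \<times> real \<Rightarrow> real" where
  "Dy f = (\<lambda>(x, y). deriv (\<lambda>s. f (x, s)) y)"

fun times_cont_diff :: "nat \<Rightarrow> (real \<times> real \<Rightarrow> real) \<Rightarrow> bool" where
  "times_cont_diff 0 f \<longleftrightarrow> continuous_on UNIV f"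
| "times_cont_diff (Suc k) f \<longleftrightarrow>
     continuous_on UNIV f \<and>
     (\<forall>x y. (\<lambda>s. f (s, y)) differentiable (at x) \<and> (\<lambda>s. f (x, s)) differentiable (at y)) \<and>
     times_cont_diff k (Dx f) \<and> times_cont_diff k (Dy f)"

definition test_functions :: "(real \<times> real) set \<Rightarrow> (real \<times> real \<Rightarrow> real) set" where
  "test_functions A = {\<phi>. (\<forall>k. times_cont_diff k \<phi>) \<and>
                          (\<exists>K. compact K \<and> K \<subseteq> A \<and> (\<forall>\<xi>. \<xi> \<notin> K \<longrightarrow> \<phi> \<xi> = 0))}"

definition has_weak_partial ::
    "real \<Rightarrow> nat \<Rightarrow> nat \<Rightarrow> (real \<times> real \<Rightarrow> real) \<Rightarrow> (real \<times> real \<Rightarrow> real) \<Rightarrow> bool" where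
  "has_weak_partial l i j u w \<longleftrightarrow>
     (\<forall>\<phi>\<in>test_functions (Omega l).
        inner_L2 l u ((Dx ^^ i) ((Dy ^^ j) \<phi>)) = (-1) ^ (i + j) * inner_L2 l w \<phi>)"

definition H2 :: "real \<Rightarrow> (real \<times> real \<Rightarrow> real) set" where
  "H2 l = {u \<in> L2 l. \<forall>i j. i + j \<le> 2 \<longrightarrow> (\<exists>w\<in>L2 l. has_weak_partial l i j u w)}"

definition weak_partial :: "real \<Rightarrow> nat \<Rightarrow> nat \<Rightarrow> (real \<times> real \<Rightarrow> real) \<Rightarrow> real \<times> real \<Rightarrow> real" where
  "weak_partial l i j u = (SOME w. w \<in> L2 l \<and> has_weak_partial l i j u w)"

text \<open>
  In dimension two \<open>H\<^sup>2\<close> embeds into the continuous functions on the closed rectangle, so the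
  condition on the short edges is a pointwise condition on the continuous representative.
\<close>

definition H2star :: "real \<Rightarrow> (real \<times> real \<Rightarrow> real) set" where
  "H2star l = {u \<in> H2 l. \<exists>w. continuous_on (closure (Omega l)) w \<and>
                 (AE \<xi> in lebesgue_on (Omega l). u \<xi> = w \<xi>) \<and>
                 (\<forall>x\<in>{0, pi}. \<forall>y\<in>{-l..l}. w (x, y) = 0)}"

definition inner_H2star :: "real \<Rightarrow> (real \<times> real \<Rightarrow> real) \<Rightarrow> (real \<times> real \<Rightarrow> real) \<Rightarrow> real" where
  "inner_H2star l U V =
    (let Uxx = weak_partial l 2 0 U; Uxy = weak_partial l 1 1 U; Uyy = weak_partial l 0 2 U;
         Vxx = weak_partial l 2 0 V; Vxy = weak_partial l 1 1 V; Vyy = weak_partial l 0 2 V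
     in \<integral>\<xi>. (Uxx \<xi> + Uyy \<xi>) * (Vxx \<xi> + Vyy \<xi>)
              - (1 - poisson) * (Uxx \<xi> * Vyy \<xi> + Uyy \<xi> * Vxx \<xi> - 2 * Uxy \<xi> * Vxy \<xi>)
          \<partial>lebesgue_on (Omega l))"

definition norm_H2star :: "real \<Rightarrow> (real \<times> real \<Rightarrow> real) \<Rightarrow> real" where
  "norm_H2star l u = sqrt (inner_H2star l u u)"

text \<open>The infimum of the Rayleigh quotient over nonzero classes; it is attained.\<close>

definition lambda1 :: "real \<Rightarrow> real" where
  "lambda1 l = Inf {(norm_H2star l v)\<^sup>2 / (norm_L2 l v)\<^sup>2 | v. v \<in> H2star l \<and> norm_L2 l v \<noteq> 0}"

text \<open>Functionals in the dual are only constrained on \<open>H2star l\<close>; the pairing is application.\<close>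

definition dual_H2star :: "real \<Rightarrow> ((real \<times> real \<Rightarrow> real) \<Rightarrow> real) set" where
  "dual_H2star l = {F.
     (\<forall>v\<in>H2star l. \<forall>w\<in>H2star l. F (\<lambda>\<xi>. v \<xi> + w \<xi>) = F v + F w) \<and>
     (\<forall>c. \<forall>v\<in>H2star l. F (\<lambda>\<xi>. c * v \<xi>) = c * F v) \<and>
     (\<exists>C. \<forall>v\<in>H2star l. \<bar>F v\<bar> \<le> C * norm_H2star l v)}"

definition norm_dual :: "real \<Rightarrow> ((real \<times> real \<Rightarrow> real) \<Rightarrow> real) \<Rightarrow> real" where
  "norm_dual l F = Sup {\<bar>F v\<bar> | v. v \<in> H2star l \<and> norm_H2star l v \<le> 1}"

text \<open>
  Curves \<open>{0..} \<rightarrow> X\<close> for a space \<open>X\<close> of real-valued functions with (semi)norm \<open>N\<close>; it is used both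
  for functions on the plate and for functionals.  Derivatives at time 0 are one-sided.
\<close>

definition has_curve_deriv ::
    "(('a \<Rightarrow> real) \<Rightarrow> real) \<Rightarrow> (real \<Rightarrow> 'a \<Rightarrow> real) \<Rightarrow> ('a \<Rightarrow> real) \<Rightarrow> real \<Rightarrow> bool" where
  "has_curve_deriv N u w t \<longleftrightarrow>
     ((\<lambda>s. N (\<lambda>z. (u s z - u t z) / (s - t) - w z)) \<longlongrightarrow> 0) (at t within {0..})"

definition curve_deriv ::
    "('a \<Rightarrow> real) set \<Rightarrow> (('a \<Rightarrow> real) \<Rightarrow> real) \<Rightarrow> (real \<Rightarrow> 'a \<Rightarrow> real) \<Rightarrow> real \<Rightarrow> 'a \<Rightarrow> real" where
  "curve_deriv X N u t = (SOME w. w \<in> X \<and> has_curve_deriv N u w t)"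

definition C0_curve ::
    "('a \<Rightarrow> real) set \<Rightarrow> (('a \<Rightarrow> real) \<Rightarrow> real) \<Rightarrow> (real \<Rightarrow> 'a \<Rightarrow> real) \<Rightarrow> bool" where
  "C0_curve X N u \<longleftrightarrow>
     (\<forall>t\<ge>0. u t \<in> X \<and> ((\<lambda>s. N (\<lambda>z. u s z - u t z)) \<longlongrightarrow> 0) (at t within {0..}))"

fun C_curve ::
    "nat \<Rightarrow> ('a \<Rightarrow> real) set \<Rightarrow> (('a \<Rightarrow> real) \<Rightarrow> real) \<Rightarrow> (real \<Rightarrow> 'a \<Rightarrow> real) \<Rightarrow> bool" where
  "C_curve 0 X N u \<longleftrightarrow> C0_curve X N u"
| "C_curve (Suc k) X N u \<longleftrightarrow>
     C0_curve X N u \<and> (\<exists>u'. (\<forall>t\<ge>0. has_curve_deriv N u (u' t) t) \<and> C_curve k X N u')"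

definition L2_time_deriv :: "real \<Rightarrow> (real \<Rightarrow> real \<times> real \<Rightarrow> real) \<Rightarrow> real \<Rightarrow> real \<times> real \<Rightarrow> real" where
  "L2_time_deriv l = curve_deriv (L2 l) (norm_L2 l)"

definition dual_time_deriv ::
    "real \<Rightarrow> (real \<Rightarrow> (real \<times> real \<Rightarrow> real) \<Rightarrow> real) \<Rightarrow> real \<Rightarrow> (real \<times> real \<Rightarrow> real) \<Rightarrow> real" where
  "dual_time_deriv l = curve_deriv (dual_H2star l) (norm_dual l)"

text \<open>\<open>L\<^sup>2\<close> is embedded into the dual of \<open>H\<^sup>2\<^sub>*\<close> by \<open>inner_L2 l\<close> (Gelfand triple).\<close>

definition weak_solution ::
    "real \<Rightarrow> real \<Rightarrow> real \<Rightarrow> real \<Rightarrow> (real \<Rightarrow> real \<times> real \<Rightarrow> real) \<Rightarrow>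
     (real \<Rightarrow> real \<times> real \<Rightarrow> real) \<Rightarrow> bool" where
  "weak_solution l \<delta> S P g u \<longleftrightarrow>
     C_curve 0 (H2star l) (norm_H2star l) u \<and>
     C_curve 1 (L2 l) (norm_L2 l) u \<and>
     C_curve 2 (dual_H2star l) (norm_dual l) (\<lambda>t. inner_L2 l (u t)) \<and>
     (\<forall>t\<ge>0. \<forall>v\<in>H2star l.
        dual_time_deriv l (dual_time_deriv l (\<lambda>s. inner_L2 l (u s))) t v
        + \<delta> * inner_L2 l (L2_time_deriv l u t) v
        + inner_H2star l (u t) v
        + (S * (norm_L2 l (weak_partial l 1 0 (u t)))\<^sup>2 - P)
            * inner_L2 l (weak_partial l 1 0 (u t)) (weak_partial l 1 0 v)
        = inner_L2 l (g t) v)"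

definition even_in_y :: "real \<Rightarrow> (real \<times> real \<Rightarrow> real) \<Rightarrow> bool" where
  "even_in_y l f \<longleftrightarrow> (AE (x, y) in lebesgue_on (Omega l). f (x, - y) = f (x, y))"

definition torsional :: "(real \<times> real \<Rightarrow> real) \<Rightarrow> real \<times> real \<Rightarrow> real" where
  "torsional f = (\<lambda>(x, y). (f (x, y) - f (x, - y)) / 2)"

end

theory Submission
  imports Defs
begin

text \<open>
  Since \<open>g\<close> is even in \<open>y\<close>, the torsional component \<open>w\<close> of a solution satisfies the equation
  without forcing, in which \<open>S \<parallel>u\<^sub>x\<parallel>\<^sup>2\<close> is a given, eventually small coefficient.  So \<open>w\<close> obeys a
  damped linear plate equation with a small perturbation, and a Lyapunov function decays: with
  \<open>A = \<parallel>w\<parallel>\<^sup>2 - P \<parallel>w\<^sub>x\<parallel>\<^sup>2\<close> (the first norm being that of \<open>H\<^sup>2\<^sub>*\<close>) take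
  \<open>Y = (\<parallel>w\<^sub>t\<parallel>\<^sup>2 + A)/2 + \<delta>/4 (w\<^sub>t, w) + \<delta>\<^sup>2/8 \<parallel>w\<parallel>\<^sup>2\<close>, the last norm being that of \<open>L\<^sup>2\<close>.  When
  \<open>S \<parallel>u\<^sub>x\<parallel>\<^sup>2 \<le> \<delta>/25\<close>, then \<open>Y' \<le> - \<kappa> Y\<close> and \<open>Y\<close> dominates the energy of \<open>w\<close>, which gives the
  decay with \<open>\<chi> = \<delta>/(25 S)\<close> (\<open>Lyapunov_estimates\<close>, \<open>exponential_decay\<close>, \<open>torsional_decay\<close>).

  Three points need work.

  \<^item> The energy identity.  The velocity of a weak solution lies in \<open>L\<^sup>2\<close> only and is not an admissible
    test function.  Testing with symmetric difference quotients in time instead, the contributions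
    of the symmetric forms telescope, and the limit yields the identity
    (\<open>two_time_energy_identity\<close>).  The nonlocal term passes to the limit because
    \<open>(w\<^sub>x, v\<^sub>x) = - (w\<^sub>x\<^sub>x, v)\<close> on \<open>H\<^sup>2\<^sub>*\<close> (\<open>weak_by_parts\<close>).

  \<^item> Coercivity of \<open>A\<close> for every \<open>P < \<lambda>\<^sub>1\<close>.  Interpolation gives
    \<open>\<parallel>w\<^sub>x\<parallel>\<^sup>4 \<le> \<parallel>w\<parallel>\<^sup>2 \<parallel>w\<^sub>x\<^sub>x\<parallel>\<^sup>2\<close> in \<open>L\<^sup>2\<close>, where \<open>\<parallel>w\<parallel>\<^sup>2\<close> is at most \<open>1/\<lambda>\<^sub>1\<close> times the squared \<open>H\<^sup>2\<^sub>*\<close> norm,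
    and that square is at least \<open>(1 - \<sigma>\<^sup>2) \<parallel>w\<^sub>x\<^sub>x\<parallel>\<^sup>2 + 2 (1 - \<sigma>) \<parallel>w\<^sub>x\<^sub>y\<parallel>\<^sup>2\<close>.
    For odd functions a Poincare inequality in \<open>y\<close> turns the mixed term into a multiple of
    \<open>\<parallel>w\<^sub>x\<parallel>\<^sup>2\<close>; with \<open>\<lambda>\<^sub>1 \<le> 1\<close> this leaves a uniform margin (\<open>odd_Poincare\<close>, \<open>lambda1_le_1\<close>,
    \<open>odd_coercivity\<close>).

  \<^item> Weak derivatives.  They are unique up to null sets by the fundamental lemma of the calculus of
    variations (\<open>fundamental_lemma\<close>), and functions with weak derivatives are absolutely continuous
    on almost all lines (\<open>ACL_rectangle\<close>).  These two facts carry the integration by parts and the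
    Poincare inequality.
\<close>

section \<open>Smooth bumps of one variable\<close>

fun Ck :: "nat \<Rightarrow> (real \<Rightarrow> real) \<Rightarrow> bool" where
  "Ck 0 f \<longleftrightarrow> continuous_on UNIV f"
| "Ck (Suc n) f \<longleftrightarrow> (\<exists>f'. (\<forall>x. (f has_real_derivative f' x) (at x)) \<and> Ck n f')"

definition smooth :: "(real \<Rightarrow> real) \<Rightarrow> bool" where
  "smooth f \<longleftrightarrow> (\<forall>n. Ck n f)"

lemma Ck_SucI: "(\<And>x. (f has_real_derivative f' x) (at x)) \<Longrightarrow> Ck n f' \<Longrightarrow> Ck (Suc n) f"
  by auto

lemma Ck_continuous: "Ck n f \<Longrightarrow> continuous_on UNIV f"
  by (cases n) (auto intro!: continuous_at_imp_continuous_on intro: DERIV_isCont)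

lemma Ck_SucD: "Ck (Suc n) f \<Longrightarrow> Ck n f"
proof (induction n arbitrary: f)
  case 0
  then show ?case using Ck_continuous[OF 0] by simp
next
  case (Suc n)
  then show ?case by (metis Ck.simps(2))
qed

lemma Ck_lincomb:
  "Ck n f \<Longrightarrow> Ck n g \<Longrightarrow> Ck n (\<lambda>x. a * f x + b * g x)"
proof (induction n arbitrary: f g)
  case 0
  then show ?case by (auto intro!: continuous_intros)
next
  case (Suc n)
  then obtain f' g' where f: "\<forall>x. (f has_real_derivative f' x) (at x)" "Ck n f'"
    and g: "\<forall>x. (g has_real_derivative g' x) (at x)" "Ck n g'" by auto
  have "((\<lambda>x. a * f x + b * g x) has_real_derivative a * f' x + b * g' x) (at x)" for x
    using f(1) g(1) by (auto intro!: derivative_eq_intros)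
  then show ?case unfolding Ck.simps using Suc.IH[OF f(2) g(2)]
    by (intro exI[of _ "\<lambda>x. a * f' x + b * g' x"]) auto
qed

lemma Ck_mult: "Ck n f \<Longrightarrow> Ck n g \<Longrightarrow> Ck n (\<lambda>x. f x * g x)"
proof (induction n arbitrary: f g)
  case 0
  then show ?case by (auto intro!: continuous_intros)
next
  case (Suc n)
  then obtain f' g' where f: "\<forall>x. (f has_real_derivative f' x) (at x)" "Ck n f'"
    and g: "\<forall>x. (g has_real_derivative g' x) (at x)" "Ck n g'" by auto
  have "((\<lambda>x. f x * g x) has_real_derivative 1 * (f' x * g x) + 1 * (f x * g' x)) (at x)" for x
    using f(1) g(1) by (auto intro!: derivative_eq_intros)
  moreover have "Ck n (\<lambda>x. 1 * (f' x * g x) + 1 * (f x * g' x))"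
    using Suc.prems[THEN Ck_SucD] Suc.IH f(2) g(2) by (intro Ck_lincomb) auto
  ultimately show ?case by (rule Ck_SucI)
qed

lemma Ck_affine: "Ck n f \<Longrightarrow> Ck n (\<lambda>x. f (a * x + b))"
proof (induction n arbitrary: f)
  case 0
  then show ?case by (auto intro!: continuous_intros continuous_on_compose2[of UNIV f])
next
  case (Suc n)
  then obtain f' where f: "\<forall>x. (f has_real_derivative f' x) (at x)" "Ck n f'" by auto
  have "((\<lambda>x. f (a * x + b)) has_real_derivative a * f' (a * x + b) + 0 * f' (a * x + b)) (at x)" for x
    by (rule DERIV_cong[OF DERIV_chain2[where g = "\<lambda>x. a * x + b" and Db = a]])
      (use f(1) in \<open>auto intro!: derivative_eq_intros\<close>)
  then show ?case
    by (rule Ck_SucI) (rule Ck_lincomb[OF Suc.IH[OF f(2)] Suc.IH[OF f(2)]])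
qed

lemma smooth_lincomb: "smooth f \<Longrightarrow> smooth g \<Longrightarrow> smooth (\<lambda>x. a * f x + b * g x)"
  and smooth_mult: "smooth f \<Longrightarrow> smooth g \<Longrightarrow> smooth (\<lambda>x. f x * g x)"
  and smooth_affine: "smooth f \<Longrightarrow> smooth (\<lambda>x. f (c * x + d))"
  by (auto simp: smooth_def intro: Ck_lincomb Ck_mult Ck_affine)

lemma smooth_has_deriv:
  assumes "smooth f"
  shows "(f has_real_derivative deriv f x) (at x)" and "smooth (deriv f)"
proof -
  have D: "(f has_real_derivative f' x) (at x) \<Longrightarrow> f' x = deriv f x" for f' x
    by (metis DERIV_imp_deriv)
  have "\<exists>f'. \<forall>x. (f has_real_derivative f' x) (at x)"
    using assms unfolding smooth_def by (metis Ck.simps(2))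
  then show "(f has_real_derivative deriv f x) (at x)" using D by metis
  show "smooth (deriv f)" unfolding smooth_def
  proof
    fix n
    obtain f' where f': "\<forall>x. (f has_real_derivative f' x) (at x)" "Ck n f'"
      using assms unfolding smooth_def by (metis Ck.simps(2))
    have "f' = deriv f" using f'(1) D by blast
    then show "Ck n (deriv f)" using f'(2) by simp
  qed
qed

lemma smooth_antideriv:
  assumes "\<And>x. (F has_real_derivative f x) (at x)" "smooth f"
  shows "smooth F"
  unfolding smooth_def
proof
  fix n
  have "Ck (Suc n) F" using assms by (auto simp: smooth_def)
  then show "Ck n F" by (rule Ck_SucD)
qed

text \<open>
  The classical flat function.  Negative powers are carried along so that the span of the family
  is closed under differentiation.
\<close>

definition flat :: "nat \<Rightarrow> real \<Rightarrow> real" where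
  "flat k x = (if x > 0 then exp (- inverse x) * inverse x ^ k else 0)"

lemma flat_has_deriv:
  "(flat k has_real_derivative (- real k * flat (k + 1) x + 1 * flat (k + 2) x)) (at x)"
proof -
  consider "x > 0" | "x < 0" | "x = 0" by linarith
  then show ?thesis
  proof cases
    case 1
    have pw: "inverse x * inverse x ^ (n - Suc 0) = (if n = 0 then inverse x else inverse x ^ n)" for n
      by (cases n) auto
    have "((\<lambda>x. exp (- inverse x) * inverse x ^ k) has_real_derivative
        (- real k * flat (k + 1) x + 1 * flat (k + 2) x)) (at x)"
      using 1
      by (cases k) (auto intro!: derivative_eq_intros simp: flat_def algebra_simps power2_eq_square pw)
    moreover have "eventually (\<lambda>y. exp (- inverse y) * inverse y ^ k = flat k y) (nhds x)"
      using eventually_nhds_in_open[of "{0<..}" x] 1 by (auto simp: flat_def elim: eventually_mono)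
    ultimately show ?thesis by (subst (asm) DERIV_cong_ev[OF refl _ refl])
  next
    case 2
    have "((\<lambda>x. 0) has_real_derivative (- real k * flat (k + 1) x + 1 * flat (k + 2) x)) (at x)"
      using 2 by (auto simp: flat_def)
    moreover have "eventually (\<lambda>y. 0 = flat k y) (nhds x)"
      using eventually_nhds_in_open[of "{..<0}" x] 2 by (auto simp: flat_def elim: eventually_mono)
    ultimately show ?thesis by (subst (asm) DERIV_cong_ev[OF refl _ refl])
  next
    case 3
    have "((\<lambda>h. flat k h / h) \<longlongrightarrow> 0) (at_right 0)"
    proof -
      have "filterlim (inverse :: real \<Rightarrow> real) at_top (at_right 0)"
        by (rule filterlim_inverse_at_top_right)
      then have "((\<lambda>h. inverse h ^ (k + 1) / exp (inverse h) :: real) \<longlongrightarrow> 0) (at_right 0)"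
        by (rule filterlim_compose[OF tendsto_power_div_exp_0])
      moreover have "eventually (\<lambda>h. inverse h ^ (k + 1) / exp (inverse h) = flat k h / h) (at_right (0::real))"
        by (auto simp: eventually_at_filter flat_def exp_minus field_simps intro!: always_eventually)
      ultimately show ?thesis by (rule Lim_transform_eventually)
    qed
    moreover have "((\<lambda>h. flat k h / h) \<longlongrightarrow> 0) (at_left 0)"
    proof (rule Lim_transform_eventually[of "\<lambda>_. 0"])
      show "eventually (\<lambda>h. 0 = flat k h / h) (at_left 0)"
        by (auto simp: eventually_at_filter flat_def intro!: always_eventually)
    qed auto
    ultimately have "((\<lambda>h. flat k h / h) \<longlongrightarrow> 0) (at 0)"
      by (simp add: filterlim_split_at)
    then show ?thesis using 3 by (simp add: DERIV_def flat_def)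
  qed
qed

lemma smooth_flat: "smooth (flat k)"
proof -
  have "Ck n (flat k)" for n
  proof (induction n arbitrary: k)
    case 0
    then show ?case using flat_has_deriv
      by (auto intro!: continuous_at_imp_continuous_on DERIV_isCont)
  next
    case (Suc n)
    show ?case by (rule Ck_SucI[OF flat_has_deriv Ck_lincomb[OF Suc.IH Suc.IH]])
  qed
  then show ?thesis by (simp add: smooth_def)
qed

definition bump :: "real \<Rightarrow> real \<Rightarrow> (real \<Rightarrow> real) set" where
  "bump a b = {f. smooth f \<and> (\<exists>p q. a < p \<and> p < q \<and> q < b \<and> (\<forall>x. x \<notin> {p..q} \<longrightarrow> f x = 0))}"

text \<open>
  These bumps have values in \<open>[0, 1]\<close> and converge to the indicator of \<open>(p, q)\<close>, because
  \<open>exp (-1/(n z - 1))\<close> tends to 1 for every \<open>z > 0\<close>.  The shift by 1 keeps the support away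
  from \<open>p\<close> and \<open>q\<close>, so that it is compact in the open interval.
\<close>

definition approx_ind :: "real \<Rightarrow> real \<Rightarrow> nat \<Rightarrow> real \<Rightarrow> real" where
  "approx_ind p q n x = flat 0 (real n * (x - p) - 1) * flat 0 (real n * (q - x) - 1)"

lemma approx_ind_bound: "\<bar>approx_ind p q n x\<bar> \<le> 1"
proof -
  have "0 \<le> flat 0 z" "flat 0 z \<le> 1" for z by (auto simp: flat_def)
  then show ?thesis unfolding approx_ind_def abs_mult by (intro mult_le_one) auto
qed

lemma flat_scaled_limit:
  assumes "z > (0::real)"
  shows "(\<lambda>n. flat 0 (real n * z - 1)) \<longlonglongrightarrow> 1"
proof -
  have "filterlim (\<lambda>n. -1 + z * real n) at_top sequentially"
    by (intro filterlim_tendsto_add_at_top[OF tendsto_const]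
        filterlim_tendsto_pos_mult_at_top[OF tendsto_const] assms filterlim_real_sequentially)
  then have L: "filterlim (\<lambda>n. real n * z - 1) at_top sequentially"
    by (simp add: algebra_simps)
  have "(\<lambda>n. inverse (real n * z - 1)) \<longlonglongrightarrow> 0"
    by (rule tendsto_inverse_0_at_top[OF L])
  then have "(\<lambda>n. exp (- inverse (real n * z - 1))) \<longlonglongrightarrow> exp (- 0)"
    by (intro tendsto_intros)
  moreover have "eventually (\<lambda>n. exp (- inverse (real n * z - 1)) = flat 0 (real n * z - 1)) sequentially"
    using L unfolding filterlim_at_top_dense by (auto elim!: allE[of _ 0] eventually_mono simp: flat_def)
  ultimately show ?thesis by (auto intro: Lim_transform_eventually)
qed

lemma approx_ind_limit: "(\<lambda>n. approx_ind p q n x) \<longlonglongrightarrow> indicator {p<..<q} x"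
proof (cases "x \<in> {p<..<q}")
  case True
  then show ?thesis unfolding approx_ind_def
    using tendsto_mult[OF flat_scaled_limit[of "x - p"] flat_scaled_limit[of "q - x"]] by simp
next
  case False
  have "flat 0 (real n * z - 1) = 0" if "z \<le> 0" for n z
    using mult_nonneg_nonpos[of "real n" z] that by (simp add: flat_def)
  then have "approx_ind p q n x = 0" for n
    using False by (auto simp: approx_ind_def not_less)
  then show ?thesis using False by simp
qed

lemma smooth_approx_ind: "smooth (approx_ind p q n)"
proof -
  have "approx_ind p q n = (\<lambda>x. flat 0 (real n * x + (- real n * p - 1)) * flat 0 (- real n * x + (real n * q - 1)))"
    by (simp add: approx_ind_def fun_eq_iff algebra_simps)
  then show ?thesis by (simp only:) (intro smooth_mult smooth_affine smooth_flat)
qed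

lemma approx_ind_bump:
  assumes "a \<le> p" "p < q" "q \<le> b" "n > 0"
  shows "approx_ind p q n \<in> bump a b"
proof -
  define m where "m = min (1 / real n) ((q - p) / 3)"
  have m: "0 < m" "m \<le> 1 / real n" "3 * m \<le> q - p" using assms 
    by (auto simp: m_def min_def field_simps)
  have "approx_ind p q n x = 0" if "x \<notin> {p + m..q - m}" for x
  proof -
    have "x - p \<le> 1 / real n \<or> q - x \<le> 1 / real n" using m that by auto
    then have "real n * (x - p) - 1 \<le> 0 \<or> real n * (q - x) - 1 \<le> 0"
      using assms(4) by (simp add: field_simps)
    then show ?thesis by (auto simp: approx_ind_def flat_def)
  qed
  moreover have "a < p + m" "p + m < q - m" "q - m < b" using assms m by auto
  ultimately show ?thesis unfolding bump_def using smooth_approx_ind by blast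
qed

lemma bump_lincomb:
  assumes "f \<in> bump a b" "g \<in> bump a b"
  shows "(\<lambda>x. c * f x + d * g x) \<in> bump a b"
proof -
  obtain p q where 1: "a < p" "p < q" "q < b" "\<And>x. x \<notin> {p..q} \<Longrightarrow> f x = 0"
    using assms(1) by (auto simp: bump_def)
  obtain p' q' where 2: "a < p'" "p' < q'" "q' < b" "\<And>x. x \<notin> {p'..q'} \<Longrightarrow> g x = 0"
    using assms(2) by (auto simp: bump_def)
  have "c * f x + d * g x = 0" if "x \<notin> {min p p'..max q q'}" for x
  proof -
    have "x \<notin> {p..q}" "x \<notin> {p'..q'}" using that by auto
    then show ?thesis by (simp add: 1(4) 2(4))
  qed
  moreover have "smooth (\<lambda>x. c * f x + d * g x)"
    using assms by (intro smooth_lincomb) (auto simp: bump_def)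
  moreover have "a < min p p'" "min p p' < max q q'" "max q q' < b" using 1 2 by auto
  ultimately show ?thesis unfolding bump_def by blast
qed

lemma bump_deriv:
  assumes "f \<in> bump a b"
  shows "deriv f \<in> bump a b"
proof -
  obtain p q where pq: "a < p" "p < q" "q < b" "\<And>x. x \<notin> {p..q} \<Longrightarrow> f x = 0" and f: "smooth f"
    using assms by (auto simp: bump_def)
  have "deriv f x = 0" if "x \<notin> {p..q}" for x
  proof -
    have "eventually (\<lambda>y. y \<in> - {p..q}) (nhds x)" using that by (intro eventually_nhds_in_open) auto
    then have "eventually (\<lambda>y. f y = 0) (nhds x)" by eventually_elim (use pq in auto)
    then have "deriv f x = deriv (\<lambda>_. 0) x" by (intro deriv_cong_ev) auto
    then show ?thesis by simp
  qed
  then show ?thesis using pq(1-3) smooth_has_deriv(2)[OF f] by (auto simp: bump_def)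
qed

text \<open>
  The value \<open>F b\<close> is the integral of the bump.  When it is 0, the primitive is again a bump; this is
  how bumps with a prescribed derivative arise.
\<close>

lemma bump_primitive:
  assumes "f \<in> bump a b"
  obtains F p q where "\<And>x. (F has_real_derivative f x) (at x)" "smooth F"
    "a < p" "p < q" "q < b" "\<And>x. x \<le> p \<Longrightarrow> F x = 0" "\<And>x. x \<ge> q \<Longrightarrow> F x = F b"
    "\<And>x. x \<notin> {p..q} \<Longrightarrow> f x = 0"
proof -
  obtain p q where pq: "a < p" "p < q" "q < b" and f0: "\<And>x. x \<notin> {p..q} \<Longrightarrow> f x = 0" and f: "smooth f"
    using assms by (auto simp: bump_def)
  define F where "F = (\<lambda>x::real. LBINT y=p..x. f y)"
  have cont: "continuous_on A f" for A using f Ck_continuous[of 0 f] continuous_on_subset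
    unfolding smooth_def by blast
  have D: "(F has_real_derivative f x) (at x)" for x
  proof -
    have "(F has_vector_derivative f x) (at x within {min p x - 1..max p x + 1})"
      unfolding F_def by (rule interval_integral_FTC2) (auto intro: cont)
    then show ?thesis
      by (simp add: at_within_Icc_at has_real_derivative_iff_has_vector_derivative)
  qed
  have contF: "continuous_on A F" for A
    by (rule continuous_at_imp_continuous_on) (use D DERIV_isCont in blast)
  have Fp: "F p = 0" by (simp add: F_def)
  have L: "F x = 0" if "x \<le> p" for x
  proof (cases "x = p")
    case False
    then have "x < p" using that by simp
    moreover have "DERIV F z :> 0" if "x < z" "z < p" for z using D[of z] f0[of z] that by simp
    ultimately have "F p = F x" by (intro DERIV_isconst_end contF) auto
    then show ?thesis by (simp add: Fp)
  qed (simp add: Fp)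
  have R: "F x = F q" if "x \<ge> q" for x
  proof (cases "x = q")
    case False
    then have "q < x" using that by simp
    moreover have "DERIV F z :> 0" if "q < z" "z < x" for z using D[of z] f0[of z] that by simp
    ultimately show ?thesis by (intro DERIV_isconst_end contF) auto
  qed simp
  have "smooth F" by (rule smooth_antideriv[OF D f])
  moreover have "F x = F b" if "x \<ge> q" for x using R[of x] R[of b] that pq by simp
  ultimately show thesis by (intro that[of F p q] D L f0 pq) auto
qed


section \<open>Square integrable functions and the fundamental lemma\<close>

lemma Omega_lebesgue [simp, measurable]: "Omega l \<in> sets lebesgue"
  and Omega_borel [simp, measurable]: "Omega l \<in> sets borel"
proof -
  have "open (Omega l)" by (auto simp: Omega_def intro: open_Times)
  then show "Omega l \<in> sets lebesgue" "Omega l \<in> sets borel" by auto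
qed

lemma Omega_finite: "finite_measure (lebesgue_on (Omega l))"
proof -
  have "bounded (Omega l)" by (auto simp: Omega_def intro: bounded_Times)
  then have "Omega l \<in> lmeasurable" by (intro bounded_set_imp_lmeasurable) auto
  then show ?thesis
    by (auto intro!: finite_measureI simp: emeasure_restrict_space fmeasurable_def top.not_eq_extremum)
qed

lemma abs_mult_le_sum_squares: "\<bar>a * b\<bar> \<le> a\<^sup>2 + b\<^sup>2" for a b :: real
proof -
  have "0 \<le> (\<bar>a\<bar> - \<bar>b\<bar>)\<^sup>2" by simp
  then have "2 * (\<bar>a\<bar> * \<bar>b\<bar>) \<le> a\<^sup>2 + b\<^sup>2" by (simp add: power2_diff)
  moreover have "0 \<le> \<bar>a\<bar> * \<bar>b\<bar>" by simp
  ultimately have "\<bar>a\<bar> * \<bar>b\<bar> \<le> a\<^sup>2 + b\<^sup>2" by linarith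
  then show ?thesis by (simp add: abs_mult)
qed

lemma L2_integrable_mult:
  assumes "f \<in> L2 l" "g \<in> L2 l"
  shows "integrable (lebesgue_on (Omega l)) (\<lambda>\<xi>. f \<xi> * g \<xi>)"
proof (rule Bochner_Integration.integrable_bound)
  show "integrable (lebesgue_on (Omega l)) (\<lambda>\<xi>. (f \<xi>)\<^sup>2 + (g \<xi>)\<^sup>2)"
    using assms by (auto simp: L2_def)
  show "(\<lambda>\<xi>. f \<xi> * g \<xi>) \<in> borel_measurable (lebesgue_on (Omega l))"
    using assms by (auto simp: L2_def)
  show "AE \<xi> in lebesgue_on (Omega l). norm (f \<xi> * g \<xi>) \<le> norm ((f \<xi>)\<^sup>2 + (g \<xi>)\<^sup>2)"
    using abs_mult_le_sum_squares by (intro AE_I2) simp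
qed

lemma L2_bounded:
  assumes "f \<in> borel_measurable (lebesgue_on (Omega l))" "\<And>\<xi>. \<xi> \<in> Omega l \<Longrightarrow> \<bar>f \<xi>\<bar> \<le> C"
  shows "f \<in> L2 l"
proof -
  interpret finite_measure "lebesgue_on (Omega l)" by (rule Omega_finite)
  have "integrable (lebesgue_on (Omega l)) (\<lambda>\<xi>. (f \<xi>)\<^sup>2)"
    using assms by (intro integrable_const_bound[where B = "C\<^sup>2"] AE_I2)
      (auto simp: abs_le_square_iff[symmetric] intro: order_trans[of _ C])
  then show ?thesis using assms by (simp add: L2_def)
qed

lemma L2_integrable:
  assumes "f \<in> L2 l"
  shows "integrable (lebesgue_on (Omega l)) f"
  using L2_integrable_mult[OF assms L2_bounded[of "\<lambda>_. 1" l 1]] by simp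

lemma L2_lincomb:
  assumes "f \<in> L2 l" "g \<in> L2 l"
  shows "(\<lambda>\<xi>. a * f \<xi> + b * g \<xi>) \<in> L2 l"
proof -
  have "(\<lambda>\<xi>. (a * f \<xi> + b * g \<xi>)\<^sup>2) = (\<lambda>\<xi>. a\<^sup>2 * (f \<xi>)\<^sup>2 + b\<^sup>2 * (g \<xi>)\<^sup>2 + 2 * a * b * (f \<xi> * g \<xi>))"
    by (auto simp: power2_eq_square algebra_simps)
  moreover have "integrable (lebesgue_on (Omega l)) \<dots>"
    using assms L2_integrable_mult[OF assms] by (auto simp: L2_def)
  ultimately show ?thesis using assms by (auto simp: L2_def)
qed

lemma inner_L2_lincomb:
  assumes "f \<in> L2 l" "g \<in> L2 l" "h \<in> L2 l"
  shows "inner_L2 l (\<lambda>\<xi>. a * f \<xi> + b * g \<xi>) h = a * inner_L2 l f h + b * inner_L2 l g h"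
proof -
  have "inner_L2 l (\<lambda>\<xi>. a * f \<xi> + b * g \<xi>) h
      = (\<integral>\<xi>. a * (f \<xi> * h \<xi>) + b * (g \<xi> * h \<xi>) \<partial>lebesgue_on (Omega l))"
    by (simp add: inner_L2_def algebra_simps)
  also have "\<dots> = a * inner_L2 l f h + b * inner_L2 l g h"
    using assms by (simp add: inner_L2_def L2_integrable_mult)
  finally show ?thesis .
qed

lemma inner_L2_commute: "inner_L2 l f g = inner_L2 l g f"
  by (simp add: inner_L2_def mult.commute)

lemma inner_L2_lincomb_right:
  assumes "f \<in> L2 l" "g \<in> L2 l" "h \<in> L2 l"
  shows "inner_L2 l h (\<lambda>\<xi>. a * f \<xi> + b * g \<xi>) = a * inner_L2 l h f + b * inner_L2 l h g"
  using inner_L2_lincomb[OF assms] by (simp add: inner_L2_commute)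

lemma inner_L2_nonneg: "0 \<le> inner_L2 l f f"
  by (simp add: inner_L2_def)

lemma inner_L2_cong:
  assumes "f \<in> L2 l" "f' \<in> L2 l" "g \<in> L2 l" "g' \<in> L2 l"
    and "AE \<xi> in lebesgue_on (Omega l). f \<xi> = f' \<xi>" "AE \<xi> in lebesgue_on (Omega l). g \<xi> = g' \<xi>"
  shows "inner_L2 l f g = inner_L2 l f' g'"
  unfolding inner_L2_def using assms by (intro integral_cong_AE) (auto simp: L2_def)

lemma norm_L2_nonneg [simp]: "0 \<le> norm_L2 l f"
  by (simp add: norm_L2_def inner_L2_nonneg)

lemma norm_L2_sq: "(norm_L2 l f)\<^sup>2 = inner_L2 l f f"
  by (simp add: norm_L2_def inner_L2_nonneg)

text \<open>
  The polynomial \<open>t \<mapsto> \<parallel>t f + g\<parallel>\<^sup>2\<close> is nonnegative at its minimum.  If \<open>\<parallel>f\<parallel> = 0\<close>, it is affine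
  and nonnegative, so its slope \<open>2 (f, g)\<close> vanishes.
\<close>

lemma inner_L2_Cauchy_Schwarz:
  assumes f: "f \<in> L2 l" and g: "g \<in> L2 l"
  shows "\<bar>inner_L2 l f g\<bar> \<le> norm_L2 l f * norm_L2 l g"
proof -
  have q: "0 \<le> t\<^sup>2 * inner_L2 l f f + 2 * t * inner_L2 l f g + inner_L2 l g g" for t
  proof -
    have "0 \<le> inner_L2 l (\<lambda>\<xi>. t * f \<xi> + 1 * g \<xi>) (\<lambda>\<xi>. t * f \<xi> + 1 * g \<xi>)" by (rule inner_L2_nonneg)
    also have "\<dots> = t * (t * inner_L2 l f f + 1 * inner_L2 l f g) + 1 * (t * inner_L2 l f g + 1 * inner_L2 l g g)"
      by (simp only: inner_L2_lincomb[OF f g L2_lincomb[OF f g]] inner_L2_lincomb_right[OF f g f]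
          inner_L2_lincomb_right[OF f g g] inner_L2_commute[of l g f])
    finally show ?thesis by (simp add: power2_eq_square algebra_simps)
  qed
  have "(inner_L2 l f g)\<^sup>2 \<le> inner_L2 l f f * inner_L2 l g g"
  proof (cases "inner_L2 l f f = 0")
    case True
    have "inner_L2 l f g = 0"
    proof (rule ccontr)
      assume n: "inner_L2 l f g \<noteq> 0"
      have "0 \<le> 2 * (- (inner_L2 l g g + 1) / (2 * inner_L2 l f g)) * inner_L2 l f g + inner_L2 l g g"
        using q[of "- (inner_L2 l g g + 1) / (2 * inner_L2 l f g)"] True by simp
      with n show False by (simp add: field_simps)
    qed
    then show ?thesis by (simp add: True)
  next
    case False
    then have p: "inner_L2 l f f > 0" using inner_L2_nonneg[of l f] by simp
    have "0 \<le> inner_L2 l f f * ((inner_L2 l f g / inner_L2 l f f)\<^sup>2 * inner_L2 l f f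
      + 2 * (- (inner_L2 l f g / inner_L2 l f f)) * inner_L2 l f g + inner_L2 l g g)"
      using q[of "- (inner_L2 l f g / inner_L2 l f f)"] p by (intro mult_nonneg_nonneg) auto
    also have "\<dots> = inner_L2 l f f * inner_L2 l g g - (inner_L2 l f g)\<^sup>2"
      using p by (simp add: field_simps power2_eq_square)
    finally show ?thesis by simp
  qed
  then have "sqrt ((inner_L2 l f g)\<^sup>2) \<le> sqrt (inner_L2 l f f * inner_L2 l g g)"
    by (rule real_sqrt_le_mono)
  then show ?thesis by (simp add: norm_L2_def real_sqrt_mult)
qed

lemma norm_L2_eq_0_iff:
  assumes "f \<in> L2 l"
  shows "norm_L2 l f = 0 \<longleftrightarrow> (AE \<xi> in lebesgue_on (Omega l). f \<xi> = 0)"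
proof -
  have "norm_L2 l f = 0 \<longleftrightarrow> (\<integral>\<xi>. (f \<xi>)\<^sup>2 \<partial>lebesgue_on (Omega l)) = 0"
    by (simp add: norm_L2_def inner_L2_def power2_eq_square)
  also have "\<dots> \<longleftrightarrow> (AE \<xi> in lebesgue_on (Omega l). f \<xi> = 0)"
    using assms by (subst integral_nonneg_eq_0_iff_AE) (auto simp: L2_def)
  finally show ?thesis .
qed

lemma norm_L2_triangle:
  assumes f: "f \<in> L2 l" and g: "g \<in> L2 l"
  shows "norm_L2 l (\<lambda>\<xi>. a * f \<xi> + b * g \<xi>) \<le> \<bar>a\<bar> * norm_L2 l f + \<bar>b\<bar> * norm_L2 l g"
proof (rule power2_le_imp_le)
  have "(norm_L2 l (\<lambda>\<xi>. a * f \<xi> + b * g \<xi>))\<^sup>2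
    = a * (a * inner_L2 l f f + b * inner_L2 l f g) + b * (a * inner_L2 l f g + b * inner_L2 l g g)"
    by (simp only: norm_L2_sq inner_L2_lincomb[OF f g L2_lincomb[OF f g]] inner_L2_lincomb_right[OF f g f]
        inner_L2_lincomb_right[OF f g g] inner_L2_commute[of l g f])
  also have "\<dots> = a\<^sup>2 * (norm_L2 l f)\<^sup>2 + 2 * (a * b * inner_L2 l f g) + b\<^sup>2 * (norm_L2 l g)\<^sup>2"
    by (simp add: norm_L2_sq) (simp add: power2_eq_square algebra_simps)
  finally have eq: "(norm_L2 l (\<lambda>\<xi>. a * f \<xi> + b * g \<xi>))\<^sup>2
    = a\<^sup>2 * (norm_L2 l f)\<^sup>2 + 2 * (a * b * inner_L2 l f g) + b\<^sup>2 * (norm_L2 l g)\<^sup>2" .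
  have "a * b * inner_L2 l f g \<le> \<bar>a * b\<bar> * \<bar>inner_L2 l f g\<bar>"
    by (metis abs_ge_self abs_mult)
  also have "\<dots> \<le> \<bar>a * b\<bar> * (norm_L2 l f * norm_L2 l g)"
    by (intro mult_left_mono inner_L2_Cauchy_Schwarz f g) simp
  finally show "(norm_L2 l (\<lambda>\<xi>. a * f \<xi> + b * g \<xi>))\<^sup>2 \<le> (\<bar>a\<bar> * norm_L2 l f + \<bar>b\<bar> * norm_L2 l g)\<^sup>2"
    unfolding eq power2_sum power_mult_distrib power2_abs abs_mult by (simp add: mult_ac)
qed simp

text \<open>
  Iterated integrals need functions that are measurable for the product of the Borel algebras,
  whereas elements of \<open>L\<^sup>2\<close> are only Lebesgue measurable on the plate.  They are therefore replaced
  by Borel functions that vanish outside the plate.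
\<close>

lemma borel_representative:
  fixes k :: "real \<times> real \<Rightarrow> real"
  assumes "k \<in> borel_measurable (lebesgue_on (Omega l))"
  obtains g where "g \<in> borel_measurable borel" "AE \<xi> in lborel. g \<xi> = indicator (Omega l) \<xi> * k \<xi>"
    "\<And>\<xi>. \<xi> \<notin> Omega l \<Longrightarrow> g \<xi> = 0"
proof -
  have "(\<lambda>\<xi>. indicator (Omega l) \<xi> *\<^sub>R k \<xi>) \<in> borel_measurable lebesgue"
    using assms by (subst borel_measurable_restrict_space_iff[symmetric]) auto
  then obtain g where g: "g \<in> borel_measurable lborel" "AE \<xi> in lborel. indicator (Omega l) \<xi> *\<^sub>R k \<xi> = g \<xi>"
    using completion_ex_borel_measurable_real by blast
  show thesis
  proof (rule that[of "\<lambda>\<xi>. indicator (Omega l) \<xi> * g \<xi>"])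
    show "(\<lambda>\<xi>. indicator (Omega l) \<xi> * g \<xi>) \<in> borel_measurable borel" using g(1) by simp
    show "AE \<xi> in lborel. indicator (Omega l) \<xi> * g \<xi> = indicator (Omega l) \<xi> * k \<xi>"
      using g(2) by eventually_elim (auto simp: indicator_def)
  qed simp
qed

lemma integral_Omega_eq_lborel:
  fixes F :: "real \<times> real \<Rightarrow> real"
  assumes G: "G \<in> borel_measurable borel" and eq: "AE \<xi> in lborel. G \<xi> = indicator (Omega l) \<xi> * F \<xi>"
  shows "(\<integral>\<xi>. F \<xi> \<partial>lebesgue_on (Omega l)) = (\<integral>\<xi>. G \<xi> \<partial>lborel)"
    and "integrable (lebesgue_on (Omega l)) F \<longleftrightarrow> integrable lborel G"
proof -
  have Gl: "G \<in> borel_measurable lebesgue" using G by (intro measurable_completion) auto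
  have eq': "AE \<xi> in lebesgue. G \<xi> = indicator (Omega l) \<xi> * F \<xi>"
    using eq by (rule AE_completion)
  have m: "(\<lambda>\<xi>. indicator (Omega l) \<xi> * F \<xi>) \<in> borel_measurable lebesgue"
    using borel_measurable_AE[OF Gl eq'] .
  have "(\<integral>\<xi>. F \<xi> \<partial>lebesgue_on (Omega l)) = (\<integral>\<xi>. indicator (Omega l) \<xi> * F \<xi> \<partial>lebesgue)"
    by (subst integral_restrict_space) auto
  also have "\<dots> = (\<integral>\<xi>. G \<xi> \<partial>lebesgue)"
    using eq' m Gl by (intro integral_cong_AE) auto
  also have "\<dots> = (\<integral>\<xi>. G \<xi> \<partial>lborel)" using G by (intro integral_completion) auto
  finally show "(\<integral>\<xi>. F \<xi> \<partial>lebesgue_on (Omega l)) = (\<integral>\<xi>. G \<xi> \<partial>lborel)" .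
  have "integrable (lebesgue_on (Omega l)) F \<longleftrightarrow> integrable lebesgue (\<lambda>\<xi>. indicator (Omega l) \<xi> * F \<xi>)"
    by (subst integrable_restrict_space) auto
  also have "\<dots> \<longleftrightarrow> integrable lebesgue G"
    using eq' m Gl by (intro integrable_cong_AE) auto
  also have "\<dots> \<longleftrightarrow> integrable lborel G" using G by (intro integrable_completion) auto
  finally show "integrable (lebesgue_on (Omega l)) F \<longleftrightarrow> integrable lborel G" .
qed

definition tensor :: "(real \<Rightarrow> real) \<Rightarrow> (real \<Rightarrow> real) \<Rightarrow> real \<times> real \<Rightarrow> real" where
  "tensor a b = (\<lambda>(x, y). a x * b y)"

lemma Dx_tensor: "smooth a \<Longrightarrow> Dx (tensor a b) = tensor (deriv a) b"
  unfolding Dx_def tensor_def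
  by (intro ext) (auto intro!: DERIV_imp_deriv derivative_eq_intros smooth_has_deriv)

lemma Dy_tensor: "smooth b \<Longrightarrow> Dy (tensor a b) = tensor a (deriv b)"
  unfolding Dy_def tensor_def
  by (intro ext) (auto intro!: DERIV_imp_deriv derivative_eq_intros smooth_has_deriv)

lemma smooth_continuous: "smooth a \<Longrightarrow> continuous_on A a"
  by (rule continuous_on_subset[OF Ck_continuous[of 0 a]]) (auto simp: smooth_def)

lemma continuous_tensor:
  assumes "smooth a" "smooth b"
  shows "continuous_on A (tensor a b)"
proof -
  have "continuous_on A (\<lambda>\<xi>. a (fst \<xi>) * b (snd \<xi>))"
    by (intro continuous_intros continuous_on_compose2[OF smooth_continuous[OF assms(1)]]
        continuous_on_compose2[OF smooth_continuous[OF assms(2)]]) auto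
  then show ?thesis by (simp add: tensor_def case_prod_unfold)
qed

lemma times_cont_diff_tensor: "smooth a \<Longrightarrow> smooth b \<Longrightarrow> times_cont_diff k (tensor a b)"
proof (induction k arbitrary: a b)
  case 0
  then show ?case by (simp add: continuous_tensor)
next
  case (Suc k)
  have "(\<lambda>s. tensor a b (s, y)) differentiable (at x)" "(\<lambda>s. tensor a b (x, s)) differentiable (at y)" for x y
    using Suc.prems[THEN smooth_has_deriv(1)] unfolding tensor_def real_differentiable_def
    by (auto intro!: derivative_eq_intros exI)
  then show ?case
    using Suc continuous_tensor by (auto simp: Dx_tensor Dy_tensor smooth_has_deriv)
qed

lemma tensor_test_function:
  assumes a: "a \<in> bump 0 pi" and b: "b \<in> bump (- l) l"
  shows "tensor a b \<in> test_functions (Omega l)"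
proof -
  obtain p q where pq: "0 < p" "p < q" "q < pi" "\<And>x. x \<notin> {p..q} \<Longrightarrow> a x = 0" and sa: "smooth a"
    using a by (auto simp: bump_def)
  obtain r s where rs: "-l < r" "r < s" "s < l" "\<And>y. y \<notin> {r..s} \<Longrightarrow> b y = 0" and sb: "smooth b"
    using b by (auto simp: bump_def)
  have "compact ({p..q} \<times> {r..s})" by (intro compact_Times) auto
  moreover have "{p..q} \<times> {r..s} \<subseteq> Omega l" using pq rs by (auto simp: Omega_def)
  moreover have "tensor a b \<xi> = 0" if "\<xi> \<notin> {p..q} \<times> {r..s}" for \<xi>
    using that pq(4)[of "fst \<xi>"] rs(4)[of "snd \<xi>"] by (cases \<xi>) (auto simp: tensor_def)
  ultimately show ?thesis
    unfolding test_functions_def using times_cont_diff_tensor[OF sa sb] by blast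
qed

text \<open>
  Products of bumps converge boundedly to the indicators of open boxes, and boxes generate the
  Borel sets.
\<close>

theorem fundamental_lemma_rectangle:
  fixes g :: "real \<times> real \<Rightarrow> real"
  assumes gi: "integrable lborel g" and g0: "\<And>\<xi>. \<xi> \<notin> {a<..<b} \<times> {c<..<d} \<Longrightarrow> g \<xi> = 0"
    and z: "\<And>\<theta> \<psi>. \<theta> \<in> bump a b \<Longrightarrow> \<psi> \<in> bump c d \<Longrightarrow> (\<integral>\<xi>. g \<xi> * tensor \<theta> \<psi> \<xi> \<partial>lborel) = 0"
  shows "AE \<xi> in lborel. g \<xi> = 0"
proof -
  have gm [measurable]: "g \<in> borel_measurable borel" using gi by auto
  have box0: "(\<integral>\<xi>. g \<xi> * (indicator {p<..<q} (fst \<xi>) * indicator {r<..<s} (snd \<xi>)) \<partial>lborel) = 0"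
    if h: "a \<le> p" "p < q" "q \<le> b" "c \<le> r" "r < s" "s \<le> d" for p q r s
  proof -
    let ?t = "\<lambda>n. tensor (approx_ind p q (Suc n)) (approx_ind r s (Suc n))"
    have tm [measurable]: "?t n \<in> borel_measurable borel" for n
      by (intro borel_measurable_continuous_onI continuous_tensor smooth_approx_ind)
    have "(\<lambda>n. \<integral>\<xi>. g \<xi> * ?t n \<xi> \<partial>lborel) \<longlonglongrightarrow>
      (\<integral>\<xi>. g \<xi> * (indicator {p<..<q} (fst \<xi>) * indicator {r<..<s} (snd \<xi>)) \<partial>lborel)"
    proof (rule integral_dominated_convergence[where w = "\<lambda>\<xi>. \<bar>g \<xi>\<bar>"])
      have "{p<..<q} \<times> {r<..<s} \<in> sets borel" by (intro borel_open open_Times) auto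
      then have "(\<lambda>\<xi>. indicator ({p<..<q} \<times> {r<..<s}) \<xi> :: real) \<in> borel_measurable borel" by simp
      then show "(\<lambda>\<xi>. g \<xi> * (indicator {p<..<q} (fst \<xi>) * indicator {r<..<s} (snd \<xi>)))
          \<in> borel_measurable lborel"
        by (auto simp: indicator_times)
      show "AE \<xi> in lborel. (\<lambda>n. g \<xi> * ?t n \<xi>) \<longlonglongrightarrow>
          g \<xi> * (indicator {p<..<q} (fst \<xi>) * indicator {r<..<s} (snd \<xi>))"
        unfolding tensor_def case_prod_unfold
        by (intro AE_I2 tendsto_intros LIMSEQ_Suc approx_ind_limit)
      show "AE \<xi> in lborel. norm (g \<xi> * ?t n \<xi>) \<le> \<bar>g \<xi>\<bar>" for n
      proof (rule AE_I2)
        fix \<xi>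
        have "\<bar>?t n \<xi>\<bar> \<le> 1" unfolding tensor_def case_prod_unfold abs_mult
          by (intro mult_le_one approx_ind_bound) auto
        then show "norm (g \<xi> * ?t n \<xi>) \<le> \<bar>g \<xi>\<bar>" by (simp add: abs_mult mult_left_le)
      qed
    qed (use gi in auto)
    moreover have "(\<integral>\<xi>. g \<xi> * ?t n \<xi> \<partial>lborel) = 0" for n
      using h by (intro z approx_ind_bump) auto
    ultimately show ?thesis by (simp add: LIMSEQ_const_iff)
  qed
  let ?I = "\<lambda>A. \<integral>\<xi>. indicator A \<xi> * g \<xi> \<partial>lborel"
  have box: "?I (box u v) = 0" for u v :: "real \<times> real"
  proof -
    obtain u1 u2 v1 v2 where uv: "u = (u1, u2)" "v = (v1, v2)" by (cases u, cases v)
    define p q r s where pqrs: "p = max u1 a" "q = min v1 b" "r = max u2 c" "s = min v2 d"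
    have eq: "indicator (box u v) \<xi> * g \<xi> = g \<xi> * (indicator {p<..<q} (fst \<xi>) * indicator {r<..<s} (snd \<xi>))" for \<xi>
      using g0[of \<xi>]
      by (cases \<xi>) (auto simp: uv pqrs box_def Basis_prod_def indicator_def)
    show ?thesis unfolding eq
    proof (cases "p < q \<and> r < s")
      case True
      then show "(\<integral>\<xi>. g \<xi> * (indicator {p<..<q} (fst \<xi>) * indicator {r<..<s} (snd \<xi>)) \<partial>lborel) = 0"
        by (intro box0) (auto simp: pqrs)
    next
      case False
      then have "{p<..<q} = {} \<or> {r<..<s} = {}" by auto
      then show "(\<integral>\<xi>. g \<xi> * (indicator {p<..<q} (fst \<xi>) * indicator {r<..<s} (snd \<xi>)) \<partial>lborel) = 0"
        by auto
    qed
  qed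
  have tot: "(\<integral>\<xi>. g \<xi> \<partial>lborel) = 0"
  proof -
    have "(\<lambda>\<xi>. indicator (box (a, c) (b, d)) \<xi> * g \<xi>) = g"
    proof
      show "indicator (box (a, c) (b, d)) \<xi> * g \<xi> = g \<xi>" for \<xi>
        using g0[of \<xi>] by (cases \<xi>) (auto simp: box_def Basis_prod_def indicator_def)
    qed
    then show ?thesis using box[of "(a, c)" "(b, d)"] by simp
  qed
  have "?I A = 0" if "A \<in> sets borel" for A
  proof -
    have "Int_stable (range (\<lambda>(a, b). box a b :: (real \<times> real) set))"
      by (auto simp: Int_stable_def box_Int_box)
    moreover have "range (\<lambda>(a, b). box a b :: (real \<times> real) set) \<subseteq> Pow UNIV" by simp
    moreover have "A \<in> sigma_sets UNIV (range (\<lambda>(a, b). box a b :: (real \<times> real) set))"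
      using that by (simp add: borel_eq_box)
    ultimately show ?thesis
    proof (induction rule: sigma_sets_induct_disjoint)
      case (compl A)
      then have A: "A \<in> sets borel" by (simp add: borel_eq_box)
      have "indicator (UNIV - A) \<xi> * g \<xi> = g \<xi> - indicator A \<xi> * g \<xi>" for \<xi>
        by (auto simp: indicator_def)
      moreover have "integrable lborel (\<lambda>\<xi>. indicator A \<xi> * g \<xi>)"
        using integrable_mult_indicator[OF _ gi, of A] A by simp
      ultimately show ?case using gi tot compl by simp
    next
      case (union A)
      then have A: "A i \<in> sets borel" for i by (auto simp: borel_eq_box)
      have "set_integrable lborel (\<Union>i. A i) g"
        unfolding set_integrable_def using gi A by (intro integrable_mult_indicator) auto
      moreover have "A i \<inter> A j = {}" if "i \<noteq> j" for i j
        using union(1) that by (auto simp: disjoint_family_on_def)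
      ultimately have "(LINT \<xi>:(\<Union>i. A i)|lborel. g \<xi>) = (\<Sum>i. (LINT \<xi>:(A i)|lborel. g \<xi>))"
        using A by (intro lebesgue_integral_countable_add) auto
      then show ?case using union by (simp add: set_lebesgue_integral_def)
    qed (auto simp: box)
  qed
  then show ?thesis
    using sigma_finite_measure.density_zero[OF sigma_finite_lborel gi]
    by (simp add: set_lebesgue_integral_def)
qed

corollary fundamental_lemma:
  assumes k: "integrable (lebesgue_on (Omega l)) k"
    and z: "\<And>a b. a \<in> bump 0 pi \<Longrightarrow> b \<in> bump (- l) l \<Longrightarrow>
      (\<integral>\<xi>. k \<xi> * tensor a b \<xi> \<partial>lebesgue_on (Omega l)) = 0"
  shows "AE \<xi> in lebesgue_on (Omega l). k \<xi> = 0"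
proof -
  obtain g where g: "g \<in> borel_measurable borel" "AE \<xi> in lborel. g \<xi> = indicator (Omega l) \<xi> * k \<xi>"
    and g0: "\<And>\<xi>. \<xi> \<notin> Omega l \<Longrightarrow> g \<xi> = 0"
    by (rule borel_representative[OF borel_measurable_integrable[OF k]]) (rule that)
  have "AE \<xi> in lborel. g \<xi> = 0"
  proof (rule fundamental_lemma_rectangle)
    show "integrable lborel g" using integral_Omega_eq_lborel(2)[OF g] k by simp
    show "g \<xi> = 0" if "\<xi> \<notin> {0<..<pi} \<times> {- l<..<l}" for \<xi>
      using g0[of \<xi>] that by (simp add: Omega_def)
    fix a b assume ab: "a \<in> bump 0 pi" "b \<in> bump (- l) l"
    then have "tensor a b \<in> borel_measurable borel"
      by (intro borel_measurable_continuous_onI continuous_tensor) (auto simp: bump_def)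
    then have "(\<integral>\<xi>. k \<xi> * tensor a b \<xi> \<partial>lebesgue_on (Omega l)) = (\<integral>\<xi>. g \<xi> * tensor a b \<xi> \<partial>lborel)"
      using g(2) by (intro integral_Omega_eq_lborel(1) borel_measurable_times g(1)) (auto elim!: eventually_mono)
    then show "(\<integral>\<xi>. g \<xi> * tensor a b \<xi> \<partial>lborel) = 0" using z[OF ab] by simp
  qed
  then have "AE \<xi> in lborel. \<xi> \<in> Omega l \<longrightarrow> k \<xi> = 0" using g(2)
    by eventually_elim (auto simp: indicator_def)
  then show ?thesis by (subst AE_restrict_space_iff) (auto intro: AE_completion)
qed


section \<open>Weak partial derivatives\<close>

abbreviation DD :: "nat \<Rightarrow> nat \<Rightarrow> (real \<times> real \<Rightarrow> real) \<Rightarrow> real \<times> real \<Rightarrow> real" where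
  "DD i j \<phi> \<equiv> (Dx ^^ i) ((Dy ^^ j) \<phi>)"

lemma smooth2_D:
  assumes "\<forall>k. times_cont_diff k f"
  shows "((\<lambda>s. f (s, y)) has_real_derivative Dx f (x, y)) (at x)"
    and "((\<lambda>s. f (x, s)) has_real_derivative Dy f (x, y)) (at y)"
    and "\<forall>k. times_cont_diff k (Dx f)" and "\<forall>k. times_cont_diff k (Dy f)"
    and "continuous_on A f"
proof -
  have S: "times_cont_diff (Suc k) f" for k using assms by blast
  have d: "(\<lambda>s. f (s, y)) differentiable (at x)" "(\<lambda>s. f (x, s)) differentiable (at y)"
    using S[of 0] by auto
  show "((\<lambda>s. f (s, y)) has_real_derivative Dx f (x, y)) (at x)"
    using d(1) unfolding Dx_def by (auto simp: DERIV_deriv_iff_real_differentiable)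
  show "((\<lambda>s. f (x, s)) has_real_derivative Dy f (x, y)) (at y)"
    using d(2) unfolding Dy_def by (auto simp: DERIV_deriv_iff_real_differentiable)
  show "\<forall>k. times_cont_diff k (Dx f)" "\<forall>k. times_cont_diff k (Dy f)" using S by auto
  have "continuous_on UNIV f" using S[of 0] by simp
  then show "continuous_on A f" using continuous_on_subset by blast
qed

lemma test_function_D:
  assumes "\<phi> \<in> test_functions A"
  shows "Dx \<phi> \<in> test_functions A" and "Dy \<phi> \<in> test_functions A"
proof -
  obtain K where K: "compact K" "K \<subseteq> A" "\<And>\<xi>. \<xi> \<notin> K \<Longrightarrow> \<phi> \<xi> = 0" and s: "\<forall>k. times_cont_diff k \<phi>"
    using assms by (auto simp: test_functions_def)
  have "Dx \<phi> \<xi> = 0 \<and> Dy \<phi> \<xi> = 0" if out: "\<xi> \<notin> K" for \<xi>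
  proof -
    obtain x y where xy: "\<xi> = (x, y)" by (cases \<xi>)
    have "open (- K)" using compact_imp_closed[OF K(1)] by (rule open_Compl)
    then obtain U V where UV: "open U" "open V" "(x, y) \<in> U \<times> V" "U \<times> V \<subseteq> - K"
      using out xy open_prod_elim by (metis ComplI)
    have "eventually (\<lambda>s. s \<in> U) (nhds x)" "eventually (\<lambda>s. s \<in> V) (nhds y)"
      using UV by (auto intro: eventually_nhds_in_open)
    then have "eventually (\<lambda>s. \<phi> (s, y) = 0) (nhds x)" "eventually (\<lambda>s. \<phi> (x, s) = 0) (nhds y)"
      using UV by (auto elim!: eventually_mono intro!: K(3))
    then have "deriv (\<lambda>s. \<phi> (s, y)) x = deriv (\<lambda>_. 0) x" "deriv (\<lambda>s. \<phi> (x, s)) y = deriv (\<lambda>_. 0) y"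
      by (intro deriv_cong_ev refl; simp)+
    then show ?thesis by (simp add: xy Dx_def Dy_def)
  qed
  then show "Dx \<phi> \<in> test_functions A" "Dy \<phi> \<in> test_functions A"
    using K smooth2_D[OF s] unfolding test_functions_def by blast+
qed

lemma test_function_DD: "\<phi> \<in> test_functions A \<Longrightarrow> DD i j \<phi> \<in> test_functions A"
proof (induction i)
  case 0
  then show ?case by (induction j) (auto intro: test_function_D)
qed (auto intro: test_function_D)

lemma test_function_L2:
  assumes "\<phi> \<in> test_functions A"
  shows "\<phi> \<in> L2 l"
proof -
  obtain K where K: "compact K" "\<And>\<xi>. \<xi> \<notin> K \<Longrightarrow> \<phi> \<xi> = 0" and s: "\<forall>k. times_cont_diff k \<phi>"
    using assms by (auto simp: test_functions_def)
  have "bounded (\<phi> ` K)"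
    by (intro compact_imp_bounded compact_continuous_image smooth2_D(5)[OF s] K(1))
  then obtain C where C: "\<And>\<xi>. \<xi> \<in> K \<Longrightarrow> \<bar>\<phi> \<xi>\<bar> \<le> C" unfolding bounded_iff by auto
  show ?thesis
  proof (rule L2_bounded)
    show "\<phi> \<in> borel_measurable (lebesgue_on (Omega l))"
      by (intro continuous_imp_measurable_on_sets_lebesgue smooth2_D(5)[OF s]) simp
    show "\<bar>\<phi> \<xi>\<bar> \<le> max C 0" for \<xi>
      using K(2)[of \<xi>] C[of \<xi>] by (cases "\<xi> \<in> K") auto
  qed
qed

text \<open>
  Everything that depends only on classes modulo null sets may thus be computed from any weak
  derivative, in place of the arbitrary one that \<^const>\<open>weak_partial\<close> selects.
\<close>

lemma weak_partial_unique:
  assumes w: "w \<in> L2 l" "w' \<in> L2 l"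
    and h: "has_weak_partial l i j u w" "has_weak_partial l i j u w'"
  shows "AE \<xi> in lebesgue_on (Omega l). w \<xi> = w' \<xi>"
proof -
  have "AE \<xi> in lebesgue_on (Omega l). 1 * w \<xi> + (-1) * w' \<xi> = 0"
  proof (rule fundamental_lemma)
    show "integrable (lebesgue_on (Omega l)) (\<lambda>\<xi>. 1 * w \<xi> + (-1) * w' \<xi>)"
      by (intro L2_integrable L2_lincomb w)
    fix a b assume ab: "a \<in> bump 0 pi" "b \<in> bump (- l) l"
    have t: "tensor a b \<in> test_functions (Omega l)" by (rule tensor_test_function[OF ab])
    have "(-1) ^ (i + j) * inner_L2 l w (tensor a b) = (-1) ^ (i + j) * inner_L2 l w' (tensor a b)"
      using h t unfolding has_weak_partial_def by metis
    then have "inner_L2 l (\<lambda>\<xi>. 1 * w \<xi> + (-1) * w' \<xi>) (tensor a b) = 0"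
      by (subst inner_L2_lincomb[OF w test_function_L2[OF t]]) simp
    then show "(\<integral>\<xi>. (1 * w \<xi> + (-1) * w' \<xi>) * tensor a b \<xi> \<partial>lebesgue_on (Omega l)) = 0"
      by (simp add: inner_L2_def)
  qed
  then show ?thesis by eventually_elim simp
qed

lemma has_weak_partial_lincomb:
  assumes "u \<in> L2 l" "v \<in> L2 l" "w \<in> L2 l" "z \<in> L2 l"
    and "has_weak_partial l i j u w" "has_weak_partial l i j v z"
  shows "has_weak_partial l i j (\<lambda>\<xi>. a * u \<xi> + b * v \<xi>) (\<lambda>\<xi>. a * w \<xi> + b * z \<xi>)"
  unfolding has_weak_partial_def
proof
  fix \<phi> assume t: "\<phi> \<in> test_functions (Omega l)"
  show "inner_L2 l (\<lambda>\<xi>. a * u \<xi> + b * v \<xi>) (DD i j \<phi>)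
    = (-1) ^ (i + j) * inner_L2 l (\<lambda>\<xi>. a * w \<xi> + b * z \<xi>) \<phi>"
    using assms(5,6)[unfolded has_weak_partial_def, rule_format, OF t]
    by (simp add: inner_L2_lincomb assms(1-4) test_function_L2[OF t]
        test_function_L2[OF test_function_DD[OF t]] algebra_simps)
qed

lemma H2_L2: "u \<in> H2 l \<Longrightarrow> u \<in> L2 l"
  by (simp add: H2_def)

lemma weak_partial_spec:
  assumes "u \<in> H2 l" "i + j \<le> 2"
  shows "weak_partial l i j u \<in> L2 l" and "has_weak_partial l i j u (weak_partial l i j u)"
proof -
  have "\<exists>w. w \<in> L2 l \<and> has_weak_partial l i j u w" using assms by (auto simp: H2_def)
  then have "weak_partial l i j u \<in> L2 l \<and> has_weak_partial l i j u (weak_partial l i j u)"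
    unfolding weak_partial_def by (rule someI_ex)
  then show "weak_partial l i j u \<in> L2 l" "has_weak_partial l i j u (weak_partial l i j u)" by auto
qed

lemma H2_lincomb:
  assumes "u \<in> H2 l" "v \<in> H2 l"
  shows "(\<lambda>\<xi>. a * u \<xi> + b * v \<xi>) \<in> H2 l"
  unfolding H2_def mem_Collect_eq
proof (intro conjI allI impI)
  show "(\<lambda>\<xi>. a * u \<xi> + b * v \<xi>) \<in> L2 l" using assms by (intro L2_lincomb H2_L2)
  fix i j :: nat assume ij: "i + j \<le> 2"
  show "\<exists>w\<in>L2 l. has_weak_partial l i j (\<lambda>\<xi>. a * u \<xi> + b * v \<xi>) w"
  proof
    show "has_weak_partial l i j (\<lambda>\<xi>. a * u \<xi> + b * v \<xi>)
        (\<lambda>\<xi>. a * weak_partial l i j u \<xi> + b * weak_partial l i j v \<xi>)"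
      using assms ij by (intro has_weak_partial_lincomb weak_partial_spec H2_L2)
  qed (use assms ij in \<open>intro L2_lincomb weak_partial_spec\<close>)
qed

lemma weak_partial_lincomb:
  assumes "u \<in> H2 l" "v \<in> H2 l" "i + j \<le> 2"
  shows "AE \<xi> in lebesgue_on (Omega l). weak_partial l i j (\<lambda>\<xi>. a * u \<xi> + b * v \<xi>) \<xi>
    = a * weak_partial l i j u \<xi> + b * weak_partial l i j v \<xi>"
  by (rule weak_partial_unique[where u = "\<lambda>\<xi>. a * u \<xi> + b * v \<xi>" and i = i and j = j];
    intro weak_partial_spec has_weak_partial_lincomb L2_lincomb H2_lincomb H2_L2 assms)

text \<open>
  The selected second derivatives are first-order weak derivatives of the selected \<open>u\<^sub>x\<close>, which
  makes one-dimensional calculus applicable to \<open>u\<^sub>x\<close>.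
\<close>

lemma weak_partial_iterate:
  assumes "u \<in> H2 l"
  shows "has_weak_partial l 1 0 (weak_partial l 1 0 u) (weak_partial l 2 0 u)"
    and "has_weak_partial l 0 1 (weak_partial l 1 0 u) (weak_partial l 1 1 u)"
proof -
  have w: "inner_L2 l u (DD i j \<phi>) = (-1) ^ (i + j) * inner_L2 l (weak_partial l i j u) \<phi>"
    if "\<phi> \<in> test_functions (Omega l)" "i + j \<le> 2" for \<phi> i j
    using weak_partial_spec(2)[OF assms that(2)] that(1) by (auto simp: has_weak_partial_def)
  show "has_weak_partial l 1 0 (weak_partial l 1 0 u) (weak_partial l 2 0 u)"
    unfolding has_weak_partial_def
  proof
    fix \<phi> assume t: "\<phi> \<in> test_functions (Omega l)"
    show "inner_L2 l (weak_partial l 1 0 u) (DD 1 0 \<phi>) = (-1) ^ (1 + 0) * inner_L2 l (weak_partial l 2 0 u) \<phi>"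
      using w[OF test_function_D(1)[OF t], of 1 0] w[OF t, of 2 0] by (simp add: numeral_2_eq_2)
  qed
  show "has_weak_partial l 0 1 (weak_partial l 1 0 u) (weak_partial l 1 1 u)"
    unfolding has_weak_partial_def
  proof
    fix \<phi> assume t: "\<phi> \<in> test_functions (Omega l)"
    show "inner_L2 l (weak_partial l 1 0 u) (DD 0 1 \<phi>) = (-1) ^ (0 + 1) * inner_L2 l (weak_partial l 1 1 u) \<phi>"
      using w[OF test_function_D(2)[OF t], of 1 0] w[OF t, of 1 1] by simp
  qed
qed

section \<open>Reflection in \<open>y\<close>\<close>

definition reflect :: "(real \<times> real \<Rightarrow> real) \<Rightarrow> real \<times> real \<Rightarrow> real" where
  "reflect f = (\<lambda>(x, y). f (x, - y))"

abbreviation mirror :: "real \<times> real \<Rightarrow> real \<times> real" where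
  "mirror \<xi> \<equiv> (fst \<xi>, - snd \<xi>)"

lemma reflect_apply: "reflect f \<xi> = f (mirror \<xi>)"
  by (simp add: reflect_def case_prod_unfold)

lemma reflect_reflect [simp]: "reflect (reflect f) = f"
  by (simp add: reflect_def fun_eq_iff)

lemma torsional_eq: "torsional f = (\<lambda>\<xi>. 1 / 2 * f \<xi> + (- 1 / 2) * reflect f \<xi>)"
  by (auto simp: torsional_def reflect_def fun_eq_iff field_simps)

lemma mirror_Omega [simp]: "mirror \<xi> \<in> Omega l \<longleftrightarrow> \<xi> \<in> Omega l"
  by (cases \<xi>) (auto simp: Omega_def)

lemma mirror_measurable: "mirror \<in> lebesgue \<rightarrow>\<^sub>M lebesgue"
  and distr_mirror: "distr lebesgue lebesgue mirror = lebesgue"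
proof -
  define c :: "real \<times> real \<Rightarrow> real" where "c = (\<lambda>j. fst j - snd j)"
  have T: "(\<lambda>x. 0 + (\<Sum>j\<in>Basis. (c j * (x \<bullet> j)) *\<^sub>R j)) = mirror"
    by (rule ext) (auto simp: c_def Basis_prod_def sum.union_disjoint[symmetric] inner_prod_def prod_eq_iff)
  have c: "c j \<noteq> 0" if "j \<in> Basis" for j using that by (auto simp: c_def Basis_prod_def)
  show "mirror \<in> lebesgue \<rightarrow>\<^sub>M lebesgue"
    using lebesgue_affine_measurable[of c 0] c unfolding T by auto
  have "(\<Prod>j\<in>Basis. \<bar>c j\<bar>) = 1" by (rule prod.neutral) (auto simp: c_def Basis_prod_def)
  then show "distr lebesgue lebesgue mirror = lebesgue"
    using lebesgue_affine_euclidean[of c 0] c unfolding T by (auto simp: density_1)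
qed

lemma mirror_measurable_on: "mirror \<in> lebesgue_on (Omega l) \<rightarrow>\<^sub>M lebesgue_on (Omega l)"
  by (intro measurable_restrict_space3 mirror_measurable) auto

lemma distr_mirror_on: "distr (lebesgue_on (Omega l)) (lebesgue_on (Omega l)) mirror = lebesgue_on (Omega l)"
proof (rule measure_eqI)
  fix A assume "A \<in> sets (distr (lebesgue_on (Omega l)) (lebesgue_on (Omega l)) mirror)"
  then have A: "A \<in> sets (lebesgue_on (Omega l))" by simp
  then have A': "A \<in> sets lebesgue" "A \<subseteq> Omega l" by (auto simp: sets_restrict_space_iff)
  have eq: "mirror -` A \<inter> Omega l = mirror -` A" using A'(2) mirror_Omega by blast
  have "emeasure (distr (lebesgue_on (Omega l)) (lebesgue_on (Omega l)) mirror) A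
      = emeasure (lebesgue_on (Omega l)) (mirror -` A)"
    using A eq by (simp add: emeasure_distr[OF mirror_measurable_on])
  also have "\<dots> = emeasure lebesgue (mirror -` A)"
    using eq by (subst emeasure_restrict_space) auto
  also have "\<dots> = emeasure (distr lebesgue lebesgue mirror) A"
    using A' by (simp add: emeasure_distr[OF mirror_measurable])
  also have "\<dots> = emeasure (lebesgue_on (Omega l)) A"
    using A' by (subst emeasure_restrict_space) (auto simp: distr_mirror)
  finally show "emeasure (distr (lebesgue_on (Omega l)) (lebesgue_on (Omega l)) mirror) A
    = emeasure (lebesgue_on (Omega l)) A" .
qed simp

lemma AE_mirror:
  assumes "AE \<xi> in lebesgue_on (Omega l). P \<xi>"
  shows "AE \<xi> in lebesgue_on (Omega l). P (mirror \<xi>)"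
proof (rule AE_distrD[OF mirror_measurable_on])
  show "AE \<xi> in distr (lebesgue_on (Omega l)) (lebesgue_on (Omega l)) mirror. P \<xi>"
    using assms by (simp only: distr_mirror_on)
qed

lemma integral_mirror:
  fixes f :: "real \<times> real \<Rightarrow> real"
  assumes "f \<in> borel_measurable (lebesgue_on (Omega l))"
  shows "(\<integral>\<xi>. f (mirror \<xi>) \<partial>lebesgue_on (Omega l)) = (\<integral>\<xi>. f \<xi> \<partial>lebesgue_on (Omega l))"
    and "integrable (lebesgue_on (Omega l)) (\<lambda>\<xi>. f (mirror \<xi>)) \<longleftrightarrow> integrable (lebesgue_on (Omega l)) f"
  using integral_distr[OF mirror_measurable_on assms] integrable_distr_eq[OF mirror_measurable_on assms]
  by (simp_all add: distr_mirror_on)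

lemma reflect_L2:
  assumes "f \<in> L2 l"
  shows "reflect f \<in> L2 l"
proof -
  have m: "f \<in> borel_measurable (lebesgue_on (Omega l))" using assms by (simp add: L2_def)
  then have "(\<lambda>\<xi>. f (mirror \<xi>)) \<in> borel_measurable (lebesgue_on (Omega l))"
    using measurable_compose[OF mirror_measurable_on] by blast
  then have "reflect f \<in> borel_measurable (lebesgue_on (Omega l))" by (simp add: reflect_apply[abs_def])
  moreover have "integrable (lebesgue_on (Omega l)) (\<lambda>\<xi>. (reflect f \<xi>)\<^sup>2)"
    using integral_mirror(2)[of "\<lambda>\<xi>. (f \<xi>)\<^sup>2" l] assms m by (simp add: reflect_apply L2_def)
  ultimately show ?thesis by (simp add: L2_def)
qed

lemma inner_L2_reflect:
  assumes "f \<in> L2 l" "g \<in> L2 l"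
  shows "inner_L2 l (reflect f) (reflect g) = inner_L2 l f g"
proof -
  have "f \<in> borel_measurable (lebesgue_on (Omega l))" "g \<in> borel_measurable (lebesgue_on (Omega l))"
    using assms by (auto simp: L2_def)
  then have "(\<lambda>\<xi>. f \<xi> * g \<xi>) \<in> borel_measurable (lebesgue_on (Omega l))" by measurable
  from integral_mirror(1)[OF this] show ?thesis by (simp add: inner_L2_def reflect_apply)
qed

text \<open>
  Each derivative in \<open>y\<close> changes the sign of a reflected function; the factor \<open>c\<close> absorbs these
  signs in the induction on the order of differentiability.
\<close>

lemma smooth2_scaled_reflect:
  "times_cont_diff k f \<Longrightarrow> times_cont_diff k (\<lambda>\<xi>. c * reflect f \<xi>)"
  and Dx_scaled_reflect: "\<forall>k. times_cont_diff k g \<Longrightarrow> Dx (\<lambda>\<xi>. c * reflect g \<xi>) = (\<lambda>\<xi>. c * reflect (Dx g) \<xi>)"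
  and Dy_scaled_reflect: "\<forall>k. times_cont_diff k g \<Longrightarrow> Dy (\<lambda>\<xi>. c * reflect g \<xi>) = (\<lambda>\<xi>. - c * reflect (Dy g) \<xi>)"
proof -
  have D: "((\<lambda>s. c * reflect f (s, y)) has_real_derivative c * reflect (Dx f) (x, y)) (at x)"
    "((\<lambda>s. c * reflect f (x, s)) has_real_derivative - c * reflect (Dy f) (x, y)) (at y)"
    if "times_cont_diff (Suc 0) f" for f c x y
  proof -
    have "((\<lambda>s. f (s, - y)) has_real_derivative Dx f (x, - y)) (at x)"
      using that unfolding Dx_def by (auto simp: DERIV_deriv_iff_real_differentiable)
    then show "((\<lambda>s. c * reflect f (s, y)) has_real_derivative c * reflect (Dx f) (x, y)) (at x)"
      by (auto simp: reflect_def intro!: derivative_eq_intros)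
    have "((\<lambda>s. f (x, s)) has_real_derivative Dy f (x, - y)) (at (- y))"
      using that unfolding Dy_def by (auto simp: DERIV_deriv_iff_real_differentiable)
    then have "((\<lambda>s. f (x, - s)) has_real_derivative Dy f (x, - y) * (- 1)) (at y)"
      by (rule DERIV_chain2) (auto intro!: derivative_eq_intros)
    then show "((\<lambda>s. c * reflect f (x, s)) has_real_derivative - c * reflect (Dy f) (x, y)) (at y)"
      by (auto simp: reflect_def intro!: derivative_eq_intros)
  qed
  have DxD: "Dx (\<lambda>\<xi>. c * reflect f \<xi>) = (\<lambda>\<xi>. c * reflect (Dx f) \<xi>)"
    and DyD: "Dy (\<lambda>\<xi>. c * reflect f \<xi>) = (\<lambda>\<xi>. - c * reflect (Dy f) \<xi>)"
    if "times_cont_diff (Suc 0) f" for f c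
  proof -
    show "Dx (\<lambda>\<xi>. c * reflect f \<xi>) = (\<lambda>\<xi>. c * reflect (Dx f) \<xi>)"
      by (subst (1) Dx_def) (auto simp: fun_eq_iff intro!: DERIV_imp_deriv D(1)[OF that])
    show "Dy (\<lambda>\<xi>. c * reflect f \<xi>) = (\<lambda>\<xi>. - c * reflect (Dy f) \<xi>)"
      by (subst (1) Dy_def) (use D(2)[OF that, of c, THEN DERIV_imp_deriv] in \<open>auto simp: fun_eq_iff\<close>)
  qed
  have C: "continuous_on UNIV (\<lambda>\<xi>. c * reflect f \<xi>)" if "continuous_on UNIV f" for f c
    unfolding reflect_apply by (intro continuous_intros continuous_on_compose2[OF that]) auto
  show "times_cont_diff k f \<Longrightarrow> times_cont_diff k (\<lambda>\<xi>. c * reflect f \<xi>)"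
  proof (induction k arbitrary: f c)
    case 0
    then show ?case using C by simp
  next
    case (Suc k)
    have 1: "times_cont_diff (Suc 0) f" using Suc.prems by (cases k) auto
    have "(\<lambda>s. c * reflect f (s, y)) differentiable (at x)" "(\<lambda>s. c * reflect f (x, s)) differentiable (at y)" for x y
      using D[OF 1] unfolding real_differentiable_def by blast+
    then show ?case using Suc C unfolding times_cont_diff.simps DxD[OF 1] DyD[OF 1] by blast
  qed
  show "\<forall>k. times_cont_diff k g \<Longrightarrow> Dx (\<lambda>\<xi>. c * reflect g \<xi>) = (\<lambda>\<xi>. c * reflect (Dx g) \<xi>)"
    "\<forall>k. times_cont_diff k g \<Longrightarrow> Dy (\<lambda>\<xi>. c * reflect g \<xi>) = (\<lambda>\<xi>. - c * reflect (Dy g) \<xi>)"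
    using DxD[of g c] DyD[of g c] by blast+
qed

lemma reflect_test_function:
  assumes "\<phi> \<in> test_functions (Omega l)"
  shows "reflect \<phi> \<in> test_functions (Omega l)"
proof -
  obtain K where K: "compact K" "K \<subseteq> Omega l" "\<And>\<xi>. \<xi> \<notin> K \<Longrightarrow> \<phi> \<xi> = 0" and s: "\<forall>k. times_cont_diff k \<phi>"
    using assms by (auto simp: test_functions_def)
  have "times_cont_diff k (reflect \<phi>)" for k using smooth2_scaled_reflect[of k \<phi> 1] s by simp
  moreover have "compact (mirror ` K)"
    by (intro compact_continuous_image continuous_intros K(1))
  moreover have "mirror ` K \<subseteq> Omega l" using K(2) by (auto simp del: mirror_Omega) (metis fst_conv mirror_Omega prod.collapse snd_conv subsetD)
  moreover have "reflect \<phi> \<xi> = 0" if "\<xi> \<notin> mirror ` K" for \<xi>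
  proof -
    have "\<xi> = mirror (mirror \<xi>)" by simp
    then have "mirror \<xi> \<notin> K" using that by blast
    then show ?thesis by (simp add: reflect_apply K(3))
  qed
  ultimately show ?thesis unfolding test_functions_def by blast
qed

lemma DD_reflect:
  assumes "\<phi> \<in> test_functions A"
  shows "DD i j (reflect \<phi>) = (\<lambda>\<xi>. (-1) ^ j * reflect (DD i j \<phi>) \<xi>)"
proof (induction i)
  case 0
  show ?case
  proof (induction j)
    case (Suc j)
    have "\<forall>k. times_cont_diff k ((Dy ^^ j) \<phi>)"
      using test_function_DD[OF assms, of 0 j] by (auto simp: test_functions_def)
    then show ?case using Suc by (simp add: Dy_scaled_reflect)
  qed simp
next
  case (Suc i)
  have "\<forall>k. times_cont_diff k (DD i j \<phi>)"
    using test_function_DD[OF assms, of i j] by (auto simp: test_functions_def)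
  then show ?case using Suc by (simp add: Dx_scaled_reflect)
qed

lemma inner_L2_scale: "inner_L2 l (\<lambda>\<xi>. c * f \<xi>) g = c * inner_L2 l f g"
  by (simp add: inner_L2_def mult.assoc)

lemma has_weak_partial_reflect:
  assumes u: "u \<in> L2 l" and w: "w \<in> L2 l" and h: "has_weak_partial l i j u w"
  shows "has_weak_partial l i j (reflect u) (\<lambda>\<xi>. (-1) ^ j * reflect w \<xi>)"
  unfolding has_weak_partial_def
proof
  fix \<phi> assume t: "\<phi> \<in> test_functions (Omega l)"
  note t' = reflect_test_function[OF t]
  have "inner_L2 l (reflect u) (DD i j \<phi>) = inner_L2 l u (reflect (DD i j \<phi>))"
    using inner_L2_reflect[OF u reflect_L2[OF test_function_L2[OF test_function_DD[OF t, of i j]]]] by simp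
  also have "\<dots> = (-1) ^ j * inner_L2 l u (DD i j (reflect \<phi>))"
  proof -
    have "inner_L2 l u (\<lambda>\<xi>. (-1) ^ j * reflect (DD i j \<phi>) \<xi>) = (-1) ^ j * inner_L2 l u (reflect (DD i j \<phi>))"
      by (simp only: inner_L2_commute[of l u] inner_L2_scale)
    then show ?thesis by (simp add: DD_reflect[OF t] flip: power_mult_distrib mult.assoc)
  qed
  also have "\<dots> = (-1) ^ j * ((-1) ^ (i + j) * inner_L2 l w (reflect \<phi>))"
    using h t' by (simp add: has_weak_partial_def)
  also have "inner_L2 l w (reflect \<phi>) = inner_L2 l (reflect w) \<phi>"
    using inner_L2_reflect[OF w test_function_L2[OF t']] by simp
  also have "(-1) ^ j * ((-1) ^ (i + j) * inner_L2 l (reflect w) \<phi>)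
      = (-1) ^ (i + j) * inner_L2 l (\<lambda>\<xi>. (-1) ^ j * reflect w \<xi>) \<phi>"
    by (simp add: inner_L2_scale)
  finally show "inner_L2 l (reflect u) (DD i j \<phi>)
    = (-1) ^ (i + j) * inner_L2 l (\<lambda>\<xi>. (-1) ^ j * reflect w \<xi>) \<phi>" .
qed

lemma L2_scale: "f \<in> L2 l \<Longrightarrow> (\<lambda>\<xi>. c * f \<xi>) \<in> L2 l"
  using L2_lincomb[of f l f c 0] by simp

lemma H2_reflect:
  assumes "u \<in> H2 l"
  shows "reflect u \<in> H2 l"
  unfolding H2_def mem_Collect_eq
proof (intro conjI allI impI)
  show "reflect u \<in> L2 l" using assms by (intro reflect_L2 H2_L2)
  fix i j :: nat assume ij: "i + j \<le> 2"
  show "\<exists>w\<in>L2 l. has_weak_partial l i j (reflect u) w"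
  proof
    show "has_weak_partial l i j (reflect u) (\<lambda>\<xi>. (-1) ^ j * reflect (weak_partial l i j u) \<xi>)"
      using assms ij by (intro has_weak_partial_reflect weak_partial_spec H2_L2)
  qed (use assms ij in \<open>intro L2_scale reflect_L2 weak_partial_spec\<close>)
qed

lemma weak_partial_reflect:
  assumes "u \<in> H2 l" "i + j \<le> 2"
  shows "AE \<xi> in lebesgue_on (Omega l). weak_partial l i j (reflect u) \<xi> = (-1) ^ j * reflect (weak_partial l i j u) \<xi>"
  by (rule weak_partial_unique[where u = "reflect u" and i = i and j = j];
    intro weak_partial_spec has_weak_partial_reflect L2_scale reflect_L2 H2_reflect H2_L2 assms)


section \<open>Absolute continuity on lines and integration by parts\<close>

lemma
  fixes f :: "real \<times> real \<Rightarrow> real"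
  assumes f: "integrable lborel f"
  shows integral_iterated: "(\<integral>\<xi>. f \<xi> \<partial>lborel) = (\<integral>y. (\<integral>x. f (x, y) \<partial>lborel) \<partial>lborel)"
    and AE_integrable_slice: "AE y in lborel. integrable lborel (\<lambda>x. f (x, y))"
    and integrable_iterated: "integrable lborel (\<lambda>y. \<integral>x. f (x, y) \<partial>lborel)"
proof -
  have i: "integrable (lborel \<Otimes>\<^sub>M lborel) (case_prod (\<lambda>x y. f (x, y)))"
    using f by (simp add: lborel_prod)
  show "(\<integral>\<xi>. f \<xi> \<partial>lborel) = (\<integral>y. (\<integral>x. f (x, y) \<partial>lborel) \<partial>lborel)"
    using lborel_pair.integral_snd[OF i] by (simp add: lborel_prod)
  show "AE y in lborel. integrable lborel (\<lambda>x. f (x, y))"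
    using lborel_pair.AE_integrable_snd[OF i] .
  show "integrable lborel (\<lambda>y. \<integral>x. f (x, y) \<partial>lborel)"
    using lborel_pair.integrable_snd[OF i] .
qed

abbreviation swap :: "real \<times> real \<Rightarrow> real \<times> real" where
  "swap \<xi> \<equiv> (snd \<xi>, fst \<xi>)"

lemma swap_measurable: "swap \<in> lborel \<rightarrow>\<^sub>M lborel"
  and distr_swap: "distr lborel lborel swap = (lborel :: (real \<times> real) measure)"
proof -
  show m: "swap \<in> lborel \<rightarrow>\<^sub>M lborel" by (simp add: borel_prod[symmetric])
  show "distr lborel lborel swap = (lborel :: (real \<times> real) measure)"
    using lborel_pair.distr_pair_swap[symmetric, unfolded lborel_prod case_prod_unfold] .
qed

lemma AE_swap: "AE \<xi> in lborel. P \<xi> \<Longrightarrow> AE \<xi> in lborel. P (swap \<xi>)"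
  using AE_distrD[OF swap_measurable, of P] by (simp only: distr_swap)

lemma integral_swap:
  fixes f :: "real \<times> real \<Rightarrow> real"
  assumes "f \<in> borel_measurable borel"
  shows "(\<integral>\<xi>. f (swap \<xi>) \<partial>lborel) = (\<integral>\<xi>. f \<xi> \<partial>lborel)"
    and "integrable lborel (\<lambda>\<xi>. f (swap \<xi>)) \<longleftrightarrow> integrable lborel f"
proof -
  have f: "f \<in> borel_measurable lborel" using assms by simp
  show "(\<integral>\<xi>. f (swap \<xi>) \<partial>lborel) = (\<integral>\<xi>. f \<xi> \<partial>lborel)"
    "integrable lborel (\<lambda>\<xi>. f (swap \<xi>)) \<longleftrightarrow> integrable lborel f"
    using integral_distr[OF swap_measurable f] integrable_distr_eq[OF swap_measurable f]
    by (simp_all add: distr_swap)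
qed

lemma AE_slice:
  fixes P :: "real \<times> real \<Rightarrow> bool"
  assumes "AE \<xi> in lborel. P \<xi>"
  shows "AE y in lborel. AE x in lborel. P (x, y)"
proof -
  have "AE \<xi> in lborel \<Otimes>\<^sub>M lborel. P (swap \<xi>)" using AE_swap[OF assms] unfolding lborel_prod .
  from lborel_pair.AE_pair[OF this] show ?thesis by simp
qed

lemma AE_snd:
  fixes P :: "real \<Rightarrow> bool"
  assumes "AE y in lborel. P y"
  shows "AE \<xi> in (lborel :: (real \<times> real) measure). P (snd \<xi>)"
proof -
  obtain N where N: "N \<in> null_sets lborel" "{y. \<not> P y} \<subseteq> N"
    using assms by (auto elim!: AE_E simp: null_sets_def)
  have [measurable]: "N \<in> sets borel" using N(1) by auto
  have "AE \<xi> in (lborel :: real measure) \<Otimes>\<^sub>M (lborel :: real measure). snd \<xi> \<notin> N"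
  proof (rule lborel_pair.AE_pair_measure)
    show "{\<xi> \<in> space ((lborel :: real measure) \<Otimes>\<^sub>M (lborel :: real measure)). snd \<xi> \<notin> N} \<in> sets (lborel \<Otimes>\<^sub>M lborel)"
      by measurable
  qed (use AE_not_in[OF N(1)] in auto)
  then show ?thesis unfolding lborel_prod by eventually_elim (use N(2) in auto)
qed

lemma integrable_product:
  fixes f g :: "real \<Rightarrow> real"
  assumes f: "integrable lborel f" and g: "integrable lborel g"
  shows "integrable lborel (\<lambda>\<xi>. f (fst \<xi>) * g (snd \<xi>))"
proof -
  have [measurable]: "f \<in> borel_measurable borel" "g \<in> borel_measurable borel" using f g by auto
  have "integrable (lborel \<Otimes>\<^sub>M lborel) (\<lambda>\<xi>. f (fst \<xi>) * g (snd \<xi>))"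
  proof (rule lborel_pair.Fubini_integrable)
    have "(\<lambda>x. \<integral>y. norm (f (fst (x, y)) * g (snd (x, y))) \<partial>lborel) = (\<lambda>x. \<bar>f x\<bar> * (\<integral>y. \<bar>g y\<bar> \<partial>lborel))"
      by (simp add: abs_mult)
    then show "integrable lborel (\<lambda>x. \<integral>y. norm (f (fst (x, y)) * g (snd (x, y))) \<partial>lborel)"
      using f by simp
  qed (use g in auto)
  then show ?thesis by (simp add: lborel_prod)
qed

lemma integrable_indicator_interval:
  "integrable lborel (indicator {a..b} :: real \<Rightarrow> real)"
  "integrable lborel (indicator {a<..<b} :: real \<Rightarrow> real)"
  using emeasure_lborel_cbox_finite[of a b] emeasure_lborel_box_finite[of a b]
  by (auto simp: integrable_indicator_iff)

definition prim :: "(real \<Rightarrow> real) \<Rightarrow> real \<Rightarrow> real" where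
  "prim h x = (\<integral>s. indicator {..<x} s * h s \<partial>lborel)"

lemma prim_diff_bound:
  assumes h: "integrable lborel h"
  shows "\<bar>prim h x - prim h y\<bar> \<le> (\<integral>s. \<bar>h s\<bar> \<partial>lborel)"
proof -
  have i: "integrable lborel (\<lambda>s. indicator {..<x} s * h s)" for x
    using integrable_mult_indicator[OF _ h, of "{..<x}"] by simp
  have "\<bar>prim h x - prim h y\<bar> = \<bar>\<integral>s. indicator {..<x} s * h s - indicator {..<y} s * h s \<partial>lborel\<bar>"
    using i by (simp add: prim_def)
  also have "\<dots> \<le> (\<integral>s. \<bar>indicator {..<x} s * h s - indicator {..<y} s * h s\<bar> \<partial>lborel)"
    by (rule integral_abs_bound)
  also have "\<dots> \<le> (\<integral>s. \<bar>h s\<bar> \<partial>lborel)"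
    using i h by (intro integral_mono) (auto simp: indicator_def)
  finally show ?thesis .
qed

lemma prim_bound:
  assumes h: "integrable lborel h"
  shows "\<bar>prim h x\<bar> \<le> (\<integral>s. \<bar>h s\<bar> \<partial>lborel)"
proof -
  have "\<bar>prim h x\<bar> \<le> (\<integral>s. \<bar>indicator {..<x} s * h s\<bar> \<partial>lborel)"
    unfolding prim_def by (rule integral_abs_bound)
  also have "\<dots> \<le> (\<integral>s. \<bar>h s\<bar> \<partial>lborel)"
    using integrable_mult_indicator[OF _ h, of "{..<x}"] h
    by (intro integral_mono) (auto simp: indicator_def)
  finally show ?thesis .
qed

text \<open>
  Dominated convergence: the integrands converge at every point other than the endpoint.
\<close>

lemma prim_continuous:
  assumes h: "integrable lborel h"
  shows "continuous_on A (prim h)"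
proof -
  have "(\<lambda>n. prim h (X n)) \<longlonglongrightarrow> prim h x" if X: "X \<longlonglongrightarrow> x" for X x
    unfolding prim_def
  proof (rule integral_dominated_convergence[where w = "\<lambda>s. \<bar>h s\<bar>"])
    have "AE s in lborel. s \<noteq> x" by (rule AE_lborel_singleton)
    then show "AE s in lborel. (\<lambda>n. indicator {..<X n} s * h s) \<longlonglongrightarrow> indicator {..<x} s * h s"
    proof eventually_elim
      case (elim s)
      have "eventually (\<lambda>n. (s < X n) = (s < x)) sequentially"
      proof (cases "s < x")
        case True
        then show ?thesis using order_tendstoD(1)[OF X True] by (auto elim: eventually_mono)
      next
        case False
        then have "x < s" using elim by simp
        then show ?thesis using order_tendstoD(2)[OF X \<open>x < s\<close>] by (auto elim: eventually_mono)
      qed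
      then have "eventually (\<lambda>n. indicator {..<x} s * h s = indicator {..<X n} s * h s) sequentially"
        by eventually_elim (auto simp: indicator_def)
      then show ?case by (rule Lim_transform_eventually[OF tendsto_const])
    qed
  qed (use h in \<open>auto simp: indicator_def\<close>)
  then show ?thesis
    by (auto simp: continuous_on_sequentially comp_def)
qed

text \<open>Fubini on the triangle \<open>s < x\<close>.\<close>

lemma prim_by_parts:
  assumes h: "integrable lborel h" and g: "integrable lborel g"
  shows "(\<integral>x. prim h x * g x \<partial>lborel) = (\<integral>s. h s * ((\<integral>x. g x \<partial>lborel) - prim g s) \<partial>lborel)"
proof -
  have [measurable]: "h \<in> borel_measurable borel" "g \<in> borel_measurable borel" using h g by auto
  let ?k = "\<lambda>\<xi>. indicator {..<snd \<xi>} (fst \<xi>) * (h (fst \<xi>) * g (snd \<xi>)) :: real"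
  have ind: "(\<lambda>\<xi>::real \<times> real. indicator {..<snd \<xi>} (fst \<xi>) :: real) \<in> borel_measurable (borel \<Otimes>\<^sub>M borel)"
  proof -
    have eq: "(\<lambda>\<xi>::real \<times> real. indicator {..<snd \<xi>} (fst \<xi>) :: real) = (\<lambda>\<xi>. if fst \<xi> < snd \<xi> then 1 else 0)"
      by (auto simp: fun_eq_iff)
    show ?thesis unfolding eq by measurable
  qed
  have km: "?k \<in> borel_measurable borel"
    unfolding borel_prod[symmetric] using ind by measurable
  have k: "integrable lborel ?k"
    by (rule Bochner_Integration.integrable_bound[OF integrable_product[OF h g]])
      (use km in \<open>auto simp: indicator_def\<close>)
  have ki: "integrable (lborel \<Otimes>\<^sub>M lborel) (case_prod (\<lambda>s x. ?k (s, x)))"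
    using k by (simp add: lborel_prod case_prod_unfold)
  have "(\<integral>x. prim h x * g x \<partial>lborel) = (\<integral>x. (\<integral>s. ?k (s, x) \<partial>lborel) \<partial>lborel)"
    by (simp add: prim_def mult.assoc[symmetric] del: integral_mult_left_zero
        flip: integral_mult_left_zero)
  also have "\<dots> = (\<integral>s. (\<integral>x. ?k (s, x) \<partial>lborel) \<partial>lborel)"
    by (rule lborel_pair.Fubini_integral[OF ki])
  also have "(\<lambda>s. \<integral>x. ?k (s, x) \<partial>lborel) = (\<lambda>s. h s * ((\<integral>x. g x \<partial>lborel) - prim g s))"
  proof
    fix s
    have gi: "integrable lborel (\<lambda>x. indicator {..<s} x * g x)"
      using integrable_mult_indicator[OF _ g, of "{..<s}"] by simp
    have "(\<integral>x. ?k (s, x) \<partial>lborel) = (\<integral>x. h s * (g x - indicator {..<s} x * g x) \<partial>lborel)"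
    proof (rule integral_cong_AE)
      show "AE x in lborel. ?k (s, x) = h s * (g x - indicator {..<s} x * g x)"
        using AE_lborel_singleton[of s] by eventually_elim (auto simp: indicator_def)
      show "(\<lambda>x. ?k (s, x)) \<in> borel_measurable lborel" unfolding indicator_def by simp
    qed simp
    also have "\<dots> = h s * ((\<integral>x. g x \<partial>lborel) - prim g s)"
      using gi g by (simp add: prim_def)
    finally show "(\<integral>x. ?k (s, x) \<partial>lborel) = h s * ((\<integral>x. g x \<partial>lborel) - prim g s)" .
  qed
  finally show ?thesis .
qed

lemma bump_integrable:
  assumes "\<theta> \<in> bump a b"
  shows "integrable lborel \<theta>" and "\<exists>C. \<forall>x. \<bar>\<theta> x\<bar> \<le> C" and "\<theta> \<in> borel_measurable borel"
proof -
  obtain p q where pq: "\<And>x. x \<notin> {p..q} \<Longrightarrow> \<theta> x = 0" and s: "smooth \<theta>"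
    using assms by (auto simp: bump_def)
  have eq: "(\<lambda>x. indicator {p..q} x *\<^sub>R \<theta> x) = \<theta>"
  proof
    show "indicator {p..q} x *\<^sub>R \<theta> x = \<theta> x" for x using pq[of x] by (cases "x \<in> {p..q}") auto
  qed
  have "integrable lborel (\<lambda>x. indicator {p..q} x *\<^sub>R \<theta> x)"
    by (rule borel_integrable_compact) (auto intro: smooth_continuous s)
  then show "integrable lborel \<theta>" by (simp only: eq)
  then show "\<theta> \<in> borel_measurable borel" by auto
  have "bounded (\<theta> ` {p..q})"
    by (intro compact_imp_bounded compact_continuous_image smooth_continuous s) auto
  then obtain C where "\<forall>x\<in>{p..q}. \<bar>\<theta> x\<bar> \<le> C"
    unfolding bounded_iff by auto
  then have "\<bar>\<theta> x\<bar> \<le> max C 0" for x using pq[of x] by (cases "x \<in> {p..q}") (force, auto)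
  then show "\<exists>C. \<forall>x. \<bar>\<theta> x\<bar> \<le> C" by blast
qed

lemma prim_bump:
  assumes "\<theta> \<in> bump a b" and D: "\<And>x. (F has_real_derivative \<theta> x) (at x)"
    and L: "\<And>x. x \<le> p \<Longrightarrow> F x = 0" and t: "\<And>x. x < p \<Longrightarrow> \<theta> x = 0"
  shows "prim \<theta> x = F x"
proof (cases "x \<le> p")
  case True
  then have "(\<lambda>s. indicator {..<x} s * \<theta> s) = (\<lambda>_. 0)"
    using t by (auto simp: fun_eq_iff indicator_def)
  then show ?thesis by (simp add: prim_def L True)
next
  case False
  have s: "smooth \<theta>" using assms by (auto simp: bump_def)
  have "prim \<theta> x = (\<integral>s. \<theta> s * indicator {p..x} s \<partial>lborel)"
    unfolding prim_def
  proof (rule integral_cong_AE)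
    show "AE s in lborel. indicator {..<x} s * \<theta> s = \<theta> s * indicator {p..x} s"
      using AE_lborel_singleton[of x]
    proof eventually_elim
      case (elim s)
      then show ?case using t[of s] by (auto simp: indicator_def)
    qed
  qed (use bump_integrable(3)[OF assms(1)] in auto)
  also have "\<dots> = F x - F p"
    using False s by (intro integral_FTC_Icc_real D) (auto intro: DERIV_isCont smooth_has_deriv)
  finally show ?thesis by (simp add: L)
qed

lemma integral_bump_deriv:
  assumes \<theta>: "\<theta> \<in> bump a b"
  shows "prim (deriv \<theta>) x = \<theta> x" and "(\<integral>x. deriv \<theta> x \<partial>lborel) = 0"
proof -
  obtain p q where pq: "p < q" "\<And>x. x \<notin> {p..q} \<Longrightarrow> \<theta> x = 0" and s: "smooth \<theta>"
    using \<theta> by (auto simp: bump_def)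
  have z: "deriv \<theta> x = 0" if "x \<notin> {p..q}" for x
  proof -
    have "eventually (\<lambda>y. y \<in> - {p..q}) (nhds x)" using that by (intro eventually_nhds_in_open) auto
    then have "eventually (\<lambda>y. \<theta> y = 0) (nhds x)" by eventually_elim (use pq in auto)
    then have "deriv \<theta> x = deriv (\<lambda>_. 0) x" by (intro deriv_cong_ev) auto
    then show ?thesis by simp
  qed
  show P: "prim (deriv \<theta>) x = \<theta> x" for x
    by (rule prim_bump[OF bump_deriv[OF \<theta>] smooth_has_deriv(1)[OF s], of "p - 1"]) (use pq z in auto)
  have "(\<lambda>s. indicator {..<q + 1} s * deriv \<theta> s) = deriv \<theta>"
    using z by (auto simp: fun_eq_iff indicator_def)
  then have "(\<integral>x. deriv \<theta> x \<partial>lborel) = prim (deriv \<theta>) (q + 1)" by (simp add: prim_def)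
  then show "(\<integral>x. deriv \<theta> x \<partial>lborel) = 0" by (simp add: P pq)
qed

lemma bump_zero_mean_primitive:
  assumes \<theta>: "\<theta> \<in> bump a b" and m: "(\<integral>x. \<theta> x \<partial>lborel) = 0"
  obtains \<Theta> where "\<Theta> \<in> bump a b" "deriv \<Theta> = \<theta>"
proof -
  obtain F p q where F: "\<And>x. (F has_real_derivative \<theta> x) (at x)" "smooth F"
    "a < p" "p < q" "q < b" "\<And>x. x \<le> p \<Longrightarrow> F x = 0" "\<And>x. x \<ge> q \<Longrightarrow> F x = F b"
    "\<And>x. x \<notin> {p..q} \<Longrightarrow> \<theta> x = 0"
    using bump_primitive[OF \<theta>] by blast
  have P: "prim \<theta> x = F x" for x
    by (rule prim_bump[OF \<theta> F(1) F(6)]) (use F(8) in auto)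
  have "(\<lambda>s. indicator {..<q + 1} s * \<theta> s) = \<theta>"
    using F(8) by (auto simp: fun_eq_iff indicator_def)
  then have "prim \<theta> (q + 1) = 0" using m by (simp add: prim_def)
  then have "F b = 0" using P[of "q + 1"] F(7)[of "q + 1"] by simp
  then have "F x = 0" if "x \<notin> {p..q}" for x
    using that F(6)[of x] F(7)[of x] by (cases "x \<le> p") auto
  then have "F \<in> bump a b" using F(2-5) by (auto simp: bump_def)
  moreover have "deriv F = \<theta>" using F(1) by (auto intro: DERIV_imp_deriv)
  ultimately show thesis by (rule that)
qed

lemma bump_nonzero_mean:
  assumes "a < b"
  obtains \<theta> where "\<theta> \<in> bump a b" "(\<integral>x. \<theta> x \<partial>lborel) \<noteq> 0"
proof -
  have "(\<lambda>n. \<integral>x. approx_ind a b (Suc n) x \<partial>lborel) \<longlonglongrightarrow> (\<integral>x. indicator {a<..<b} x \<partial>lborel)"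
  proof (rule integral_dominated_convergence[where w = "indicator {a..b}", OF _ _ integrable_indicator_interval(1)])
    show "AE x in lborel. (\<lambda>n. approx_ind a b (Suc n) x) \<longlonglongrightarrow> indicator {a<..<b} x"
      by (intro AE_I2 LIMSEQ_Suc approx_ind_limit)
    have B: "approx_ind a b (Suc n) \<in> bump a b" for n using assms by (intro approx_ind_bump) auto
    show "approx_ind a b (Suc n) \<in> borel_measurable lborel" for n
      using bump_integrable(3)[OF B] by simp
    have "norm (approx_ind a b (Suc n) x) \<le> indicator {a..b} x" for n x
    proof (cases "x \<in> {a..b}")
      case True
      then show ?thesis using approx_ind_bound by simp
    next
      case False
      then have "approx_ind a b (Suc n) x = 0" using B[of n] by (fastforce simp: bump_def)
      then show ?thesis by simp
    qed
    then show "AE x in lborel. norm (approx_ind a b (Suc n) x) \<le> indicator {a..b} x" for n by simp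
  qed auto
  then have "(\<lambda>n. \<integral>x. approx_ind a b (Suc n) x \<partial>lborel) \<longlonglongrightarrow> b - a" using assms by simp
  then obtain n where "(\<integral>x. approx_ind a b (Suc n) x \<partial>lborel) > 0"
    using order_tendstoD(1)[of _ "b - a" sequentially 0] assms eventually_happens'[OF sequentially_bot] by fastforce
  then show thesis using assms by (intro that[of "approx_ind a b (Suc n)"] approx_ind_bump) auto
qed

text \<open>
  A function with an integrable weak derivative is absolutely continuous on almost all lines.  The
  difference \<open>K\<close> between \<open>f\<close> and the \<open>x\<close>-primitive of \<open>h\<close> annihilates all products
  \<open>\<theta>' \<otimes> \<psi>\<close>, hence all \<open>\<theta> \<otimes> \<psi>\<close> with \<open>\<theta>\<close> of mean zero.  Correcting an arbitrary \<open>\<theta>\<close> by a multiple of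
  a fixed bump \<open>\<theta>0\<close> shows that \<open>K\<close> agrees with its average \<open>k\<close> against \<open>\<theta>0\<close>, which depends on
  \<open>y\<close> only.
\<close>

theorem ACL_rectangle:
  fixes f h :: "real \<times> real \<Rightarrow> real"
  assumes ab: "a < b" and f: "integrable lborel f" and h: "integrable lborel h"
    and h0: "\<And>\<xi>. \<xi> \<notin> {a<..<b} \<times> {c<..<d} \<Longrightarrow> h \<xi> = 0"
    and z: "\<And>\<theta> \<psi>. \<theta> \<in> bump a b \<Longrightarrow> \<psi> \<in> bump c d \<Longrightarrow>
      (\<integral>\<xi>. f \<xi> * tensor (deriv \<theta>) \<psi> \<xi> \<partial>lborel) = - (\<integral>\<xi>. h \<xi> * tensor \<theta> \<psi> \<xi> \<partial>lborel)"
  obtains k where "AE \<xi> in lborel. \<xi> \<in> {a<..<b} \<times> {c<..<d} \<longrightarrow>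
      f \<xi> = k (snd \<xi>) + prim (\<lambda>s. h (s, snd \<xi>)) (fst \<xi>)"
proof -
  let ?R = "{a<..<b} \<times> {c<..<d}"
  have R: "?R \<in> sets borel" by (intro borel_open open_Times) auto
  have [measurable]: "f \<in> borel_measurable borel" "h \<in> borel_measurable borel" using f h by auto
  define F where "F \<xi> = prim (\<lambda>s. h (s, snd \<xi>)) (fst \<xi>)" for \<xi>
  have Fm: "F \<in> borel_measurable borel"
  proof -
    have "(\<lambda>(\<xi>, s). (if s < fst \<xi> then 1 else 0) * h (s, snd \<xi>)) \<in> borel_measurable ((borel \<Otimes>\<^sub>M borel) \<Otimes>\<^sub>M lborel)"
    proof -
      have "(\<lambda>p::(real \<times> real) \<times> real. (snd p, snd (fst p))) \<in> (borel \<Otimes>\<^sub>M borel) \<Otimes>\<^sub>M lborel \<rightarrow>\<^sub>M borel \<Otimes>\<^sub>M borel"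
        by measurable
      then have "(\<lambda>p::(real \<times> real) \<times> real. h (snd p, snd (fst p))) \<in> borel_measurable ((borel \<Otimes>\<^sub>M borel) \<Otimes>\<^sub>M lborel)"
        by (rule measurable_compose) (simp add: borel_prod)
      then show ?thesis unfolding case_prod_unfold by measurable
    qed
    then have "(\<lambda>\<xi>. \<integral>s. (if s < fst \<xi> then 1 else 0) * h (s, snd \<xi>) \<partial>lborel) \<in> borel_measurable (borel \<Otimes>\<^sub>M borel)"
      by (rule lborel.borel_measurable_lebesgue_integral)
    moreover have "F = (\<lambda>\<xi>. \<integral>s. (if s < fst \<xi> then 1 else 0) * h (s, snd \<xi>) \<partial>lborel)"
      by (auto simp: F_def prim_def fun_eq_iff indicator_def intro!: Bochner_Integration.integral_cong)
    ultimately show ?thesis by (simp add: borel_prod)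
  qed
  define K where "K \<xi> = indicator ?R \<xi> * (f \<xi> - F \<xi>)" for \<xi>
  have FR: "integrable lborel (\<lambda>\<xi>. indicator ?R \<xi> * F \<xi>)"
  proof (rule Bochner_Integration.integrable_bound)
    show "integrable lborel (\<lambda>\<xi>. indicator {a<..<b} (fst \<xi>) * (\<integral>s. \<bar>h (s, snd \<xi>)\<bar> \<partial>lborel))"
      using h by (intro integrable_product integrable_indicator_interval integrable_iterated) auto
    have "AE \<xi> in (lborel :: (real \<times> real) measure). integrable lborel (\<lambda>s. h (s, snd \<xi>))"
      by (rule AE_snd[OF AE_integrable_slice[OF h]])
    then show "AE \<xi> in lborel. norm (indicator ?R \<xi> * F \<xi>)
        \<le> norm (indicator {a<..<b} (fst \<xi>) * (\<integral>s. \<bar>h (s, snd \<xi>)\<bar> \<partial>lborel))"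
    proof eventually_elim
      case (elim \<xi>)
      then show ?case using prim_bound[OF elim, of "fst \<xi>"]
        by (cases \<xi>) (auto simp: indicator_def F_def)
    qed
  qed (use Fm R in auto)
  have K: "integrable lborel K"
  proof -
    have "integrable lborel (\<lambda>\<xi>. indicator ?R \<xi> * f \<xi> - indicator ?R \<xi> * F \<xi>)"
      using integrable_mult_indicator[OF _ f, of ?R] R FR by simp
    then show ?thesis by (simp add: K_def[abs_def] algebra_simps)
  qed
  have tm [measurable]: "tensor \<theta> \<psi> \<in> borel_measurable borel" if "\<theta> \<in> bump a b" "\<psi> \<in> bump c d" for \<theta> \<psi>
    using that by (intro borel_measurable_continuous_onI continuous_tensor) (auto simp: bump_def)
  have ti: "integrable lborel (\<lambda>\<xi>. g \<xi> * tensor \<theta> \<psi> \<xi>)"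
    if g: "integrable lborel g" and B: "\<theta> \<in> bump a b" "\<psi> \<in> bump c d" for g \<theta> \<psi>
  proof -
    obtain C C' where C: "\<And>x. \<bar>\<theta> x\<bar> \<le> C" "\<And>x. \<bar>\<psi> x\<bar> \<le> C'"
      using bump_integrable(2)[OF B(1)] bump_integrable(2)[OF B(2)] by blast
    have C0: "0 \<le> C" using C(1)[of 0] by linarith
    have T: "\<bar>tensor \<theta> \<psi> \<xi>\<bar> \<le> C * C'" for \<xi>
      unfolding tensor_def case_prod_unfold abs_mult using C C0 by (intro mult_mono) auto
    have T2: "\<bar>g \<xi>\<bar> * \<bar>tensor \<theta> \<psi> \<xi>\<bar> \<le> \<bar>g \<xi>\<bar> * \<bar>C * C'\<bar>" for \<xi>
      by (intro mult_left_mono order_trans[OF T abs_ge_self]) simp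
    have "norm (g \<xi> * tensor \<theta> \<psi> \<xi>) \<le> norm ((C * C') * g \<xi>)" for \<xi>
      using T2[of \<xi>] by (simp add: abs_mult mult_ac)
    moreover have "(\<lambda>\<xi>. g \<xi> * tensor \<theta> \<psi> \<xi>) \<in> borel_measurable lborel"
      using tm[OF B] g by auto
    ultimately show ?thesis
      by (intro Bochner_Integration.integrable_bound[OF integrable_mult_right[OF g, of "C * C'"]]) auto
  qed
  have out: "indicator ?R \<xi> * tensor \<theta> \<psi> \<xi> = tensor \<theta> \<psi> \<xi>"
    if B: "\<theta> \<in> bump a b" "\<psi> \<in> bump c d" for \<theta> \<psi> \<xi>
  proof -
    have "\<theta> x = 0" if "x \<notin> {a<..<b}" for x using B(1) that by (fastforce simp: bump_def)
    moreover have "\<psi> y = 0" if "y \<notin> {c<..<d}" for y using B(2) that by (fastforce simp: bump_def)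
    ultimately show ?thesis by (cases \<xi>) (auto simp: tensor_def indicator_def)
  qed
  have out2: "(indicator ?R \<xi> * r) * tensor \<theta> \<psi> \<xi> = r * tensor \<theta> \<psi> \<xi>"
    if B: "\<theta> \<in> bump a b" "\<psi> \<in> bump c d" for \<theta> \<psi> \<xi> r
    by (subst (2) out[OF B, symmetric]) (simp only: mult_ac)
  have A: "(\<integral>\<xi>. (indicator ?R \<xi> * F \<xi>) * tensor (deriv \<theta>) \<psi> \<xi> \<partial>lborel) = - (\<integral>\<xi>. h \<xi> * tensor \<theta> \<psi> \<xi> \<partial>lborel)"
    if B: "\<theta> \<in> bump a b" "\<psi> \<in> bump c d" for \<theta> \<psi>
  proof -
    note B' = bump_deriv[OF B(1)] B(2)
    have i: "integrable lborel (\<lambda>\<xi>. F \<xi> * tensor (deriv \<theta>) \<psi> \<xi>)"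
      using ti[OF FR B'] by (simp only: out2[OF B'])
    have "(\<integral>\<xi>. (indicator ?R \<xi> * F \<xi>) * tensor (deriv \<theta>) \<psi> \<xi> \<partial>lborel)
        = (\<integral>\<xi>. F \<xi> * tensor (deriv \<theta>) \<psi> \<xi> \<partial>lborel)"
      by (simp only: out2[OF B'])
    also have "\<dots> = (\<integral>y. (\<integral>x. F (x, y) * tensor (deriv \<theta>) \<psi> (x, y) \<partial>lborel) \<partial>lborel)"
      by (rule integral_iterated[OF i])
    also have "\<dots> = (\<integral>y. (\<integral>x. - (h (x, y) * tensor \<theta> \<psi> (x, y)) \<partial>lborel) \<partial>lborel)"
    proof (rule integral_cong_AE)
      show "(\<lambda>y. \<integral>x. F (x, y) * tensor (deriv \<theta>) \<psi> (x, y) \<partial>lborel) \<in> borel_measurable lborel"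
        using integrable_iterated[OF i] by auto
      show "(\<lambda>y. \<integral>x. - (h (x, y) * tensor \<theta> \<psi> (x, y)) \<partial>lborel) \<in> borel_measurable lborel"
        using integrable_iterated[OF ti[OF h B]] by auto
      show "AE y in lborel. (\<integral>x. F (x, y) * tensor (deriv \<theta>) \<psi> (x, y) \<partial>lborel)
          = (\<integral>x. - (h (x, y) * tensor \<theta> \<psi> (x, y)) \<partial>lborel)"
        using AE_integrable_slice[OF h]
      proof eventually_elim
        case (elim y)
        have "(\<integral>x. F (x, y) * tensor (deriv \<theta>) \<psi> (x, y) \<partial>lborel)
            = (\<integral>x. (prim (\<lambda>s. h (s, y)) x * deriv \<theta> x) * \<psi> y \<partial>lborel)"
          by (simp add: F_def tensor_def mult.assoc)
        also have "\<dots> = (\<integral>x. prim (\<lambda>s. h (s, y)) x * deriv \<theta> x \<partial>lborel) * \<psi> y" by simp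
        also have "\<dots> = (\<integral>s. h (s, y) * (0 - \<theta> s) \<partial>lborel) * \<psi> y"
          by (simp add: prim_by_parts[OF elim bump_integrable(1)[OF B'(1)]] integral_bump_deriv[OF B(1)])
        also have "\<dots> = (\<integral>x. - (h (x, y) * tensor \<theta> \<psi> (x, y)) \<partial>lborel)"
          by (simp add: tensor_def mult.assoc flip: integral_mult_left_zero)
        finally show ?case .
      qed
    qed
    also have "\<dots> = - (\<integral>\<xi>. h \<xi> * tensor \<theta> \<psi> \<xi> \<partial>lborel)"
      using integral_iterated[OF ti[OF h B]] by simp
    finally show ?thesis .
  qed
  have KD: "(\<integral>\<xi>. K \<xi> * tensor (deriv \<theta>) \<psi> \<xi> \<partial>lborel) = 0"
    if B: "\<theta> \<in> bump a b" "\<psi> \<in> bump c d" for \<theta> \<psi>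
  proof -
    note B' = bump_deriv[OF B(1)] B(2)
    have eq: "K \<xi> * tensor (deriv \<theta>) \<psi> \<xi> = f \<xi> * tensor (deriv \<theta>) \<psi> \<xi>
        - (indicator ?R \<xi> * F \<xi>) * tensor (deriv \<theta>) \<psi> \<xi>" for \<xi>
      unfolding K_def out2[OF B'] by (simp only: left_diff_distrib)
    show ?thesis
      unfolding eq using ti[OF f B'] ti[OF FR B'] z[OF B] A[OF B] by simp
  qed
  obtain \<theta>0 where \<theta>0: "\<theta>0 \<in> bump a b" and m0: "(\<integral>x. \<theta>0 x \<partial>lborel) \<noteq> 0"
    using bump_nonzero_mean[OF ab] by blast
  define m where "m = (\<integral>x. \<theta>0 x \<partial>lborel)"
  obtain C0 where C0: "\<And>x. \<bar>\<theta>0 x\<bar> \<le> C0" using bump_integrable(2)[OF \<theta>0] by blast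
  have K\<theta>: "integrable lborel (\<lambda>\<xi>. K \<xi> * \<theta>0 (fst \<xi>))"
  proof (rule Bochner_Integration.integrable_bound[OF integrable_mult_right[OF K, of C0]])
    have [measurable]: "K \<in> borel_measurable borel" "\<theta>0 \<in> borel_measurable borel"
      using K bump_integrable(3)[OF \<theta>0] by auto
    have "(\<lambda>\<xi>::real \<times> real. \<theta>0 (fst \<xi>)) \<in> borel_measurable borel"
      unfolding borel_prod[symmetric] by measurable
    then show "(\<lambda>\<xi>. K \<xi> * \<theta>0 (fst \<xi>)) \<in> borel_measurable lborel" by simp
    have "\<bar>K \<xi>\<bar> * \<bar>\<theta>0 (fst \<xi>)\<bar> \<le> \<bar>C0\<bar> * \<bar>K \<xi>\<bar>" for \<xi>
      using C0[of "fst \<xi>"] by (subst mult.commute, intro mult_right_mono) auto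
    then show "AE \<xi> in lborel. norm (K \<xi> * \<theta>0 (fst \<xi>)) \<le> norm (C0 * K \<xi>)"
      by (simp add: abs_mult)
  qed
  define k where "k y = (\<integral>x. K (x, y) * \<theta>0 x \<partial>lborel) / m" for y
  have ki: "integrable lborel k"
    using integrable_iterated[OF K\<theta>] by (simp add: k_def[abs_def])
  let ?k = "\<lambda>\<xi>. indicator {a<..<b} (fst \<xi>) * k (snd \<xi>)"
  have k2: "integrable lborel ?k" using ki by (intro integrable_product integrable_indicator_interval)
  have "AE \<xi> in lborel. indicator ?R \<xi> * (K \<xi> - ?k \<xi>) = 0"
  proof (rule fundamental_lemma_rectangle)
    show i1: "integrable lborel (\<lambda>\<xi>. indicator ?R \<xi> * (K \<xi> - ?k \<xi>))"
      using integrable_mult_indicator[OF _ Bochner_Integration.integrable_diff[OF K k2], of ?R] R by simp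
    fix \<theta> \<psi> assume B: "\<theta> \<in> bump a b" "\<psi> \<in> bump c d"
    define M where "M = (\<integral>x. \<theta> x \<partial>lborel)"
    \<comment> \<open>This correction of \<open>\<theta>\<close> has mean zero, so it is the derivative of a bump.\<close>
    have e: "(\<lambda>x. 1 * \<theta> x + (- M / m) * \<theta>0 x) \<in> bump a b" by (intro bump_lincomb B \<theta>0)
    moreover have "(\<integral>x. 1 * \<theta> x + (- M / m) * \<theta>0 x \<partial>lborel) = 0"
      using bump_integrable(1)[OF B(1)] bump_integrable(1)[OF \<theta>0] m0 by (simp add: M_def m_def)
    ultimately obtain \<Theta> where \<Theta>: "\<Theta> \<in> bump a b" "deriv \<Theta> = (\<lambda>x. 1 * \<theta> x + (- M / m) * \<theta>0 x)"
      by (rule bump_zero_mean_primitive)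
    have "0 = (\<integral>\<xi>. K \<xi> * tensor \<theta> \<psi> \<xi> - (M / m) * (K \<xi> * tensor \<theta>0 \<psi> \<xi>) \<partial>lborel)"
      using KD[OF \<Theta>(1) B(2)] by (simp add: \<Theta>(2) tensor_def case_prod_unfold algebra_simps)
    then have 1: "(\<integral>\<xi>. K \<xi> * tensor \<theta> \<psi> \<xi> \<partial>lborel) = (M / m) * (\<integral>\<xi>. K \<xi> * tensor \<theta>0 \<psi> \<xi> \<partial>lborel)"
      using ti[OF K B] ti[OF K \<theta>0 B(2)] by simp
    have "(\<integral>\<xi>. K \<xi> * tensor \<theta>0 \<psi> \<xi> \<partial>lborel) = (\<integral>y. (\<integral>x. K (x, y) * \<theta>0 x \<partial>lborel) * \<psi> y \<partial>lborel)"
      by (subst integral_iterated[OF ti[OF K \<theta>0 B(2)]])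
        (simp add: tensor_def mult.assoc flip: integral_mult_left_zero)
    also have "(\<lambda>y. (\<integral>x. K (x, y) * \<theta>0 x \<partial>lborel) * \<psi> y) = (\<lambda>y. m * (k y * \<psi> y))"
      using m0 by (simp add: k_def m_def)
    also have "(\<integral>y. m * (k y * \<psi> y) \<partial>lborel) = m * (\<integral>y. k y * \<psi> y \<partial>lborel)" by simp
    finally have 2: "(\<integral>\<xi>. K \<xi> * tensor \<theta> \<psi> \<xi> \<partial>lborel) = M * (\<integral>y. k y * \<psi> y \<partial>lborel)"
      using m0 by (simp add: 1 m_def)
    have in0: "indicator {a<..<b} x * \<theta> x = \<theta> x" for x
    proof (cases "x \<in> {a<..<b}")
      case False
      then have "\<theta> x = 0" using B(1) by (fastforce simp: bump_def)
      then show ?thesis by simp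
    qed simp
    have kt: "?k (x, y) * tensor \<theta> \<psi> (x, y) = \<theta> x * (k y * \<psi> y)" for x y
      using in0[of x] by (cases "x \<in> {a<..<b}") (simp_all add: tensor_def)
    have "(\<integral>\<xi>. ?k \<xi> * tensor \<theta> \<psi> \<xi> \<partial>lborel) = (\<integral>y. (\<integral>x. \<theta> x * (k y * \<psi> y) \<partial>lborel) \<partial>lborel)"
      by (subst integral_iterated[OF ti[OF k2 B]]) (simp only: kt)
    also have "\<dots> = M * (\<integral>y. k y * \<psi> y \<partial>lborel)" by (simp add: M_def)
    finally have 3: "(\<integral>\<xi>. ?k \<xi> * tensor \<theta> \<psi> \<xi> \<partial>lborel) = M * (\<integral>y. k y * \<psi> y \<partial>lborel)" .
    have "(\<integral>\<xi>. (indicator ?R \<xi> * (K \<xi> - ?k \<xi>)) * tensor \<theta> \<psi> \<xi> \<partial>lborel)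
        = (\<integral>\<xi>. K \<xi> * tensor \<theta> \<psi> \<xi> - ?k \<xi> * tensor \<theta> \<psi> \<xi> \<partial>lborel)"
    proof (rule Bochner_Integration.integral_cong[OF refl])
      show "(indicator ?R \<xi> * (K \<xi> - ?k \<xi>)) * tensor \<theta> \<psi> \<xi> = K \<xi> * tensor \<theta> \<psi> \<xi> - ?k \<xi> * tensor \<theta> \<psi> \<xi>" for \<xi>
        unfolding out2[OF B] by (simp only: left_diff_distrib)
    qed
    also have "\<dots> = 0" using ti[OF K B] ti[OF k2 B] 2 3 by simp
    finally show "(\<integral>\<xi>. (indicator ?R \<xi> * (K \<xi> - ?k \<xi>)) * tensor \<theta> \<psi> \<xi> \<partial>lborel) = 0" .
  qed simp
  then show thesis
    by (intro that[of k]) (auto elim!: eventually_mono simp: K_def F_def)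
qed


lemma L2_representative:
  assumes "u \<in> L2 l"
  obtains f where "f \<in> borel_measurable borel" "AE \<xi> in lborel. f \<xi> = indicator (Omega l) \<xi> * u \<xi>"
    "\<And>\<xi>. \<xi> \<notin> Omega l \<Longrightarrow> f \<xi> = 0" "integrable lborel f" "integrable lborel (\<lambda>\<xi>. (f \<xi>)\<^sup>2)"
proof -
  have "u \<in> borel_measurable (lebesgue_on (Omega l))" using assms by (simp add: L2_def)
  then obtain f where f: "f \<in> borel_measurable borel" "AE \<xi> in lborel. f \<xi> = indicator (Omega l) \<xi> * u \<xi>"
    "\<And>\<xi>. \<xi> \<notin> Omega l \<Longrightarrow> f \<xi> = 0"
    by (rule borel_representative) (rule that)
  have "integrable lborel f"
    using integral_Omega_eq_lborel(2)[OF f(1,2)] L2_integrable[OF assms] by simp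
  moreover have "integrable lborel (\<lambda>\<xi>. (f \<xi>)\<^sup>2)"
  proof -
    have "AE \<xi> in lborel. (f \<xi>)\<^sup>2 = indicator (Omega l) \<xi> * (u \<xi>)\<^sup>2"
      using f(2) by eventually_elim (simp add: indicator_def)
    then show ?thesis
      using integral_Omega_eq_lborel(2)[of "\<lambda>\<xi>. (f \<xi>)\<^sup>2" l "\<lambda>\<xi>. (u \<xi>)\<^sup>2"] f(1) assms
      by (simp add: L2_def)
  qed
  ultimately show thesis using f that by blast
qed

lemma inner_L2_representative:
  assumes "f \<in> borel_measurable borel" "AE \<xi> in lborel. f \<xi> = indicator (Omega l) \<xi> * u \<xi>"
    and "g \<in> borel_measurable borel" "AE \<xi> in lborel. g \<xi> = indicator (Omega l) \<xi> * v \<xi>"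
  shows "inner_L2 l u v = (\<integral>\<xi>. f \<xi> * g \<xi> \<partial>lborel)"
proof -
  have "AE \<xi> in lborel. f \<xi> * g \<xi> = indicator (Omega l) \<xi> * (u \<xi> * v \<xi>)"
    using assms(2,4) by eventually_elim (simp add: indicator_def)
  then show ?thesis
    unfolding inner_L2_def using assms(1,3) by (intro integral_Omega_eq_lborel(1)) auto
qed

lemma inner_L2_tensor:
  assumes "f \<in> borel_measurable borel" "AE \<xi> in lborel. f \<xi> = indicator (Omega l) \<xi> * u \<xi>"
    and "smooth a" "smooth b"
  shows "inner_L2 l u (tensor a b) = (\<integral>\<xi>. f \<xi> * tensor a b \<xi> \<partial>lborel)"
proof -
  have "AE \<xi> in lborel. f \<xi> * tensor a b \<xi> = indicator (Omega l) \<xi> * (u \<xi> * tensor a b \<xi>)"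
    using assms(2) by eventually_elim simp
  moreover have "tensor a b \<in> borel_measurable borel"
    using assms by (intro borel_measurable_continuous_onI continuous_tensor)
  ultimately show ?thesis
    unfolding inner_L2_def using assms(1) by (intro integral_Omega_eq_lborel(1)) auto
qed

lemma AE_Omega_iff: "(AE \<xi> in lebesgue_on (Omega l). P \<xi>) \<longleftrightarrow> (AE \<xi> in lborel. \<xi> \<in> Omega l \<longrightarrow> P \<xi>)"
  by (subst AE_restrict_space_iff) (auto simp: AE_completion_iff)

lemma ACL_x:
  assumes f: "f \<in> borel_measurable borel" "AE \<xi> in lborel. f \<xi> = indicator (Omega l) \<xi> * u \<xi>" "integrable lborel f"
    and h: "h \<in> borel_measurable borel" "AE \<xi> in lborel. h \<xi> = indicator (Omega l) \<xi> * w \<xi>" "integrable lborel h"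
      "\<And>\<xi>. \<xi> \<notin> Omega l \<Longrightarrow> h \<xi> = 0"
    and wp: "has_weak_partial l 1 0 u w"
  obtains k where "AE \<xi> in lborel. \<xi> \<in> Omega l \<longrightarrow> f \<xi> = k (snd \<xi>) + prim (\<lambda>s. h (s, snd \<xi>)) (fst \<xi>)"
proof -
  have z: "(\<integral>\<xi>. f \<xi> * tensor (deriv \<theta>) \<psi> \<xi> \<partial>lborel) = - (\<integral>\<xi>. h \<xi> * tensor \<theta> \<psi> \<xi> \<partial>lborel)"
    if B: "\<theta> \<in> bump 0 pi" "\<psi> \<in> bump (- l) l" for \<theta> \<psi>
  proof -
    have s: "smooth \<theta>" "smooth \<psi>" using B by (auto simp: bump_def)
    have "inner_L2 l u (DD 1 0 (tensor \<theta> \<psi>)) = - inner_L2 l w (tensor \<theta> \<psi>)"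
      using wp tensor_test_function[OF B] by (simp add: has_weak_partial_def)
    then show ?thesis
      using s by (simp add: Dx_tensor inner_L2_tensor[OF f(1,2)] inner_L2_tensor[OF h(1,2)] smooth_has_deriv)
  qed
  show thesis
    by (rule ACL_rectangle[OF pi_gt_zero f(3) h(3) _ z]) (use h(4) that in \<open>auto simp: Omega_def\<close>)
qed

lemma ACL_y:
  assumes l: "0 < l"
    and f: "f \<in> borel_measurable borel" "AE \<xi> in lborel. f \<xi> = indicator (Omega l) \<xi> * u \<xi>" "integrable lborel f"
    and h: "h \<in> borel_measurable borel" "AE \<xi> in lborel. h \<xi> = indicator (Omega l) \<xi> * w \<xi>" "integrable lborel h"
      "\<And>\<xi>. \<xi> \<notin> Omega l \<Longrightarrow> h \<xi> = 0"
    and wp: "has_weak_partial l 0 1 u w"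
  obtains k where "AE \<xi> in lborel. \<xi> \<in> Omega l \<longrightarrow> f \<xi> = k (fst \<xi>) + prim (\<lambda>s. h (fst \<xi>, s)) (snd \<xi>)"
proof -
  have ts: "tensor a b (swap \<xi>) = tensor b a \<xi>" for a b \<xi> by (simp add: tensor_def case_prod_unfold)
  have z: "(\<integral>\<xi>. f (swap \<xi>) * tensor (deriv \<theta>) \<psi> \<xi> \<partial>lborel) = - (\<integral>\<xi>. h (swap \<xi>) * tensor \<theta> \<psi> \<xi> \<partial>lborel)"
    if B: "\<theta> \<in> bump (- l) l" "\<psi> \<in> bump 0 pi" for \<theta> \<psi>
  proof -
    have s: "smooth \<theta>" "smooth \<psi>" using B by (auto simp: bump_def)
    have "inner_L2 l u (DD 0 1 (tensor \<psi> \<theta>)) = - inner_L2 l w (tensor \<psi> \<theta>)"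
      using wp tensor_test_function[OF B(2,1)] by (simp add: has_weak_partial_def)
    then have e: "(\<integral>\<xi>. f \<xi> * tensor \<psi> (deriv \<theta>) \<xi> \<partial>lborel) = - (\<integral>\<xi>. h \<xi> * tensor \<psi> \<theta> \<xi> \<partial>lborel)"
      using s by (simp add: Dy_tensor inner_L2_tensor[OF f(1,2)] inner_L2_tensor[OF h(1,2)] smooth_has_deriv)
    have sw: "(\<integral>\<xi>. g (swap \<xi>) * tensor a b \<xi> \<partial>lborel) = (\<integral>\<xi>. g \<xi> * tensor b a \<xi> \<partial>lborel)"
      if "g \<in> borel_measurable borel" "smooth a" "smooth b" for g a b
    proof -
      have "tensor b a \<in> borel_measurable borel"
        using that by (intro borel_measurable_continuous_onI continuous_tensor)
      then have "(\<integral>\<xi>. g (swap \<xi>) * tensor b a (swap \<xi>) \<partial>lborel) = (\<integral>\<xi>. g \<xi> * tensor b a \<xi> \<partial>lborel)"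
        using that by (intro integral_swap(1)) auto
      then show ?thesis by (simp only: ts)
    qed
    show ?thesis using e s by (simp add: sw f(1) h(1) smooth_has_deriv)
  qed
  have i: "integrable lborel (\<lambda>\<xi>. f (swap \<xi>))" "integrable lborel (\<lambda>\<xi>. h (swap \<xi>))"
    using integral_swap(2)[OF f(1)] integral_swap(2)[OF h(1)] f(3) h(3) by auto
  obtain k where k: "AE \<xi> in lborel. \<xi> \<in> {-l<..<l} \<times> {0<..<pi} \<longrightarrow>
      f (swap \<xi>) = k (snd \<xi>) + prim (\<lambda>s. h (swap (s, snd \<xi>))) (fst \<xi>)"
  proof (rule ACL_rectangle[OF _ i _ z])
    show "h (swap \<xi>) = 0" if "\<xi> \<notin> {-l<..<l} \<times> {0<..<pi}" for \<xi>
      using that by (intro h(4)) (auto simp: Omega_def mem_Times_iff)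
  qed (use l that in auto)
  have "AE \<xi> in lborel. \<xi> \<in> Omega l \<longrightarrow> f \<xi> = k (fst \<xi>) + prim (\<lambda>s. h (fst \<xi>, s)) (snd \<xi>)"
    using AE_swap[OF k] by eventually_elim (auto simp: Omega_def)
  then show thesis by (rule that)
qed

lemma prim_mult_integrable:
  assumes h: "integrable lborel h" and g: "integrable lborel g"
  shows "integrable lborel (\<lambda>x. prim h x * g x)"
proof (rule Bochner_Integration.integrable_bound[OF integrable_mult_right[OF g, of "\<integral>s. \<bar>h s\<bar> \<partial>lborel"]])
  have "prim h \<in> borel_measurable borel"
    by (intro borel_measurable_continuous_onI prim_continuous h)
  then show "(\<lambda>x. prim h x * g x) \<in> borel_measurable lborel" using g by auto
  show "AE x in lborel. norm (prim h x * g x) \<le> norm ((\<integral>s. \<bar>h s\<bar> \<partial>lborel) * g x)"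
    unfolding real_norm_def abs_mult
    by (intro AE_I2 mult_right_mono order_trans[OF prim_bound[OF h] abs_ge_self] abs_ge_zero)
qed

lemma continuous_AE_zero:
  fixes G :: "real \<Rightarrow> real"
  assumes ab: "a < b" and G: "continuous_on {a..b} G" and z: "AE x in lborel. x \<in> {a<..<b} \<longrightarrow> G x = 0"
    and x: "x \<in> {a..b}"
  shows "G x = 0"
proof -
  have C: "closed {x \<in> {a..b}. G x = 0}"
    by (rule continuous_closed_preimage_constant[OF G]) simp
  have Z: "AE x \<in> {a<..<b} in lebesgue. x \<in> {x \<in> {a..b}. G x = 0}"
    using AE_completion[OF z] by eventually_elim auto
  have "y \<in> {x \<in> {a..b}. G x = 0}" if "y \<in> {a<..<b}" for y
    by (rule mem_closed_if_AE_lebesgue_open[OF open_greaterThanLessThan C Z that])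
  then have "\<And>y. y \<in> {a<..<b} \<Longrightarrow> G y = 0" by auto
  moreover have "closure {a<..<b} = {a..b}" using ab by simp
  ultimately show ?thesis
    using continuous_constant_on_closure[of "{a<..<b}" G 0 x] G x by auto
qed

text \<open>
  On almost every line, \<open>u\<close> is a constant \<open>k(y)\<close> plus the primitive of \<open>w\<close>, and \<open>v\<close> is the
  primitive of \<open>z\<close> because it vanishes at \<open>x = 0\<close>.  As \<open>v\<close> also vanishes at \<open>x = \<pi>\<close>, the function
  \<open>z\<close> has mean zero, which removes \<open>k(y)\<close>.
\<close>

theorem weak_by_parts:
  assumes l: "0 < l" and L: "u \<in> L2 l" "w \<in> L2 l" "v \<in> L2 l" "z \<in> L2 l"
    and wu: "has_weak_partial l 1 0 u w" and wv: "has_weak_partial l 1 0 v z"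
    and c: "continuous_on (closure (Omega l)) vv" and vv: "AE \<xi> in lebesgue_on (Omega l). v \<xi> = vv \<xi>"
    and b: "\<And>x y. x \<in> {0, pi} \<Longrightarrow> y \<in> {- l..l} \<Longrightarrow> vv (x, y) = 0"
  shows "inner_L2 l u z = - inner_L2 l w v"
proof -
  obtain fu where fu: "fu \<in> borel_measurable borel" "AE \<xi> in lborel. fu \<xi> = indicator (Omega l) \<xi> * u \<xi>"
    "\<And>\<xi>. \<xi> \<notin> Omega l \<Longrightarrow> fu \<xi> = 0" "integrable lborel fu" "integrable lborel (\<lambda>\<xi>. (fu \<xi>)\<^sup>2)"
    using L2_representative[OF L(1)] by blast
  obtain hw where hw: "hw \<in> borel_measurable borel" "AE \<xi> in lborel. hw \<xi> = indicator (Omega l) \<xi> * w \<xi>"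
    "\<And>\<xi>. \<xi> \<notin> Omega l \<Longrightarrow> hw \<xi> = 0" "integrable lborel hw" "integrable lborel (\<lambda>\<xi>. (hw \<xi>)\<^sup>2)"
    using L2_representative[OF L(2)] by blast
  obtain fv where fv: "fv \<in> borel_measurable borel" "AE \<xi> in lborel. fv \<xi> = indicator (Omega l) \<xi> * v \<xi>"
    "\<And>\<xi>. \<xi> \<notin> Omega l \<Longrightarrow> fv \<xi> = 0" "integrable lborel fv" "integrable lborel (\<lambda>\<xi>. (fv \<xi>)\<^sup>2)"
    using L2_representative[OF L(3)] by blast
  obtain hz where hz: "hz \<in> borel_measurable borel" "AE \<xi> in lborel. hz \<xi> = indicator (Omega l) \<xi> * z \<xi>"
    "\<And>\<xi>. \<xi> \<notin> Omega l \<Longrightarrow> hz \<xi> = 0" "integrable lborel hz" "integrable lborel (\<lambda>\<xi>. (hz \<xi>)\<^sup>2)"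
    using L2_representative[OF L(4)] by blast
  obtain ku where ku: "AE \<xi> in lborel. \<xi> \<in> Omega l \<longrightarrow> fu \<xi> = ku (snd \<xi>) + prim (\<lambda>s. hw (s, snd \<xi>)) (fst \<xi>)"
    using ACL_x[OF fu(1,2,4) hw(1,2,4,3) wu] by blast
  obtain kv where kv: "AE \<xi> in lborel. \<xi> \<in> Omega l \<longrightarrow> fv \<xi> = kv (snd \<xi>) + prim (\<lambda>s. hz (s, snd \<xi>)) (fst \<xi>)"
    using ACL_x[OF fv(1,2,4) hz(1,2,4,3) wv] by blast
  have fvv: "AE \<xi> in lborel. \<xi> \<in> Omega l \<longrightarrow> fv \<xi> = vv \<xi>"
    using vv[unfolded AE_Omega_iff] fv(2) by eventually_elim auto
  have sl [measurable]: "(\<lambda>x. g (x, y)) \<in> borel_measurable borel" if "g \<in> borel_measurable borel"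
    for g :: "real \<times> real \<Rightarrow> real" and y
  proof (rule measurable_compose[OF _ that])
    show "(\<lambda>x. (x, y)) \<in> borel \<rightarrow>\<^sub>M borel" 
      by (intro borel_measurable_continuous_onI continuous_intros)
  qed
  have prod_i: "integrable lborel (\<lambda>\<xi>. g \<xi> * g' \<xi>)"
    if "g \<in> borel_measurable borel" "g' \<in> borel_measurable borel"
      "integrable lborel (\<lambda>\<xi>. (g \<xi>)\<^sup>2)" "integrable lborel (\<lambda>\<xi>. (g' \<xi>)\<^sup>2)" for g g' :: "real \<times> real \<Rightarrow> real"
  proof (rule Bochner_Integration.integrable_bound[OF Bochner_Integration.integrable_add[OF that(3,4)]])
    show "AE \<xi> in lborel. norm (g \<xi> * g' \<xi>) \<le> norm ((g \<xi>)\<^sup>2 + (g' \<xi>)\<^sup>2)"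
      using abs_mult_le_sum_squares by (intro AE_I2) simp
  qed (use that in auto)
  note i1 = prod_i[OF fu(1) hz(1) fu(5) hz(5)] and i2 = prod_i[OF hw(1) fv(1) hw(5) fv(5)]
  have "AE y in lborel. (\<integral>x. fu (x, y) * hz (x, y) \<partial>lborel) = - (\<integral>x. hw (x, y) * fv (x, y) \<partial>lborel)"
    using AE_slice[OF ku] AE_slice[OF kv] AE_slice[OF fvv]
      AE_integrable_slice[OF hw(4)] AE_integrable_slice[OF hz(4)]
  proof eventually_elim
    case (elim y)
    show ?case
    proof (cases "y \<in> {- l<..<l}")
      case False
      then have "fu (x, y) = 0" "hw (x, y) = 0" for x by (auto intro!: fu(3) hw(3) simp: Omega_def)
      then show ?thesis by simp
    next
      case y: True
      let ?h = "\<lambda>s. hz (s, y)" and ?g = "\<lambda>s. hw (s, y)"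
      define G where "G x = vv (x, y) - kv y - prim ?h x" for x
      have cl: "closure (Omega l) = {0..pi} \<times> {- l..l}"
        unfolding Omega_def using l by (simp add: closure_Times)
      have "continuous_on {0..pi} (\<lambda>x. (x, y))" by (intro continuous_intros)
      then have "continuous_on {0..pi} (\<lambda>x. vv (x, y))"
        by (rule continuous_on_compose2[OF c]) (use y in \<open>auto simp: cl\<close>)
      then have Gc: "continuous_on {0..pi} G"
        unfolding G_def by (intro continuous_on_diff continuous_on_const prim_continuous elim(5))
      have Gz: "AE x in lborel. x \<in> {0<..<pi} \<longrightarrow> G x = 0"
        using elim(2,3) by eventually_elim (use y in \<open>auto simp: Omega_def G_def\<close>)
      have G0: "G 0 = 0" "G pi = 0"
        using continuous_AE_zero[OF pi_gt_zero Gc Gz] by auto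
      have out: "?h x = 0" "?g x = 0" if "x \<le> 0 \<or> x \<ge> pi" for x
        using that by (auto intro!: hz(3) hw(3) simp: Omega_def)
      have "(\<lambda>s. indicator {..<0} s * ?h s) = (\<lambda>_. 0)" "(\<lambda>s. indicator {..<pi} s * ?h s) = ?h"
        using out(1) by (auto simp: fun_eq_iff indicator_def)
      then have p: "prim ?h 0 = 0" "prim ?h pi = (\<integral>s. ?h s \<partial>lborel)" by (simp_all add: prim_def)
      have kv0: "kv y = 0" using G0(1) b[of 0 y] y p(1) by (auto simp: G_def)
      have mean: "(\<integral>s. ?h s \<partial>lborel) = 0" using G0(2) b[of pi y] y p(2) kv0 by (auto simp: G_def)
      have pm: "prim ?g \<in> borel_measurable borel" "prim ?h \<in> borel_measurable borel"
        using elim by (auto intro!: borel_measurable_continuous_onI prim_continuous)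
      have "(\<integral>x. fu (x, y) * hz (x, y) \<partial>lborel) = (\<integral>x. ku y * ?h x + prim ?g x * ?h x \<partial>lborel)"
      proof (rule integral_cong_AE)
        show "AE x in lborel. fu (x, y) * hz (x, y) = ku y * ?h x + prim ?g x * ?h x"
          using elim(1)
        proof eventually_elim
          case (elim x)
          then show ?case using y out(1)[of x]
            by (cases "x \<in> {0<..<pi}") (auto simp: Omega_def algebra_simps)
        qed
      qed (use pm fu(1) hz(1) sl in auto)
      also have "\<dots> = ku y * (\<integral>s. ?h s \<partial>lborel) + (\<integral>x. prim ?g x * ?h x \<partial>lborel)"
        using elim by (simp add: prim_mult_integrable)
      also have "\<dots> = (\<integral>s. ?g s * (0 - prim ?h s) \<partial>lborel)"
        using elim by (simp add: mean prim_by_parts)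
      also have "\<dots> = (\<integral>x. - (hw (x, y) * fv (x, y)) \<partial>lborel)"
      proof (rule integral_cong_AE)
        show "AE x in lborel. ?g x * (0 - prim ?h x) = - (hw (x, y) * fv (x, y))"
          using elim(2)
        proof eventually_elim
          case (elim x)
          then show ?case using y out(2)[of x] kv0
            by (cases "x \<in> {0<..<pi}") (auto simp: Omega_def)
        qed
      qed (use pm fv(1) hw(1) sl in auto)
      finally show ?thesis by simp
    qed
  qed
  then have "(\<integral>y. (\<integral>x. fu (x, y) * hz (x, y) \<partial>lborel) \<partial>lborel)
      = (\<integral>y. - (\<integral>x. hw (x, y) * fv (x, y) \<partial>lborel) \<partial>lborel)"
    using integrable_iterated[OF i1] integrable_iterated[OF i2] by (intro integral_cong_AE) auto
  then show ?thesis
    unfolding inner_L2_representative[OF fu(1,2) hz(1,2)] inner_L2_representative[OF hw(1,2) fv(1,2)]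
      integral_iterated[OF i1] integral_iterated[OF i2] by simp
qed


text \<open>
  The variance of \<open>\<bar>h\<bar>\<close> over the interval is nonnegative.
\<close>

lemma sq_integral_le:
  fixes h :: "real \<Rightarrow> real"
  assumes l: "0 < l" and h: "integrable lborel h" "integrable lborel (\<lambda>s. (h s)\<^sup>2)"
    and out: "\<And>s. s \<notin> {- l<..<l} \<Longrightarrow> h s = 0"
  shows "(\<integral>s. \<bar>h s\<bar> \<partial>lborel)\<^sup>2 \<le> 2 * l * (\<integral>s. (h s)\<^sup>2 \<partial>lborel)"
proof -
  define m where "m = (\<integral>s. \<bar>h s\<bar> \<partial>lborel) / (2 * l)"
  have eq: "(\<bar>h s\<bar> - m * indicator {- l<..<l} s)\<^sup>2 = (h s)\<^sup>2 - 2 * m * \<bar>h s\<bar> + m\<^sup>2 * indicator {- l<..<l} s" for s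
  proof (cases "s \<in> {- l<..<l}")
    case True
    then have "indicator {- l<..<l} s = (1 :: real)" by simp
    then show ?thesis by (simp only: power2_diff power2_abs mult_1_right mult_1 mult_ac)
  next
    case False
    then have "indicator {- l<..<l} s = (0 :: real)" "h s = 0" using out by simp_all
    then show ?thesis by (simp only:) simp
  qed
  have "0 \<le> (\<integral>s. (\<bar>h s\<bar> - m * indicator {- l<..<l} s)\<^sup>2 \<partial>lborel)" by simp
  also have "\<dots> = (\<integral>s. (h s)\<^sup>2 \<partial>lborel) - 2 * m * (\<integral>s. \<bar>h s\<bar> \<partial>lborel) + m\<^sup>2 * (2 * l)"
    unfolding eq using h l integrable_indicator_interval(2)[of "- l" l] by simp
  also have "\<dots> = (\<integral>s. (h s)\<^sup>2 \<partial>lborel) - (\<integral>s. \<bar>h s\<bar> \<partial>lborel)\<^sup>2 / (2 * l)"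
    using l by (simp add: m_def power2_eq_square)
  finally have "(\<integral>s. \<bar>h s\<bar> \<partial>lborel)\<^sup>2 / (2 * l) \<le> (\<integral>s. (h s)\<^sup>2 \<partial>lborel)" by simp
  then show ?thesis using l by (simp add: divide_le_eq mult.commute)
qed

text \<open>
  An odd function is half of the integral of its \<open>y\<close>-derivative over a symmetric interval, so
  that the unknown integration constant cancels.
\<close>

theorem odd_Poincare:
  assumes l: "0 < l" and L: "f \<in> L2 l" "h \<in> L2 l" and w: "has_weak_partial l 0 1 f h"
    and odd: "AE \<xi> in lebesgue_on (Omega l). f (mirror \<xi>) = - f \<xi>"
  shows "inner_L2 l f f \<le> l\<^sup>2 * inner_L2 l h h"
proof -
  obtain F where F: "F \<in> borel_measurable borel" "AE \<xi> in lborel. F \<xi> = indicator (Omega l) \<xi> * f \<xi>"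
    "\<And>\<xi>. \<xi> \<notin> Omega l \<Longrightarrow> F \<xi> = 0" "integrable lborel F" "integrable lborel (\<lambda>\<xi>. (F \<xi>)\<^sup>2)"
    using L2_representative[OF L(1)] by blast
  obtain H where H: "H \<in> borel_measurable borel" "AE \<xi> in lborel. H \<xi> = indicator (Omega l) \<xi> * h \<xi>"
    "\<And>\<xi>. \<xi> \<notin> Omega l \<Longrightarrow> H \<xi> = 0" "integrable lborel H" "integrable lborel (\<lambda>\<xi>. (H \<xi>)\<^sup>2)"
    using L2_representative[OF L(2)] by blast
  obtain k where k: "AE \<xi> in lborel. \<xi> \<in> Omega l \<longrightarrow> F \<xi> = k (fst \<xi>) + prim (\<lambda>s. H (fst \<xi>, s)) (snd \<xi>)"
    using ACL_y[OF l F(1,2,4) H(1,2,4,3) w] by blast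
  have "AE \<xi> in lborel. \<xi> \<in> Omega l \<longrightarrow> f \<xi> = k (fst \<xi>) + prim (\<lambda>s. H (fst \<xi>, s)) (snd \<xi>)"
    using k F(2) by eventually_elim auto
  then have f: "AE \<xi> in lebesgue_on (Omega l). f \<xi> = k (fst \<xi>) + prim (\<lambda>s. H (fst \<xi>, s)) (snd \<xi>)"
    by (simp only: AE_Omega_iff)
  define Q where "Q x = (\<integral>s. (H (x, s))\<^sup>2 \<partial>lborel)" for x
  have iH: "integrable lborel (\<lambda>\<xi>. H (swap \<xi>))" "integrable lborel (\<lambda>\<xi>. (H (swap \<xi>))\<^sup>2)"
    using integral_swap(2)[OF H(1)] integral_swap(2)[of "\<lambda>\<xi>. (H \<xi>)\<^sup>2"] H(1,4,5) by auto
  have Qi: "integrable lborel Q" and Qint: "(\<integral>x. Q x \<partial>lborel) = inner_L2 l h h"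
    using integrable_iterated[OF iH(2)] integral_iterated[OF iH(2)] integral_swap(1)[of "\<lambda>\<xi>. (H \<xi>)\<^sup>2"] H(1)
    by (simp_all add: Q_def[abs_def] inner_L2_representative[OF H(1,2) H(1,2)] power2_eq_square)
  have "AE x in lborel. integrable lborel (\<lambda>s. H (x, s)) \<and> integrable lborel (\<lambda>s. (H (x, s))\<^sup>2)"
    using AE_integrable_slice[OF iH(1)] AE_integrable_slice[OF iH(2)] by eventually_elim simp
  from AE_swap[OF AE_snd[OF this]]
  have "AE \<xi> in (lborel :: (real \<times> real) measure). integrable lborel (\<lambda>s. H (fst \<xi>, s)) \<and> integrable lborel (\<lambda>s. (H (fst \<xi>, s))\<^sup>2)"
    by simp
  then have "AE \<xi> in lborel. \<xi> \<in> Omega l \<longrightarrow>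
      integrable lborel (\<lambda>s. H (fst \<xi>, s)) \<and> integrable lborel (\<lambda>s. (H (fst \<xi>, s))\<^sup>2)"
    by eventually_elim simp
  then have "AE \<xi> in lebesgue_on (Omega l). integrable lborel (\<lambda>s. H (fst \<xi>, s)) \<and> integrable lborel (\<lambda>s. (H (fst \<xi>, s))\<^sup>2)"
    by (simp only: AE_Omega_iff)
  then have le: "AE \<xi> in lebesgue_on (Omega l). (f \<xi>)\<^sup>2 \<le> (l / 2) * Q (fst \<xi>)"
    using f AE_mirror[OF f] odd
  proof eventually_elim
    case (elim \<xi>)
    let ?h = "\<lambda>s. H (fst \<xi>, s)"
    have "2 * f \<xi> = prim ?h (snd \<xi>) - prim ?h (- snd \<xi>)" using elim(2-4) by simp
    then have "2 * \<bar>f \<xi>\<bar> \<le> (\<integral>s. \<bar>?h s\<bar> \<partial>lborel)"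
      using prim_diff_bound[of ?h "snd \<xi>" "- snd \<xi>"] elim(1) by simp
    then have "(2 * \<bar>f \<xi>\<bar>)\<^sup>2 \<le> (\<integral>s. \<bar>?h s\<bar> \<partial>lborel)\<^sup>2" by (rule power_mono) simp
    also have "\<dots> \<le> 2 * l * Q (fst \<xi>)"
      unfolding Q_def using elim(1) by (intro sq_integral_le l) (auto intro!: H(3) simp: Omega_def)
    finally show ?case by (simp add: power_mult_distrib)
  qed
  let ?G = "\<lambda>\<xi>::real \<times> real. Q (fst \<xi>) * indicator {- l<..<l} (snd \<xi>)"
  have Gi: "integrable lborel ?G" by (intro integrable_product Qi integrable_indicator_interval)
  have "Q x = 0" if "x \<notin> {0<..<pi}" for x
  proof -
    have "H (x, s) = 0" for s using that by (intro H(3)) (auto simp: Omega_def)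
    then show ?thesis by (simp add: Q_def)
  qed
  then have "?G \<xi> = indicator (Omega l) \<xi> * Q (fst \<xi>)" for \<xi>
    by (cases \<xi>) (auto simp: Omega_def indicator_def)
  then have Ge: "AE \<xi> in lborel. ?G \<xi> = indicator (Omega l) \<xi> * Q (fst \<xi>)" by simp
  have Gm: "?G \<in> borel_measurable borel" using borel_measurable_integrable[OF Gi] by simp
  have "inner_L2 l f f = (\<integral>\<xi>. (f \<xi>)\<^sup>2 \<partial>lebesgue_on (Omega l))"
    by (simp add: inner_L2_def power2_eq_square)
  also have "\<dots> \<le> (\<integral>\<xi>. (l / 2) * Q (fst \<xi>) \<partial>lebesgue_on (Omega l))"
  proof (rule integral_mono_AE[OF _ _ le])
    show "integrable (lebesgue_on (Omega l)) (\<lambda>\<xi>. (f \<xi>)\<^sup>2)" using L(1) by (simp add: L2_def)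
    show "integrable (lebesgue_on (Omega l)) (\<lambda>\<xi>. (l / 2) * Q (fst \<xi>))"
      using integral_Omega_eq_lborel(2)[OF Gm Ge] Gi by (intro integrable_mult_right) simp
  qed
  also have "\<dots> = (l / 2) * (\<integral>\<xi>. ?G \<xi> \<partial>lborel)"
    using integral_Omega_eq_lborel(1)[OF Gm Ge] by simp
  also have "(\<integral>\<xi>. ?G \<xi> \<partial>lborel) = 2 * l * inner_L2 l h h"
    using l by (simp add: integral_iterated[OF Gi] Qint mult.commute)
  finally show ?thesis by (simp add: power2_eq_square)
qed


section \<open>The energy form of the plate\<close>

lemma integral_partial_lborel:
  fixes G g :: "real \<times> real \<Rightarrow> real"
  assumes K: "compact K" and g0: "\<And>\<xi>. \<xi> \<notin> K \<Longrightarrow> g \<xi> = 0" and G0: "\<And>\<xi>. \<xi> \<notin> K \<Longrightarrow> G \<xi> = 0"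
    and c: "continuous_on UNIV g"
    and D: "\<And>x y. ((\<lambda>s. G (s, y)) has_real_derivative g (x, y)) (at x)"
  shows "(\<integral>\<xi>. g \<xi> \<partial>lborel) = 0"
proof -
  have "(\<lambda>\<xi>. indicator K \<xi> *\<^sub>R g \<xi>) = g" using g0 by (auto simp: fun_eq_iff indicator_def)
  moreover have "integrable lborel (\<lambda>\<xi>. indicator K \<xi> *\<^sub>R g \<xi>)"
    by (rule borel_integrable_compact[OF K continuous_on_subset[OF c]]) simp
  ultimately have gi: "integrable lborel g" by simp
  obtain B where B: "\<And>\<xi>. \<xi> \<in> K \<Longrightarrow> norm \<xi> < B" "0 < B"
    using compact_imp_bounded[OF K] unfolding bounded_pos_less by blast
  have out: "(x, y) \<notin> K" if "B \<le> \<bar>x\<bar>" for x y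
    using B(1)[of "(x, y)"] norm_fst_le[of x y] that by auto
  have "(\<integral>x. g (x, y) \<partial>lborel) = 0" for y
  proof -
    have "(\<lambda>x. g (x, y)) = (\<lambda>x. g (x, y) * indicator {- B..B} x)"
    proof
      show "g (x, y) = g (x, y) * indicator {- B..B} x" for x
        using g0[OF out, of x y] by (cases "x \<in> {- B..B}") auto
    qed
    then have "(\<integral>x. g (x, y) \<partial>lborel) = (\<integral>x. g (x, y) * indicator {- B..B} x \<partial>lborel)" by simp
    also have "\<dots> = G (B, y) - G (- B, y)"
    proof (rule integral_FTC_Icc_real[OF _ D])
      have "continuous_on UNIV (\<lambda>x. g (x, y))"
        by (rule continuous_on_compose2[OF c]) (auto intro!: continuous_intros)
      then show "isCont (\<lambda>x. g (x, y)) x" for x by (simp add: continuous_on_eq_continuous_at)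
    qed (use B in simp)
    also have "\<dots> = 0" using G0[OF out] B(2) by simp
    finally show ?thesis .
  qed
  then show ?thesis by (simp add: integral_iterated[OF gi])
qed

lemma integral_Omega_supported:
  fixes g :: "real \<times> real \<Rightarrow> real"
  assumes "K \<subseteq> Omega l" "\<And>\<xi>. \<xi> \<notin> K \<Longrightarrow> g \<xi> = 0" "continuous_on UNIV g"
  shows "(\<integral>\<xi>. g \<xi> \<partial>lebesgue_on (Omega l)) = (\<integral>\<xi>. g \<xi> \<partial>lborel)"
proof (rule integral_Omega_eq_lborel(1))
  show "g \<in> borel_measurable borel" using assms(3) by (rule borel_measurable_continuous_onI)
  have "g \<xi> = indicator (Omega l) \<xi> * g \<xi>" for \<xi>
    using assms(1) assms(2)[of \<xi>] by (auto simp: indicator_def)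
  then show "AE \<xi> in lborel. g \<xi> = indicator (Omega l) \<xi> * g \<xi>" by simp
qed

lemma smooth_function_of_x_L2:
  assumes "smooth a"
  shows "(\<lambda>\<xi>. a (fst \<xi>)) \<in> L2 l"
proof -
  have "bounded (a ` {0..pi})"
    by (intro compact_imp_bounded compact_continuous_image smooth_continuous assms) simp
  then obtain C where C: "\<forall>x\<in>{0..pi}. \<bar>a x\<bar> \<le> C" unfolding bounded_iff by auto
  have "continuous_on (Omega l) (\<lambda>\<xi>. a (fst \<xi>))"
    by (rule continuous_on_compose2[OF smooth_continuous[OF assms, of UNIV]]) (auto intro!: continuous_intros)
  then show ?thesis
    by (intro L2_bounded[where C = C] continuous_imp_measurable_on_sets_lebesgue Omega_lebesgue)
      (use C in \<open>auto simp: Omega_def\<close>)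
qed

lemma weak_partial_function_of_x:
  assumes a: "smooth a"
  shows "has_weak_partial l 1 0 (\<lambda>\<xi>. a (fst \<xi>)) (\<lambda>\<xi>. deriv a (fst \<xi>))"
    and "has_weak_partial l 0 1 (\<lambda>\<xi>. a (fst \<xi>)) (\<lambda>_. 0)"
proof -
  have ca: "continuous_on UNIV (\<lambda>\<xi>::real \<times> real. b (fst \<xi>))" if "smooth b" for b
    by (rule continuous_on_compose2[OF smooth_continuous[OF that, of UNIV]]) (auto intro!: continuous_intros)
  note L = smooth_function_of_x_L2[OF a] smooth_function_of_x_L2[OF smooth_has_deriv(2)[OF a]]
  show "has_weak_partial l 1 0 (\<lambda>\<xi>. a (fst \<xi>)) (\<lambda>\<xi>. deriv a (fst \<xi>))"
    unfolding has_weak_partial_def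
  proof
    fix \<phi> assume t: "\<phi> \<in> test_functions (Omega l)"
    then obtain K where K: "compact K" "K \<subseteq> Omega l" "\<And>\<xi>. \<xi> \<notin> K \<Longrightarrow> \<phi> \<xi> = 0" and s: "\<forall>k. times_cont_diff k \<phi>"
      by (auto simp: test_functions_def)
    obtain K' where K': "compact K'" "K' \<subseteq> Omega l" "\<And>\<xi>. \<xi> \<notin> K' \<Longrightarrow> Dx \<phi> \<xi> = 0"
      using test_function_D(1)[OF t] by (auto simp: test_functions_def)
    let ?g = "\<lambda>\<xi>. a (fst \<xi>) * Dx \<phi> \<xi> + deriv a (fst \<xi>) * \<phi> \<xi>"
    have gc: "continuous_on UNIV ?g"
      by (intro continuous_intros ca a smooth_has_deriv(2) smooth2_D(5)[OF s] smooth2_D(5)[OF smooth2_D(3)[OF s]])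
    have "(\<integral>\<xi>. ?g \<xi> \<partial>lebesgue_on (Omega l)) = (\<integral>\<xi>. ?g \<xi> \<partial>lborel)"
      by (rule integral_Omega_supported[of "K \<union> K'"]) (use K K' gc in auto)
    also have "\<dots> = 0"
    proof (rule integral_partial_lborel[of "K \<union> K'" _ "\<lambda>\<xi>. a (fst \<xi>) * \<phi> \<xi>"])
      show "((\<lambda>s. a (fst (s, y)) * \<phi> (s, y)) has_real_derivative ?g (x, y)) (at x)" for x y
        using smooth_has_deriv(1)[OF a, of x] smooth2_D(1)[OF s, of y x]
        by (auto intro!: derivative_eq_intros)
    qed (use K K' gc in auto)
    finally have "inner_L2 l (\<lambda>\<xi>. a (fst \<xi>)) (Dx \<phi>) + inner_L2 l (\<lambda>\<xi>. deriv a (fst \<xi>)) \<phi> = 0"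
      unfolding inner_L2_def
      using L2_integrable_mult[OF L(1) test_function_L2[OF test_function_D(1)[OF t]]]
        L2_integrable_mult[OF L(2) test_function_L2[OF t]] by simp
    then show "inner_L2 l (\<lambda>\<xi>. a (fst \<xi>)) (DD 1 0 \<phi>) = (-1) ^ (1 + 0) * inner_L2 l (\<lambda>\<xi>. deriv a (fst \<xi>)) \<phi>"
      by simp
  qed
  show "has_weak_partial l 0 1 (\<lambda>\<xi>. a (fst \<xi>)) (\<lambda>_. 0)"
    unfolding has_weak_partial_def
  proof
    fix \<phi> assume t: "\<phi> \<in> test_functions (Omega l)"
    then obtain K where K: "compact K" "K \<subseteq> Omega l" "\<And>\<xi>. \<xi> \<notin> K \<Longrightarrow> \<phi> \<xi> = 0" and s: "\<forall>k. times_cont_diff k \<phi>"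
      by (auto simp: test_functions_def)
    obtain K' where K': "compact K'" "K' \<subseteq> Omega l" "\<And>\<xi>. \<xi> \<notin> K' \<Longrightarrow> Dy \<phi> \<xi> = 0"
      using test_function_D(2)[OF t] by (auto simp: test_functions_def)
    let ?g = "\<lambda>\<xi>. a (fst \<xi>) * Dy \<phi> \<xi>"
    have gc: "continuous_on UNIV ?g"
      by (intro continuous_intros ca a smooth2_D(5)[OF smooth2_D(4)[OF s]])
    have sc: "continuous_on UNIV (\<lambda>\<xi>. ?g (swap \<xi>))"
      by (rule continuous_on_compose2[OF gc]) (auto intro!: continuous_intros)
    have inK: "swap \<xi> \<notin> K \<union> K'" if "\<xi> \<notin> swap ` (K \<union> K')" for \<xi> :: "real \<times> real"
    proof
      assume "swap \<xi> \<in> K \<union> K'"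
      then have "swap (swap \<xi>) \<in> swap ` (K \<union> K')" by (rule imageI)
      then show False using that by simp
    qed
    have "inner_L2 l (\<lambda>\<xi>. a (fst \<xi>)) (Dy \<phi>) = (\<integral>\<xi>. ?g \<xi> \<partial>lborel)"
      unfolding inner_L2_def by (rule integral_Omega_supported[of K']) (use K' gc in auto)
    also have "\<dots> = (\<integral>\<xi>. ?g (swap \<xi>) \<partial>lborel)"
      by (rule integral_swap(1)[symmetric]) (rule borel_measurable_continuous_onI[OF gc])
    also have "\<dots> = 0"
    proof (rule integral_partial_lborel[of "swap ` (K \<union> K')" _ "\<lambda>\<xi>. a (snd \<xi>) * \<phi> (swap \<xi>)"])
      show "compact (swap ` (K \<union> K'))"
        by (intro compact_continuous_image continuous_intros compact_Un K K')
      show "((\<lambda>s. a (snd (s, y)) * \<phi> (swap (s, y))) has_real_derivative ?g (swap (x, y))) (at x)" for x y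
        using smooth2_D(2)[OF s, of y x] by (auto intro!: derivative_eq_intros)
    qed (use inK K(3) K'(3) sc in auto)
    finally show "inner_L2 l (\<lambda>\<xi>. a (fst \<xi>)) (DD 0 1 \<phi>) = (-1) ^ (0 + 1) * inner_L2 l (\<lambda>_. 0) \<phi>"
      by (simp add: inner_L2_def)
  qed
qed

lemma has_weak_partial_compose:
  "has_weak_partial l 1 0 u w \<Longrightarrow> has_weak_partial l 1 0 w z \<Longrightarrow> has_weak_partial l 2 0 u z"
  "has_weak_partial l 1 0 u w \<Longrightarrow> has_weak_partial l 0 1 w z \<Longrightarrow> has_weak_partial l 1 1 u z"
  "has_weak_partial l 0 1 u w \<Longrightarrow> has_weak_partial l 0 1 w z \<Longrightarrow> has_weak_partial l 0 2 u z"
  by (auto simp: has_weak_partial_def test_function_D numeral_2_eq_2)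

text \<open>
  Both coefficients are kept general since the family is then closed under differentiation.
\<close>

lemma smooth_sin_cos: "smooth (\<lambda>x. c * sin x + d * cos x)"
proof -
  have "Ck n (\<lambda>x. c * sin x + d * cos x)" for n
  proof (induction n arbitrary: c d)
    case 0
    then show ?case by (auto intro!: continuous_intros)
  next
    case (Suc n)
    have "((\<lambda>x. c * sin x + d * cos x) has_real_derivative (- d) * sin x + c * cos x) (at x)" for x
      by (auto intro!: derivative_eq_intros)
    then show ?case by (rule Ck_SucI) (rule Suc)
  qed
  then show ?thesis by (simp add: smooth_def)
qed

lemma inner_H2star_eq:
  assumes "u \<in> H2 l" "v \<in> H2 l"
  shows "inner_H2star l u v =
      inner_L2 l (weak_partial l 2 0 u) (weak_partial l 2 0 v)
    + inner_L2 l (weak_partial l 0 2 u) (weak_partial l 0 2 v)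
    + 1 / 5 * (inner_L2 l (weak_partial l 2 0 u) (weak_partial l 0 2 v)
             + inner_L2 l (weak_partial l 0 2 u) (weak_partial l 2 0 v))
    + 8 / 5 * inner_L2 l (weak_partial l 1 1 u) (weak_partial l 1 1 v)"
proof -
  have i: "integrable (lebesgue_on (Omega l)) (\<lambda>\<xi>. weak_partial l i j u \<xi> * weak_partial l k m v \<xi>)"
    if "i + j \<le> 2" "k + m \<le> 2" for i j k m
    using assms that by (intro L2_integrable_mult weak_partial_spec)
  have "inner_H2star l u v = (\<integral>\<xi>. weak_partial l 2 0 u \<xi> * weak_partial l 2 0 v \<xi>
      + weak_partial l 0 2 u \<xi> * weak_partial l 0 2 v \<xi>
      + (1 / 5 * (weak_partial l 2 0 u \<xi> * weak_partial l 0 2 v \<xi>)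
      + 1 / 5 * (weak_partial l 0 2 u \<xi> * weak_partial l 2 0 v \<xi>))
      + 8 / 5 * (weak_partial l 1 1 u \<xi> * weak_partial l 1 1 v \<xi>) \<partial>lebesgue_on (Omega l))"
    unfolding inner_H2star_def Let_def poisson_def
    by (intro Bochner_Integration.integral_cong refl) (simp add: algebra_simps)
  also have "\<dots> = inner_L2 l (weak_partial l 2 0 u) (weak_partial l 2 0 v)
      + inner_L2 l (weak_partial l 0 2 u) (weak_partial l 0 2 v)
      + (1 / 5 * inner_L2 l (weak_partial l 2 0 u) (weak_partial l 0 2 v)
             + 1 / 5 * inner_L2 l (weak_partial l 0 2 u) (weak_partial l 2 0 v))
      + 8 / 5 * inner_L2 l (weak_partial l 1 1 u) (weak_partial l 1 1 v)"
    unfolding inner_L2_def by (simp add: i)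
  finally show ?thesis by (simp add: algebra_simps)
qed

text \<open>Completing the square in \<open>u\<^sub>y\<^sub>y\<close>, respectively \<open>u\<^sub>x\<^sub>x\<close>; here \<open>24/25 = 1 - \<sigma>\<^sup>2\<close>.\<close>

lemma inner_H2star_lower:
  assumes u: "u \<in> H2 l"
  shows "24 / 25 * inner_L2 l (weak_partial l 2 0 u) (weak_partial l 2 0 u)
      + 8 / 5 * inner_L2 l (weak_partial l 1 1 u) (weak_partial l 1 1 u) \<le> inner_H2star l u u"
    and "24 / 25 * inner_L2 l (weak_partial l 0 2 u) (weak_partial l 0 2 u)
      + 8 / 5 * inner_L2 l (weak_partial l 1 1 u) (weak_partial l 1 1 u) \<le> inner_H2star l u u"
proof -
  have L: "weak_partial l 2 0 u \<in> L2 l" "weak_partial l 0 2 u \<in> L2 l"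
    using u by (auto intro!: weak_partial_spec)
  have q: "0 \<le> inner_L2 l f f + 2 / 5 * inner_L2 l f g + 1 / 25 * inner_L2 l g g"
    if f: "f \<in> L2 l" and g: "g \<in> L2 l" for f g
  proof -
    have "0 \<le> inner_L2 l (\<lambda>\<xi>. 1 * f \<xi> + (1 / 5) * g \<xi>) (\<lambda>\<xi>. 1 * f \<xi> + (1 / 5) * g \<xi>)"
      by (rule inner_L2_nonneg)
    also have "\<dots> = 1 * (1 * inner_L2 l f f + (1 / 5) * inner_L2 l f g)
        + (1 / 5) * (1 * inner_L2 l f g + (1 / 5) * inner_L2 l g g)"
      by (simp only: inner_L2_lincomb[OF f g L2_lincomb[OF f g]] inner_L2_lincomb_right[OF f g f]
          inner_L2_lincomb_right[OF f g g] inner_L2_commute[of l g f])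
    finally show ?thesis by (simp add: field_simps)
  qed
  show "24 / 25 * inner_L2 l (weak_partial l 2 0 u) (weak_partial l 2 0 u)
      + 8 / 5 * inner_L2 l (weak_partial l 1 1 u) (weak_partial l 1 1 u) \<le> inner_H2star l u u"
    "24 / 25 * inner_L2 l (weak_partial l 0 2 u) (weak_partial l 0 2 u)
      + 8 / 5 * inner_L2 l (weak_partial l 1 1 u) (weak_partial l 1 1 u) \<le> inner_H2star l u u"
    using q[OF L(2,1)] q[OF L]
    by (simp_all add: inner_H2star_eq[OF u u] inner_L2_commute[of l "weak_partial l 2 0 u" "weak_partial l 0 2 u"])
qed

lemma inner_H2star_nonneg: "u \<in> H2 l \<Longrightarrow> 0 \<le> inner_H2star l u u"
  using inner_H2star_lower(1)[of u l] inner_L2_nonneg[of l "weak_partial l 2 0 u"]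
    inner_L2_nonneg[of l "weak_partial l 1 1 u"] by linarith

lemma norm_H2star_sq: "u \<in> H2 l \<Longrightarrow> (norm_H2star l u)\<^sup>2 = inner_H2star l u u"
  by (simp add: norm_H2star_def inner_H2star_nonneg)

lemma H2star_H2: "u \<in> H2star l \<Longrightarrow> u \<in> H2 l"
  by (simp add: H2star_def)

lemma closure_Omega: "0 < l \<Longrightarrow> closure (Omega l) = {0..pi} \<times> {- l..l}"
  unfolding Omega_def by (simp add: closure_Times)

lemma H2star_lincomb:
  assumes "u \<in> H2star l" "v \<in> H2star l"
  shows "(\<lambda>\<xi>. a * u \<xi> + b * v \<xi>) \<in> H2star l"
proof -
  obtain w z where w: "continuous_on (closure (Omega l)) w" "AE \<xi> in lebesgue_on (Omega l). u \<xi> = w \<xi>"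
      "\<forall>x\<in>{0, pi}. \<forall>y\<in>{-l..l}. w (x, y) = 0"
    and z: "continuous_on (closure (Omega l)) z" "AE \<xi> in lebesgue_on (Omega l). v \<xi> = z \<xi>"
      "\<forall>x\<in>{0, pi}. \<forall>y\<in>{-l..l}. z (x, y) = 0"
    using assms by (auto simp: H2star_def)
  have "AE \<xi> in lebesgue_on (Omega l). a * u \<xi> + b * v \<xi> = a * w \<xi> + b * z \<xi>"
    using w(2) z(2) by eventually_elim simp
  moreover have "continuous_on (closure (Omega l)) (\<lambda>\<xi>. a * w \<xi> + b * z \<xi>)"
    using w(1) z(1) by (intro continuous_intros)
  moreover have "\<forall>x\<in>{0, pi}. \<forall>y\<in>{-l..l}. a * w (x, y) + b * z (x, y) = 0"
    using w(3) z(3) by simp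
  moreover have "(\<lambda>\<xi>. a * u \<xi> + b * v \<xi>) \<in> H2 l" using assms by (intro H2_lincomb H2star_H2)
  ultimately show ?thesis unfolding H2star_def mem_Collect_eq by blast
qed

lemma H2star_reflect:
  assumes l: "0 < l" and u: "u \<in> H2star l"
  shows "reflect u \<in> H2star l"
proof -
  obtain w where w: "continuous_on (closure (Omega l)) w" "AE \<xi> in lebesgue_on (Omega l). u \<xi> = w \<xi>"
      "\<forall>x\<in>{0, pi}. \<forall>y\<in>{-l..l}. w (x, y) = 0"
    using u by (auto simp: H2star_def)
  have "AE \<xi> in lebesgue_on (Omega l). reflect u \<xi> = reflect w \<xi>"
    using AE_mirror[OF w(2)] by (simp add: reflect_apply)
  moreover have "continuous_on (closure (Omega l)) (\<lambda>\<xi>. w (mirror \<xi>))"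
  proof (rule continuous_on_compose2[OF w(1)])
    show "continuous_on (closure (Omega l)) mirror" by (intro continuous_intros)
    show "mirror ` closure (Omega l) \<subseteq> closure (Omega l)" by (auto simp: closure_Omega[OF l])
  qed
  then have "continuous_on (closure (Omega l)) (reflect w)" by (simp add: reflect_apply[abs_def])
  moreover have "\<forall>x\<in>{0, pi}. \<forall>y\<in>{-l..l}. reflect w (x, y) = 0"
    using w(3) by (simp add: reflect_apply)
  moreover have "reflect u \<in> H2 l" using u by (intro H2_reflect H2star_H2)
  ultimately show ?thesis unfolding H2star_def mem_Collect_eq by blast
qed

lemma H2star_torsional: "0 < l \<Longrightarrow> u \<in> H2star l \<Longrightarrow> torsional u \<in> H2star l"
  unfolding torsional_eq by (intro H2star_lincomb H2star_reflect)

text \<open>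
  The right-hand side is continuous in \<open>v\<close> for the \<open>L\<^sup>2\<close> norm alone, so the nonlocal term of the
  equation can be paired with velocities, which have no derivative in \<open>x\<close>.
\<close>

lemma inner_x_by_parts:
  assumes l: "0 < l" and u: "u \<in> H2star l" and v: "v \<in> H2star l"
  shows "inner_L2 l (weak_partial l 1 0 u) (weak_partial l 1 0 v) = - inner_L2 l (weak_partial l 2 0 u) v"
proof -
  obtain w where w: "continuous_on (closure (Omega l)) w" "AE \<xi> in lebesgue_on (Omega l). v \<xi> = w \<xi>"
      "\<forall>x\<in>{0, pi}. \<forall>y\<in>{-l..l}. w (x, y) = 0"
    using v by (auto simp: H2star_def)
  note u' = H2star_H2[OF u] and v' = H2star_H2[OF v]
  show ?thesis
    by (rule weak_by_parts[OF l _ _ _ _ weak_partial_iterate(1)[OF u'] weak_partial_spec(2)[OF v'] w(1,2)])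
      (use w(3) H2_L2[OF v'] in \<open>auto intro!: weak_partial_spec u' v'\<close>)
qed

lemma bdd_below_Rayleigh:
  "bdd_below {(norm_H2star l v)\<^sup>2 / (norm_L2 l v)\<^sup>2 | v. v \<in> H2star l \<and> norm_L2 l v \<noteq> 0}"
  by (rule bdd_belowI[of _ 0]) auto

lemma lambda1_le:
  assumes v: "v \<in> H2star l"
  shows "lambda1 l * inner_L2 l v v \<le> inner_H2star l v v"
proof (cases "norm_L2 l v = 0")
  case True
  then show ?thesis using inner_H2star_nonneg[OF H2star_H2[OF v]] by (simp flip: norm_L2_sq)
next
  case False
  then have "lambda1 l \<le> (norm_H2star l v)\<^sup>2 / (norm_L2 l v)\<^sup>2"
    unfolding lambda1_def using v by (intro cInf_lower bdd_below_Rayleigh) blast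
  then show ?thesis using False H2star_H2[OF v]
    by (simp add: field_simps norm_H2star_sq norm_L2_sq[symmetric])
qed

text \<open>The competitor \<open>sin x\<close> has Rayleigh quotient 1.\<close>

lemma lambda1_le_1:
  assumes l: "0 < l"
  shows "lambda1 l \<le> 1"
proof -
  define S :: "real \<times> real \<Rightarrow> real" where "S = (\<lambda>\<xi>. 1 * sin (fst \<xi>) + 0 * cos (fst \<xi>))"
  define C :: "real \<times> real \<Rightarrow> real" where "C = (\<lambda>\<xi>. 0 * sin (fst \<xi>) + 1 * cos (fst \<xi>))"
  define S' :: "real \<times> real \<Rightarrow> real" where "S' = (\<lambda>\<xi>. (- 1) * sin (fst \<xi>) + 0 * cos (fst \<xi>))"
  define Z :: "real \<times> real \<Rightarrow> real" where "Z = (\<lambda>\<xi>. 0)"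
  have d: "deriv (\<lambda>x. c * sin x + d * cos x) = (\<lambda>x. (- d) * sin x + c * cos x)" for c d :: real
    by (rule ext, rule DERIV_imp_deriv) (auto intro!: derivative_eq_intros)
  note W = weak_partial_function_of_x[OF smooth_sin_cos, of l, unfolded d]
  have L: "S \<in> L2 l" "C \<in> L2 l" "S' \<in> L2 l" "Z \<in> L2 l"
    unfolding S_def C_def S'_def Z_def
    by (rule smooth_function_of_x_L2[OF smooth_sin_cos])+ (simp add: L2_bounded[where C = 0])
  have x: "has_weak_partial l 1 0 S C" "has_weak_partial l 1 0 C S'" "has_weak_partial l 0 1 S Z" "has_weak_partial l 0 1 C Z"
    using W(1)[of 1 0] W(1)[of 0 1] W(2)[of 1 0] W(2)[of 0 1] by (simp_all add: S_def C_def S'_def Z_def)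
  have z: "has_weak_partial l 0 1 Z Z" by (simp add: Z_def has_weak_partial_def inner_L2_def)
  note p = has_weak_partial_compose(1)[OF x(1,2)] has_weak_partial_compose(2)[OF x(1,4)] has_weak_partial_compose(3)[OF x(3) z]
  have "S \<in> H2 l" unfolding H2_def mem_Collect_eq
  proof (intro conjI allI impI L)
    fix i j :: nat assume "i + j \<le> 2"
    then consider "i = 0" "j = 0" | "i = 1" "j = 0" | "i = 0" "j = 1" | "i = 2" "j = 0" | "i = 1" "j = 1" | "i = 0" "j = 2"
      by linarith
    then show "\<exists>w\<in>L2 l. has_weak_partial l i j S w"
    proof cases
      case 1
      have "has_weak_partial l 0 0 S S" by (simp add: has_weak_partial_def)
      with 1 L show ?thesis by blast
    qed (use x p L in blast)+
  qed
  moreover have "continuous_on (closure (Omega l)) S" unfolding S_def by (intro continuous_intros)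
  ultimately have S: "S \<in> H2star l"
    unfolding H2star_def by (auto intro!: exI[of _ S] simp: S_def)
  note S2 = H2star_H2[OF S]
  have e: "AE \<xi> in lebesgue_on (Omega l). weak_partial l 2 0 S \<xi> = S' \<xi>"
    "AE \<xi> in lebesgue_on (Omega l). weak_partial l 1 1 S \<xi> = Z \<xi>"
    "AE \<xi> in lebesgue_on (Omega l). weak_partial l 0 2 S \<xi> = Z \<xi>"
    by (rule weak_partial_unique[OF _ _ weak_partial_spec(2)[OF S2]]; (intro weak_partial_spec S2 L p)?; simp)+
  have w: "weak_partial l 2 0 S \<in> L2 l" "weak_partial l 1 1 S \<in> L2 l" "weak_partial l 0 2 S \<in> L2 l"
    by (intro weak_partial_spec S2; simp)+
  have "inner_H2star l S S = inner_L2 l S' S' + inner_L2 l Z Z + 1 / 5 * (inner_L2 l S' Z + inner_L2 l Z S') + 8 / 5 * inner_L2 l Z Z"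
    unfolding inner_H2star_eq[OF S2 S2]
    by (simp only: inner_L2_cong[OF w(1) L(3) w(1) L(3) e(1) e(1)] inner_L2_cong[OF w(3) L(4) w(3) L(4) e(3) e(3)]
        inner_L2_cong[OF w(1) L(3) w(3) L(4) e(1) e(3)] inner_L2_cong[OF w(3) L(4) w(1) L(3) e(3) e(1)]
        inner_L2_cong[OF w(2) L(4) w(2) L(4) e(2) e(2)])
  also have "\<dots> = inner_L2 l S S" by (simp add: inner_L2_def Z_def S_def S'_def)
  finally have eq: "(norm_H2star l S)\<^sup>2 = (norm_L2 l S)\<^sup>2" by (simp add: norm_H2star_sq[OF S2] norm_L2_sq)
  have nz: "norm_L2 l S \<noteq> 0"
  proof
    assume "norm_L2 l S = 0"
    then have "AE \<xi> in lebesgue_on (Omega l). S \<xi> = 0" by (simp add: norm_L2_eq_0_iff[OF L(1)])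
    then have "AE \<xi> in lborel. \<xi> \<in> Omega l \<longrightarrow> S \<xi> = 0" by (simp only: AE_Omega_iff)
    then have "AE \<xi> \<in> Omega l in lebesgue. \<xi> \<in> {}"
      using AE_completion by (rule AE_mp[OF AE_completion]) (auto simp: S_def Omega_def sin_gt_zero less_imp_neq[symmetric])
    moreover have "open (Omega l)" by (auto simp: Omega_def intro: open_Times)
    moreover have "(1, 0) \<in> Omega l" using l pi_gt3 by (auto simp: Omega_def)
    ultimately show False using mem_closed_if_AE_lebesgue_open[of "Omega l" "{}"] by blast
  qed
  have "lambda1 l \<le> (norm_H2star l S)\<^sup>2 / (norm_L2 l S)\<^sup>2"
    unfolding lambda1_def using S nz by (intro cInf_lower bdd_below_Rayleigh) blast
  then show ?thesis using eq nz by simp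
qed

text \<open>
  For odd functions the mixed derivative controls \<open>v\<^sub>x\<close> with a constant that is uniform for
  \<open>l < \<pi>\<close>.  This gain compensates the loss of \<open>1 - \<sigma>\<^sup>2\<close> against \<open>1\<close> in the form, and keeps
  \<open>P \<parallel>v\<^sub>x\<parallel>\<^sup>2\<close> below a fixed fraction of the energy for all \<open>P < \<lambda>\<^sub>1\<close>.
\<close>

lemma odd_coercivity:
  assumes l: "0 < l" "l < pi" and lam: "0 \<le> lambda1 l" and v: "v \<in> H2star l"
    and odd: "reflect v = (\<lambda>\<xi>. - v \<xi>)"
  shows "lambda1 l * inner_L2 l (weak_partial l 1 0 v) (weak_partial l 1 0 v) \<le> 49 / 50 * inner_H2star l v v"
proof -
  note v2 = H2star_H2[OF v]
  have vL: "v \<in> L2 l" "weak_partial l 1 0 v \<in> L2 l" "weak_partial l 2 0 v \<in> L2 l" "weak_partial l 1 1 v \<in> L2 l"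
    by (rule H2_L2[OF v2]) (auto intro!: weak_partial_spec v2)
  define X A B H L where "X = inner_L2 l (weak_partial l 1 0 v) (weak_partial l 1 0 v)"
    and "A = inner_L2 l (weak_partial l 2 0 v) (weak_partial l 2 0 v)"
    and "B = inner_L2 l (weak_partial l 1 1 v) (weak_partial l 1 1 v)"
    and "H = inner_H2star l v v" and "L = inner_L2 l v v"
  have nn: "0 \<le> X" "0 \<le> A" "0 \<le> B" "0 \<le> H" "0 \<le> L"
    unfolding X_def A_def B_def H_def L_def by (auto intro!: inner_L2_nonneg inner_H2star_nonneg v2)
  have "reflect v = (\<lambda>\<xi>. (- 1) * v \<xi> + 0 * v \<xi>)" using odd by simp
  then have "AE \<xi> in lebesgue_on (Omega l). weak_partial l 1 0 (reflect v) \<xi> = (- 1) * weak_partial l 1 0 v \<xi> + 0 * weak_partial l 1 0 v \<xi>"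
    using weak_partial_lincomb[OF v2 v2, of 1 0 "- 1" 0] by simp
  then have "AE \<xi> in lebesgue_on (Omega l). weak_partial l 1 0 v (mirror \<xi>) = - weak_partial l 1 0 v \<xi>"
    using weak_partial_reflect[OF v2, of 1 0] by (simp add: reflect_apply) (auto elim: eventually_elim2)
  then have XB: "X \<le> l\<^sup>2 * B"
    unfolding X_def B_def using l by (intro odd_Poincare weak_partial_iterate(2) v2 vL)
  have "l\<^sup>2 \<le> 16" using power_mono[of l 4 2] l pi_less_4 by simp
  then have XB': "X \<le> 16 * B" using XB nn(3) by (meson mult_right_mono order_trans)
  have HAB: "24 / 25 * A + 8 / 5 * B \<le> H"
    unfolding A_def B_def H_def by (rule inner_H2star_lower(1)[OF v2])
  have XLA: "X\<^sup>2 \<le> L * A"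
  proof -
    have "X = - inner_L2 l (weak_partial l 2 0 v) v" unfolding X_def by (rule inner_x_by_parts[OF l(1) v v])
    then have "X \<le> norm_L2 l (weak_partial l 2 0 v) * norm_L2 l v"
      using inner_L2_Cauchy_Schwarz[OF vL(3,1)] by linarith
    then have "X\<^sup>2 \<le> (norm_L2 l (weak_partial l 2 0 v) * norm_L2 l v)\<^sup>2" using nn(1) by (rule power_mono)
    then show ?thesis by (simp add: power_mult_distrib norm_L2_sq A_def L_def mult.commute)
  qed
  define t where "t = lambda1 l * X"
  have lam1: "lambda1 l \<le> 1" by (rule lambda1_le_1[OF l(1)])
  have LH: "lambda1 l * L \<le> H" unfolding L_def H_def by (rule lambda1_le[OF v])
  have tX: "t \<le> X" unfolding t_def using lam1 nn(1) by (simp add: mult_left_le_one_le lam)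
  have t0: "0 \<le> t" unfolding t_def using lam nn(1) by simp
  have "t\<^sup>2 \<le> lambda1 l * X\<^sup>2"
    unfolding t_def power_mult_distrib using lam lam1 nn(1)
    by (intro mult_right_mono) (auto simp: power2_eq_square mult_left_le)
  also have "\<dots> \<le> lambda1 l * (L * A)" using XLA lam by (rule mult_left_mono)
  also have "\<dots> = (lambda1 l * L) * A" by simp
  also have "\<dots> \<le> H * A" using LH nn(2) by (rule mult_right_mono)
  finally have "24 / 25 * t\<^sup>2 \<le> H * (24 / 25 * A)" by simp
  also have "\<dots> \<le> H * (H - 1 / 10 * t)"
    using HAB XB' tX nn(4) by (intro mult_left_mono) auto
  finally have ineq: "24 / 25 * t\<^sup>2 + 1 / 10 * (H * t) \<le> H\<^sup>2" by (simp add: algebra_simps power2_eq_square)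
  \<comment> \<open>The value 49/50 exceeds the positive root of \<open>24/25 \<tau>\<^sup>2 + \<tau>/10 = 1\<close>.\<close>
  have "t \<le> 49 / 50 * H"
  proof (rule ccontr)
    assume "\<not> ?thesis"
    then have t: "49 / 50 * H < t" by simp
    then have tpos: "0 < t" using nn(4) by simp
    have "(49 / 50 * H)\<^sup>2 \<le> t\<^sup>2" using t nn(4) by (intro power_mono) auto
    moreover have "H * (49 / 50 * H) \<le> H * t" using t nn(4) by (intro mult_left_mono) auto
    ultimately have "24 / 25 * (49 / 50)\<^sup>2 * H\<^sup>2 + 1 / 10 * (49 / 50) * H\<^sup>2 \<le> H\<^sup>2"
      using ineq by (simp add: power2_eq_square)
    then have "H\<^sup>2 \<le> 0" by (simp add: power2_eq_square)
    then have "H = 0" by simp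
    then show False using ineq tpos by simp
  qed
  then show ?thesis by (simp add: t_def X_def H_def)
qed


section \<open>Energy identities from two-time correlations\<close>

text \<open>
  Total differentiability from one partial derivative and one continuous partial derivative, restricted
  to a line parallel to the diagonal.
\<close>

lemma diagonal_deriv:
  fixes M N :: "real \<Rightarrow> real \<Rightarrow> real"
  assumes D1: "\<And>s t. 0 < s \<Longrightarrow> 0 < t \<Longrightarrow> ((\<lambda>s. M s t) has_real_derivative M1 s t) (at s)"
    and D2: "\<And>s t. 0 < s \<Longrightarrow> 0 < t \<Longrightarrow> ((\<lambda>t. M s t) has_real_derivative N s t) (at t)"
    and N: "continuous_on ({0<..} \<times> {0<..}) (\<lambda>(s, t). N s t)"
    and t: "0 < t" "0 < t + c"
  shows "((\<lambda>t. M t (t + c)) has_real_derivative M1 t (t + c) + N t (t + c)) (at t)"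
proof -
  have op: "open ({0<..} \<times> {0<..} :: (real \<times> real) set)" by (intro open_Times) auto
  have m: "(t, t + c) \<in> {0<..} \<times> {0<..}" using t by auto
  have app: "blinfun_apply (r *\<^sub>R id_blinfun) = (*) r" for r :: real
    by (rule ext) (simp only: blinfun.scaleR_left blinfun_apply_id_blinfun id_apply real_scaleR_def)
  have "((\<lambda>(s, t). M s t) has_derivative (\<lambda>(a, b). M1 t (t + c) * a + blinfun_apply (N t (t + c) *\<^sub>R id_blinfun) b))
      (at (t, t + c) within {0<..} \<times> {0<..})"
  proof (rule has_derivative_partialsI)
    show "((\<lambda>s. M s (t + c)) has_derivative (*) (M1 t (t + c))) (at t within {0<..})"
      using D1[OF t] unfolding has_field_derivative_def by (rule has_derivative_at_withinI)
    show "(M s has_derivative blinfun_apply (N s r *\<^sub>R id_blinfun)) (at r within {0<..})"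
      if "s \<in> {0<..}" "r \<in> {0<..}" for s r
    proof -
      have "(M s has_derivative (*) (N s r)) (at r within {0<..})"
        by (rule has_derivative_at_withinI)
          (use D2[of s r] that in \<open>simp add: has_field_derivative_def\<close>)
      then show ?thesis unfolding app .
    qed
    have "continuous_on ({0<..} \<times> {0<..}) (\<lambda>\<xi>. (case \<xi> of (s, t) \<Rightarrow> N s t) *\<^sub>R (id_blinfun :: real \<Rightarrow>\<^sub>L real))"
      by (intro continuous_intros N)
    then have "continuous_on ({0<..} \<times> {0<..}) (\<lambda>(s, t). N s t *\<^sub>R (id_blinfun :: real \<Rightarrow>\<^sub>L real))"
      by (simp add: case_prod_unfold)
    then show "continuous (at (t, t + c) within {0<..} \<times> {0<..}) (\<lambda>(s, t). N s t *\<^sub>R (id_blinfun :: real \<Rightarrow>\<^sub>L real))"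
      using m by (rule continuous_on_eq_continuous_within[THEN iffD1, rule_format])
  qed (use t in auto)
  then have "((\<lambda>(s, t). M s t) has_derivative (\<lambda>(a, b). M1 t (t + c) * a + N t (t + c) * b)) (at (t, t + c))"
    unfolding at_within_open[OF m op] app .
  moreover have "((\<lambda>t. (t, t + c)) has_derivative (\<lambda>h. (h, h))) (at t)"
    by (auto intro!: derivative_eq_intros)
  ultimately have "((\<lambda>t. (\<lambda>(s, t). M s t) (t, t + c)) has_derivative
      (\<lambda>h. (\<lambda>(a, b). M1 t (t + c) * a + N t (t + c) * b) (h, h))) (at t)"
    by (rule has_derivative_compose[rotated])
  moreover have "(*) (M1 t (t + c) + N t (t + c)) = (\<lambda>h. M1 t (t + c) * h + N t (t + c) * h)"
    by (simp add: fun_eq_iff distrib_right)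
  ultimately show ?thesis
    unfolding has_field_derivative_def by simp
qed

lemma symmetric_average_limit:
  fixes B :: "real \<Rightarrow> real \<Rightarrow> real"
  assumes B: "continuous_on ({0<..} \<times> {0<..}) (\<lambda>(s, t). B s t)" and t: "0 < t"
  shows "((\<lambda>h. integral {t - h..t} (\<lambda>s. B s (s + h)) / h) \<longlongrightarrow> B t t) (at_right 0)"
proof (rule tendstoI)
  fix e :: real assume e: "0 < e"
  have "(t, t) \<in> {0<..} \<times> {0<..}" using t by simp
  from B[unfolded continuous_on_iff, rule_format, OF this, of "e / 2"] e
  obtain d where d: "0 < d" "\<And>s r. 0 < s \<Longrightarrow> 0 < r \<Longrightarrow> dist (s, r) (t, t) < d \<Longrightarrow> dist (B s r) (B t t) < e / 2"
    by auto
  have "eventually (\<lambda>h. h \<in> {0<..<min (d / 2) t}) (at_right 0)"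
    using d(1) t by (intro eventually_at_right_real) auto
  then show "eventually (\<lambda>h. dist (integral {t - h..t} (\<lambda>s. B s (s + h)) / h) (B t t) < e) (at_right 0)"
  proof eventually_elim
    case (elim h)
    then have h: "0 < h" "h < d / 2" "h < t" by auto
    have c: "continuous_on {t - h..t} (\<lambda>s. (\<lambda>(s, t). B s t) (s, s + h))"
      using h by (intro continuous_on_compose2[OF B] continuous_intros) auto
    then have c: "continuous_on {t - h..t} (\<lambda>s. B s (s + h))" by simp
    have "norm (integral (cbox (t - h) t) (\<lambda>s. B s (s + h) - B t t)) \<le> e / 2 * measure lborel (cbox (t - h) t)"
    proof (rule integrable_bound)
      show "(\<lambda>s. B s (s + h) - B t t) integrable_on cbox (t - h) t"
        using c by (intro integrable_continuous continuous_intros) simp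
      fix s assume s: "s \<in> cbox (t - h) t"
      have "dist (s, s + h) (t, t) \<le> dist s t + dist (s + h) t"
        by (simp add: dist_Pair_Pair real_sqrt_le_iff sqrt_sum_squares_le_sum)
      also have "\<dots> < d" using s h by (simp add: dist_real_def)
      finally have "dist (B s (s + h)) (B t t) < e / 2" using s h by (intro d(2)) auto
      then show "norm (B s (s + h) - B t t) \<le> e / 2" by (simp add: dist_norm)
    qed (use e in simp)
    moreover have "integral {t - h..t} (\<lambda>s. B s (s + h) - B t t) = integral {t - h..t} (\<lambda>s. B s (s + h)) - h * B t t"
      using c h by (subst integral_diff) (auto intro!: integrable_continuous_real)
    ultimately have "\<bar>integral {t - h..t} (\<lambda>s. B s (s + h)) - h * B t t\<bar> \<le> e / 2 * h" using h by simp
    moreover have "integral {t - h..t} (\<lambda>s. B s (s + h)) / h - B t t = (integral {t - h..t} (\<lambda>s. B s (s + h)) - h * B t t) / h"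
      using h by (simp add: diff_divide_distrib)
    ultimately have "\<bar>integral {t - h..t} (\<lambda>s. B s (s + h)) / h - B t t\<bar> \<le> e / 2"
      using h by (simp add: abs_divide divide_le_eq)
    then show ?case using e by (simp add: dist_real_def)
  qed
qed

lemma symmetric_difference_limit:
  fixes f :: "real \<Rightarrow> real"
  assumes "(f has_real_derivative d) (at t)"
  shows "((\<lambda>h. (f (t + h) - f (t - h)) / (2 * h)) \<longlongrightarrow> d) (at_right 0)"
proof -
  have 1: "((\<lambda>h. (f (t + h) - f t) / h) \<longlongrightarrow> d) (at 0)" using assms by (simp add: DERIV_def)
  then have r: "((\<lambda>h. (f (t + h) - f t) / h) \<longlongrightarrow> d) (at_right 0)"
    and l: "((\<lambda>h. (f (t + h) - f t) / h) \<longlongrightarrow> d) (at_left 0)" by (simp_all only: filterlim_at_split)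
  have "((\<lambda>h. (f (t + - h) - f t) / - h) \<longlongrightarrow> d) (at_right 0)"
    using l by (simp only: filterlim_at_left_to_right minus_zero)
  from tendsto_add[OF r this]
  have "((\<lambda>h. ((f (t + h) - f t) / h + (f (t + - h) - f t) / - h) / 2) \<longlongrightarrow> (d + d) / 2) (at_right 0)"
    by (intro tendsto_divide tendsto_const) auto
  moreover have "(\<lambda>h. ((f (t + h) - f t) / h + (f (t + - h) - f t) / - h) / 2) = (\<lambda>h. (f (t + h) - f (t - h)) / (2 * h))"
  proof
    show "((f (t + h) - f t) / h + (f (t + - h) - f t) / - h) / 2 = (f (t + h) - f (t - h)) / (2 * h)" for h
      by (cases "h = 0") (simp_all add: field_simps)
  qed
  moreover have "(d + d) / 2 = d" by simp
  ultimately show ?thesis by (simp only:)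
qed

text \<open>
  The energy identity for a wave-type equation whose velocity is too irregular to be a test function.
  In the application \<open>A s t = a(w(s), w(t))\<close>, \<open>N s t = (w\<^sub>t(s), w\<^sub>t(t))\<close>, \<open>M s t = (w\<^sub>t(s), w(t))\<close>, the
  equation at time \<open>s\<close> tested with \<open>w(t)\<close> is \<open>D1\<close>, and \<open>J\<close> collects the lower-order terms.
  The velocity is replaced by the symmetric difference quotient \<open>(w(s + h) - w(s - h)) / 2h\<close>.  For
  the symmetric form \<open>B = N - A\<close> one has \<open>B s (s - h) = B (s - h) s\<close>, so that
  \<open>B s (s + h) - B s (s - h)\<close> is the derivative in \<open>s\<close> of the integral \<open>b h s\<close> of \<open>B r (r + h)\<close>
  over \<open>[s - h, s]\<close>.  What remains is the difference quotient of \<open>J\<close> in its second argument, which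
  tends to \<open>L\<close> locally uniformly.  As \<open>h\<close> tends to 0 the differentiated quantity tends to
  \<open>N - B/2 = (N + A)/2\<close>.
\<close>

theorem two_time_energy_identity:
  fixes A J L M N :: "real \<Rightarrow> real \<Rightarrow> real"
  assumes A: "continuous_on ({0<..} \<times> {0<..}) (\<lambda>(s, t). A s t)"
    and N: "continuous_on ({0<..} \<times> {0<..}) (\<lambda>(s, t). N s t)"
    and L: "continuous_on ({0<..} \<times> {0<..}) (\<lambda>(s, t). L s t)"
    and symA: "\<And>s t. A s t = A t s" and symN: "\<And>s t. N s t = N t s"
    and D1: "\<And>s t. 0 < s \<Longrightarrow> 0 < t \<Longrightarrow> ((\<lambda>s. M s t) has_real_derivative - A s t - J s t) (at s)"
    and D2: "\<And>s t. 0 < s \<Longrightarrow> 0 < t \<Longrightarrow> ((\<lambda>t. M s t) has_real_derivative N s t) (at t)"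
    and D3: "\<And>s t. 0 < s \<Longrightarrow> 0 < t \<Longrightarrow> ((\<lambda>t. J s t) has_real_derivative L s t) (at t)"
    and t: "0 < t"
  shows "((\<lambda>t. (N t t + A t t) / 2) has_real_derivative - L t t) (at t)"
proof -
  define p q where "p = t / 2" and "q = t + 1"
  have p: "0 < p" "p < t" and q: "t < q" using t by (auto simp: p_def q_def)
  have pos: "0 < s" if "s \<in> {p..q}" for s using that p by auto
  define \<Lambda> where "\<Lambda> s = integral {p..s} (\<lambda>s. L s s)" for s
  have Lc: "continuous_on {p..q} (\<lambda>s. L s s)"
  proof -
    have "continuous_on {p..q} (\<lambda>s. (\<lambda>(s, t). L s t) (s, s))"
      using p by (intro continuous_on_compose2[OF L] continuous_intros) auto
    then show ?thesis by simp
  qed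
  have D\<Lambda>: "(\<Lambda> has_real_derivative L s s) (at s within {p..q})" if "s \<in> {p..q}" for s
    unfolding \<Lambda>_def by (rule integral_has_real_derivative[OF Lc that])
  define B where "B s r = N s r - A s r" for s r
  have Bc: "continuous_on ({0<..} \<times> {0<..}) (\<lambda>(s, t). B s t)"
    using continuous_on_diff[OF N A] by (simp add: B_def case_prod_unfold)
  have symB: "B s r = B r s" for s r unfolding B_def using symA[of s r] symN[of s r] by simp
  define b where "b h s = integral {s - h..s} (\<lambda>r. B r (r + h))" for h s
  \<comment> \<open>The sum \<open>\<Psi> h\<close> has a derivative that vanishes in the limit, so its limit \<open>E\<close> is constant.\<close>
  define \<Psi> where "\<Psi> h s = (M s (s + h) - M s (s - h) - b h s) / (2 * h) + \<Lambda> s" for h s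
  have Db: "(b h has_real_derivative B s (s + h) - B s (s - h)) (at s)" if h: "0 < h" "h < p / 2" and s: "s \<in> {p..q}" for h s
  proof -
    have cB: "continuous_on {p / 4..q + 1} (\<lambda>r. B r (r + h))"
    proof -
      have "continuous_on {p / 4..q + 1} (\<lambda>r. (\<lambda>(s, t). B s t) (r, r + h))"
        using p h by (intro continuous_on_compose2[OF Bc] continuous_intros) auto
      then show ?thesis by simp
    qed
    define I where "I s = integral {p / 4..s} (\<lambda>r. B r (r + h))" for s
    have DI: "(I has_real_derivative B s (s + h)) (at s)" if "p / 4 < s" "s < q + 1" for s
    proof -
      have "(I has_real_derivative B s (s + h)) (at s within {p / 4..q + 1})"
        unfolding I_def using that by (intro integral_has_real_derivative[OF cB]) auto
      then show ?thesis using that by (simp add: at_within_Icc_at)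
    qed
    have "(I has_real_derivative B s (s + h)) (at s)" using s h p by (intro DI) auto
    moreover have "((\<lambda>s. I (s - h)) has_real_derivative B (s - h) (s - h + h) * 1) (at s)"
      using s h p by (intro DERIV_chain2[OF DI]) (auto intro!: derivative_eq_intros)
    ultimately have D: "((\<lambda>s. I s - I (s - h)) has_real_derivative B s (s + h) - B s (s - h)) (at s)"
      using symB[of "s - h" s] by (auto intro!: derivative_eq_intros)
    have "eventually (\<lambda>r. r \<in> {3 * p / 4<..<q + 1}) (nhds s)"
      using s p by (intro eventually_nhds_in_open) auto
    then have "eventually (\<lambda>r. I r - I (r - h) = b h r) (nhds s)"
    proof eventually_elim
      case (elim r)
      have "integral {p / 4..r - h} (\<lambda>r. B r (r + h)) + integral {r - h..r} (\<lambda>r. B r (r + h)) = integral {p / 4..r} (\<lambda>r. B r (r + h))"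
      proof (rule Henstock_Kurzweil_Integration.integral_combine)
        show "(\<lambda>r. B r (r + h)) integrable_on {p / 4..r}"
          by (rule integrable_continuous_real[OF continuous_on_subset[OF cB]]) (use elim in auto)
      qed (use elim h p in auto)
      then show ?case by (simp add: I_def b_def)
    qed
    with D show ?thesis by (subst (asm) DERIV_cong_ev[OF refl _ refl])
  qed
  have DM: "((\<lambda>s. M s (s + c)) has_real_derivative - A s (s + c) - J s (s + c) + N s (s + c)) (at s)"
    if "0 < s" "0 < s + c" for s c
    by (rule diagonal_deriv[OF D1 D2 N that])
  have D\<Psi>: "(\<Psi> h has_real_derivative - (J s (s + h) - J s (s - h)) / (2 * h) + L s s) (at s within {p..q})"
    if h: "0 < h" "h < p / 2" and s: "s \<in> {p..q}" for h s
  proof -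
    have "((\<lambda>s. M s (s + h) - M s (s + - h) - b h s) has_real_derivative
        (- A s (s + h) - J s (s + h) + N s (s + h)) - (- A s (s + - h) - J s (s + - h) + N s (s + - h))
        - (B s (s + h) - B s (s - h))) (at s)"
      using h s p by (intro DERIV_diff DM Db) auto
    then have "((\<lambda>s. M s (s + h) - M s (s - h) - b h s) has_real_derivative - (J s (s + h) - J s (s - h))) (at s)"
      by (simp add: B_def algebra_simps)
    from DERIV_add[OF DERIV_cdivide[OF has_field_derivative_at_within[OF this]] D\<Lambda>[OF s], of "2 * h"]
    show ?thesis unfolding \<Psi>_def .
  qed
  have close: "eventually (\<lambda>h. \<forall>s\<in>{p..q}. \<bar>- (J s (s + h) - J s (s - h)) / (2 * h) + L s s\<bar> \<le> e) (at_right 0)"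
    if e: "0 < e" for e
  proof -
    have "uniformly_continuous_on ({p / 2..q + 1} \<times> {p / 2..q + 1}) (\<lambda>(s, t). L s t)"
      using p by (intro compact_uniformly_continuous continuous_on_subset[OF L] compact_Times) auto
    then obtain d where d: "0 < d"
      "\<And>s r r'. s \<in> {p / 2..q + 1} \<Longrightarrow> r \<in> {p / 2..q + 1} \<Longrightarrow> r' \<in> {p / 2..q + 1} \<Longrightarrow> dist r' r < d
        \<Longrightarrow> dist (L s r') (L s r) < e"
      unfolding uniformly_continuous_on_def using e by (force simp: dist_Pair_Pair)
    have "eventually (\<lambda>h. h \<in> {0<..<min d (min 1 (p / 2))}) (at_right 0)"
      using d(1) p by (intro eventually_at_right_real) auto
    then show ?thesis
    proof eventually_elim
      case (elim h)
      then have h: "0 < h" "h < d" "h < 1" "h < p / 2" by auto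
      show ?case
      proof
        fix s assume s: "s \<in> {p..q}"
        have "\<exists>z. s - h < z \<and> z < s + h \<and> J s (s + h) - J s (s - h) = (s + h - (s - h)) * L s z"
          using h s p by (intro MVT2 D3) auto
        then obtain z where z: "s - h < z" "z < s + h" "J s (s + h) - J s (s - h) = 2 * h * L s z" by auto
        have "dist (L s z) (L s s) < e"
          using z h s p by (intro d(2)) (auto simp: dist_real_def)
        moreover have "- (J s (s + h) - J s (s - h)) / (2 * h) + L s s = L s s - L s z"
          using z(3) h by simp
        ultimately show "\<bar>- (J s (s + h) - J s (s - h)) / (2 * h) + L s s\<bar> \<le> e"
          by (simp add: dist_real_def)
      qed
    qed
  qed
  define E where "E s = (N s s + A s s) / 2 + \<Lambda> s" for s
  have lim: "((\<lambda>h. \<Psi> h s) \<longlongrightarrow> E s) (at_right 0)" if s: "s \<in> {p..q}" for s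
  proof -
    have "((\<lambda>h. (M s (s + h) - M s (s - h)) / (2 * h)) \<longlongrightarrow> N s s) (at_right 0)"
      using pos[OF s] by (intro symmetric_difference_limit D2)
    moreover have "((\<lambda>h. b h s / h) \<longlongrightarrow> B s s) (at_right 0)"
      unfolding b_def using pos[OF s] by (rule symmetric_average_limit[OF Bc])
    ultimately have "((\<lambda>h. (M s (s + h) - M s (s - h)) / (2 * h) - b h s / h / 2 + \<Lambda> s) \<longlongrightarrow> N s s - B s s / 2 + \<Lambda> s) (at_right 0)"
      by (intro tendsto_intros) auto
    moreover have "N s s - B s s / 2 + \<Lambda> s = E s" by (simp add: E_def B_def field_simps)
    moreover have "(M s (s + h) - M s (s - h)) / (2 * h) - b h s / h / 2 + \<Lambda> s = \<Psi> h s" for h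
      by (simp add: \<Psi>_def diff_divide_distrib)
    ultimately show ?thesis by simp
  qed
  have const: "E s = E p" if s: "s \<in> {p..q}" for s
  proof (rule ccontr)
    assume ne: "E s \<noteq> E p"
    then have sp: "p < s" using s by (cases "s = p") auto
    define e where "e = \<bar>E s - E p\<bar> / (2 * (s - p))"
    have e: "0 < e" using ne sp by (simp add: e_def)
    have "p \<in> {p..q}" using s by simp
    then have "((\<lambda>h. \<bar>\<Psi> h s - \<Psi> h p\<bar>) \<longlongrightarrow> \<bar>E s - E p\<bar>) (at_right 0)"
      by (intro tendsto_intros lim s)
    moreover have "eventually (\<lambda>h. \<bar>\<Psi> h s - \<Psi> h p\<bar> \<le> e * (s - p)) (at_right 0)"
    proof -
      have "eventually (\<lambda>h. h \<in> {0<..<p / 2}) (at_right 0)" using p by (intro eventually_at_right_real) auto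
      then show ?thesis using close[OF e]
      proof eventually_elim
        case (elim h)
        have "norm (\<Psi> h s - \<Psi> h p) \<le> e * norm (s - p)"
        proof (rule field_differentiable_bound[of "{p..s}"])
          fix z assume z: "z \<in> {p..s}"
          then have zq: "z \<in> {p..q}" using s by auto
          show "(\<Psi> h has_field_derivative - (J z (z + h) - J z (z - h)) / (2 * h) + L z z) (at z within {p..s})"
            using elim s by (intro DERIV_subset[OF D\<Psi>[OF _ _ zq]]) auto
          show "norm (- (J z (z + h) - J z (z - h)) / (2 * h) + L z z) \<le> e"
            using elim zq by simp
        qed (use sp in auto)
        then show ?case using sp by simp
      qed
    qed
    ultimately have "\<bar>E s - E p\<bar> \<le> e * (s - p)"
      by (intro tendsto_upperbound) auto
    also have "\<dots> = \<bar>E s - E p\<bar> / 2"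
    proof -
      have "x / (2 * y) * y = x / 2" if "y \<noteq> 0" for x y :: real using that by simp
      then show ?thesis using sp by (simp only: e_def)
    qed
    finally show False using ne by simp
  qed
  have "((\<lambda>s. E p - \<Lambda> s) has_real_derivative 0 - L t t) (at t within {p..q})"
    using p q by (intro DERIV_diff DERIV_const D\<Lambda>) auto
  then have "((\<lambda>s. E p - \<Lambda> s) has_real_derivative - L t t) (at t)"
    using p q by (simp add: at_within_Icc_at)
  moreover have "eventually (\<lambda>s. E p - \<Lambda> s = (N s s + A s s) / 2) (nhds t)"
  proof -
    have "eventually (\<lambda>s. s \<in> {p<..<q}) (nhds t)" using p q by (intro eventually_nhds_in_open) auto
    then show ?thesis
    proof eventually_elim
      case (elim s)
      then have "E p = E s" by (intro const[symmetric]) auto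
      then show ?case by (simp only: E_def[of s] add_diff_cancel_right')
    qed
  qed
  ultimately show ?thesis by (subst (asm) DERIV_cong_ev[OF refl _ refl])
qed

lemma exponential_decay:
  fixes Y Y' X :: "real \<Rightarrow> real"
  assumes \<kappa>: "0 < \<kappa>" and D: "\<And>t. T \<le> t \<Longrightarrow> (Y has_real_derivative Y' t) (at t)"
    and le: "\<And>t. T \<le> t \<Longrightarrow> Y' t \<le> - \<kappa> * Y t"
    and X: "\<And>t. T \<le> t \<Longrightarrow> 0 \<le> X t" "\<And>t. T \<le> t \<Longrightarrow> X t \<le> C * Y t" and C: "0 \<le> C"
  shows "((\<lambda>t. exp (\<kappa> / 2 * t) * X t) \<longlongrightarrow> 0) at_top"
proof -
  have mono: "exp (\<kappa> * t) * Y t \<le> exp (\<kappa> * T) * Y T" if t: "T \<le> t" for t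
  proof (rule DERIV_nonpos_imp_nonincreasing[OF t])
    fix s assume s: "T \<le> s" "s \<le> t"
    have "((\<lambda>s. exp (\<kappa> * s) * Y s) has_real_derivative exp (\<kappa> * s) * (\<kappa> * Y s + Y' s)) (at s)"
      using D[OF s(1)] by (auto intro!: derivative_eq_intros simp: algebra_simps)
    moreover have "exp (\<kappa> * s) * (\<kappa> * Y s + Y' s) \<le> 0"
      using le[OF s(1)] by (intro mult_nonneg_nonpos) auto
    ultimately show "\<exists>y. ((\<lambda>s. exp (\<kappa> * s) * Y s) has_real_derivative y) (at s) \<and> y \<le> 0" by blast
  qed
  define K where "K = C * (exp (\<kappa> * T) * Y T)"
  have bound: "exp (\<kappa> / 2 * t) * X t \<le> K * exp (- (\<kappa> / 2) * t)" if t: "T \<le> t" for t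
  proof -
    have "exp (\<kappa> / 2 * t) * X t \<le> exp (\<kappa> / 2 * t) * (C * Y t)"
      by (intro mult_left_mono X t) simp
    also have "\<dots> = C * (exp (\<kappa> * t) * Y t) * exp (- (\<kappa> / 2) * t)"
    proof -
      have "exp (\<kappa> * t) * exp (- (\<kappa> / 2) * t) = exp (\<kappa> / 2 * t)"
        by (simp add: exp_add[symmetric] algebra_simps)
      then show ?thesis by (simp only: mult_ac)
    qed
    also have "\<dots> \<le> K * exp (- (\<kappa> / 2) * t)"
      unfolding K_def by (intro mult_right_mono mult_left_mono mono t C) simp
    finally show ?thesis .
  qed
  have "((\<lambda>t. K * exp (- (\<kappa> / 2) * t)) \<longlongrightarrow> K * 0) at_top"
  proof (intro tendsto_mult tendsto_const)
    have "filterlim (\<lambda>t. - (\<kappa> / 2) * t) at_bot at_top"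
      using \<kappa> by (intro filterlim_tendsto_neg_mult_at_bot[OF tendsto_const]) (auto simp: filterlim_ident)
    then show "((\<lambda>t. exp (- (\<kappa> / 2) * t)) \<longlongrightarrow> 0) at_top"
      by (rule filterlim_compose[OF exp_at_bot])
  qed
  then have lim: "((\<lambda>t. K * exp (- (\<kappa> / 2) * t)) \<longlongrightarrow> 0) at_top" by simp
  show ?thesis
  proof (rule tendsto_sandwich[OF _ _ tendsto_const lim])
    show "eventually (\<lambda>t. 0 \<le> exp (\<kappa> / 2 * t) * X t) at_top"
      using eventually_ge_at_top[of T] by eventually_elim (simp add: X)
    show "eventually (\<lambda>t. exp (\<kappa> / 2 * t) * X t \<le> K * exp (- (\<kappa> / 2) * t)) at_top"
      using eventually_ge_at_top[of T] by eventually_elim (rule bound)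
  qed
qed


section \<open>Curves of plate configurations\<close>

lemma C0_curve_inner_continuous:
  assumes p: "C0_curve (L2 l) (norm_L2 l) p" and q: "C0_curve (L2 l) (norm_L2 l) q"
  shows "continuous_on ({0..} \<times> {0..}) (\<lambda>(s, t). inner_L2 l (p s) (q t))"
  unfolding continuous_on_eq_continuous_within
proof
  fix \<xi> :: "real \<times> real" assume "\<xi> \<in> {0..} \<times> {0..}"
  then obtain s0 t0 where st: "\<xi> = (s0, t0)" "0 \<le> s0" "0 \<le> t0" by auto
  let ?F = "at (s0, t0) within {0..} \<times> {0..}"
  have pL: "p s \<in> L2 l" "q s \<in> L2 l" if "0 \<le> s" for s using p q that by (auto simp: C0_curve_def)
  have lim: "((\<lambda>\<xi>. norm_L2 l (\<lambda>z. r (x \<xi>) z - r a z)) \<longlongrightarrow> 0) F"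
    if r: "C0_curve (L2 l) (norm_L2 l) r" and a: "0 \<le> a" and x: "(x \<longlongrightarrow> a) F" "eventually (\<lambda>\<xi>. x \<xi> \<in> {0..}) F"
    for r a and x :: "real \<times> real \<Rightarrow> real" and F
  proof -
    have z: "norm_L2 l (\<lambda>z. r a z - r a z) = 0" by (simp add: norm_L2_def inner_L2_def)
    have "continuous (at a within {0..}) (\<lambda>s. norm_L2 l (\<lambda>z. r s z - r a z))"
      using r a unfolding continuous_within z by (auto simp: C0_curve_def)
    from continuous_within_tendsto_compose[OF this x(2,1)] show ?thesis unfolding z .
  qed
  have e: "eventually (\<lambda>\<xi>. \<xi> \<in> {0..} \<times> {0..}) ?F" by (simp add: eventually_at_filter)
  have lp: "((\<lambda>\<xi>. norm_L2 l (\<lambda>z. p (fst \<xi>) z - p s0 z)) \<longlongrightarrow> 0) ?F"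
    by (rule lim[OF p st(2)]) (use e in \<open>auto intro!: tendsto_eq_intros elim!: eventually_mono\<close>)
  have lq: "((\<lambda>\<xi>. norm_L2 l (\<lambda>z. q (snd \<xi>) z - q t0 z)) \<longlongrightarrow> 0) ?F"
    by (rule lim[OF q st(3)]) (use e in \<open>auto intro!: tendsto_eq_intros elim!: eventually_mono\<close>)
  let ?a = "\<lambda>\<xi>. norm_L2 l (\<lambda>z. p (fst \<xi>) z - p s0 z)" and ?b = "\<lambda>\<xi>. norm_L2 l (\<lambda>z. q (snd \<xi>) z - q t0 z)"
  have "((\<lambda>\<xi>. inner_L2 l (p (fst \<xi>)) (q (snd \<xi>)) - inner_L2 l (p s0) (q t0)) \<longlongrightarrow> 0) ?F"
  proof (rule Lim_null_comparison)
    show "((\<lambda>\<xi>. ?a \<xi> * ?b \<xi> + ?a \<xi> * norm_L2 l (q t0) + norm_L2 l (p s0) * ?b \<xi>) \<longlongrightarrow> 0) ?F"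
      using lp lq by (auto intro!: tendsto_eq_intros)
    show "eventually (\<lambda>\<xi>. norm (inner_L2 l (p (fst \<xi>)) (q (snd \<xi>)) - inner_L2 l (p s0) (q t0))
        \<le> ?a \<xi> * ?b \<xi> + ?a \<xi> * norm_L2 l (q t0) + norm_L2 l (p s0) * ?b \<xi>) ?F"
      using e
    proof eventually_elim
      case (elim \<xi>)
      then have L: "p (fst \<xi>) \<in> L2 l" "p s0 \<in> L2 l" "q (snd \<xi>) \<in> L2 l" "q t0 \<in> L2 l"
        using st by (auto intro!: pL)
      define f where "f = (\<lambda>z. p (fst \<xi>) z - p s0 z)"
      define g where "g = (\<lambda>z. q (snd \<xi>) z - q t0 z)"
      have fg: "f \<in> L2 l" "g \<in> L2 l"
        using L2_lincomb[OF L(1,2), of 1 "- 1"] L2_lincomb[OF L(3,4), of 1 "- 1"] by (simp_all add: f_def g_def)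
      have "inner_L2 l f h = inner_L2 l (p (fst \<xi>)) h - inner_L2 l (p s0) h" if "h \<in> L2 l" for h
        using inner_L2_lincomb[OF L(1,2) that, of 1 "- 1"] by (simp add: f_def)
      moreover have "inner_L2 l h g = inner_L2 l h (q (snd \<xi>)) - inner_L2 l h (q t0)" if "h \<in> L2 l" for h
        using inner_L2_lincomb_right[OF L(3,4) that, of 1 "- 1"] by (simp add: g_def)
      ultimately have "inner_L2 l (p (fst \<xi>)) (q (snd \<xi>)) - inner_L2 l (p s0) (q t0)
          = inner_L2 l f g + inner_L2 l f (q t0) + inner_L2 l (p s0) g"
        using fg L by simp
      moreover have "\<bar>inner_L2 l f g + inner_L2 l f (q t0) + inner_L2 l (p s0) g\<bar>
          \<le> norm_L2 l f * norm_L2 l g + norm_L2 l f * norm_L2 l (q t0) + norm_L2 l (p s0) * norm_L2 l g"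
        using inner_L2_Cauchy_Schwarz[OF fg] inner_L2_Cauchy_Schwarz[OF fg(1) L(4)]
          inner_L2_Cauchy_Schwarz[OF L(2) fg(2)] by linarith
      ultimately show ?case by (simp add: f_def g_def)
    qed
  qed
  then have "((\<lambda>\<xi>. inner_L2 l (p (fst \<xi>)) (q (snd \<xi>))) \<longlongrightarrow> inner_L2 l (p s0) (q t0)) ?F"
    by (simp add: LIM_zero_iff)
  then show "continuous (at \<xi> within {0..} \<times> {0..}) (\<lambda>(s, t). inner_L2 l (p s) (q t))"
    by (simp add: st continuous_within case_prod_unfold)
qed

lemma difference_quotient_L2:
  assumes "p \<in> L2 l" "q \<in> L2 l" "w \<in> L2 l"
  shows "(\<lambda>z. (p z - q z) / c - w z) \<in> L2 l"
    and "f \<in> L2 l \<Longrightarrow> inner_L2 l f (\<lambda>z. (p z - q z) / c - w z) = (inner_L2 l f p - inner_L2 l f q) / c - inner_L2 l f w"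
proof -
  have e: "(\<lambda>z. (p z - q z) / c - w z) = (\<lambda>z. 1 * ((1 / c) * p z + (- 1 / c) * q z) + (- 1) * w z)"
    by (simp add: fun_eq_iff diff_divide_distrib)
  show "(\<lambda>z. (p z - q z) / c - w z) \<in> L2 l"
    unfolding e by (intro L2_lincomb assms)
  show "inner_L2 l f (\<lambda>z. (p z - q z) / c - w z) = (inner_L2 l f p - inner_L2 l f q) / c - inner_L2 l f w"
    if f: "f \<in> L2 l"
    unfolding e
    by (simp only: inner_L2_lincomb_right[OF L2_lincomb[OF assms(1,2)] assms(3) f]
        inner_L2_lincomb_right[OF assms(1,2) f]) (simp add: diff_divide_distrib)
qed

lemma has_curve_deriv_inner:
  assumes D: "has_curve_deriv (norm_L2 l) q w t" and q: "\<And>s. 0 \<le> s \<Longrightarrow> q s \<in> L2 l"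
    and w: "w \<in> L2 l" and f: "f \<in> L2 l" and t: "0 \<le> t"
  shows "((\<lambda>s. (inner_L2 l f (q s) - inner_L2 l f (q t)) / (s - t)) \<longlongrightarrow> inner_L2 l f w) (at t within {0..})"
proof -
  have "((\<lambda>s. (inner_L2 l f (q s) - inner_L2 l f (q t)) / (s - t) - inner_L2 l f w) \<longlongrightarrow> 0) (at t within {0..})"
  proof (rule Lim_null_comparison)
    show "((\<lambda>s. norm_L2 l f * norm_L2 l (\<lambda>z. (q s z - q t z) / (s - t) - w z)) \<longlongrightarrow> 0) (at t within {0..})"
      using D unfolding has_curve_deriv_def by (auto intro!: tendsto_eq_intros)
    have "eventually (\<lambda>s. s \<in> {0..}) (at t within {0..})" by (simp add: eventually_at_filter)
    then show "eventually (\<lambda>s. norm ((inner_L2 l f (q s) - inner_L2 l f (q t)) / (s - t) - inner_L2 l f w)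
        \<le> norm_L2 l f * norm_L2 l (\<lambda>z. (q s z - q t z) / (s - t) - w z)) (at t within {0..})"
    proof eventually_elim
      case (elim s)
      then have L: "q s \<in> L2 l" "q t \<in> L2 l" using t by (auto intro: q)
      show ?case
        using inner_L2_Cauchy_Schwarz[OF f difference_quotient_L2(1)[OF L w, of "s - t"]]
        by (simp add: difference_quotient_L2(2)[OF L w f])
    qed
  qed
  then show ?thesis by (simp add: LIM_zero_iff)
qed

lemma at_within_nonneg: "0 < t \<Longrightarrow> at t within {0..} = at (t::real)"
  by (rule at_within_interior) simp

lemma has_curve_deriv_inner_DERIV:
  assumes "has_curve_deriv (norm_L2 l) q w t" "\<And>s. 0 \<le> s \<Longrightarrow> q s \<in> L2 l" "w \<in> L2 l" "f \<in> L2 l" "0 < t"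
  shows "((\<lambda>t. inner_L2 l f (q t)) has_real_derivative inner_L2 l f w) (at t)"
  using has_curve_deriv_inner[OF assms(1-4)] assms(5)
  by (simp add: has_field_derivative_iff at_within_nonneg)

lemma at_within_nonneg_nontrivial: "0 \<le> t \<Longrightarrow> at t within {0::real..} \<noteq> bot"
  by (cases "t = 0") (auto simp: at_within_nonneg at_within_Ici_at_right)

lemma curve_deriv_L2_unique:
  assumes D: "has_curve_deriv (norm_L2 l) q w t" "has_curve_deriv (norm_L2 l) q w' t"
    and q: "\<And>s. 0 \<le> s \<Longrightarrow> q s \<in> L2 l" and w: "w \<in> L2 l" "w' \<in> L2 l" and t: "0 \<le> t"
  shows "AE \<xi> in lebesgue_on (Omega l). w \<xi> = w' \<xi>"
proof -
  have eq: "inner_L2 l f w = inner_L2 l f w'" if f: "f \<in> L2 l" for f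
    by (rule tendsto_unique[OF at_within_nonneg_nontrivial[OF t]
          has_curve_deriv_inner[OF D(1) q w(1) f t] has_curve_deriv_inner[OF D(2) q w(2) f t]])
  have d: "(\<lambda>\<xi>. 1 * w \<xi> + (- 1) * w' \<xi>) \<in> L2 l" by (rule L2_lincomb[OF w])
  have "(norm_L2 l (\<lambda>\<xi>. 1 * w \<xi> + (- 1) * w' \<xi>))\<^sup>2 = 0"
    unfolding norm_L2_sq inner_L2_lincomb_right[OF w d] eq[OF d] by simp
  then have "norm_L2 l (\<lambda>\<xi>. 1 * w \<xi> + (- 1) * w' \<xi>) = 0" by simp
  then have "AE \<xi> in lebesgue_on (Omega l). 1 * w \<xi> + (- 1) * w' \<xi> = 0"
    unfolding norm_L2_eq_0_iff[OF d] .
  then show ?thesis by eventually_elim simp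
qed

lemma L2_time_deriv_eq:
  assumes D: "has_curve_deriv (norm_L2 l) q w t" and q: "\<And>s. 0 \<le> s \<Longrightarrow> q s \<in> L2 l"
    and w: "w \<in> L2 l" and t: "0 \<le> t"
  shows "L2_time_deriv l q t \<in> L2 l" and "AE \<xi> in lebesgue_on (Omega l). L2_time_deriv l q t \<xi> = w \<xi>"
proof -
  have "\<exists>w. w \<in> L2 l \<and> has_curve_deriv (norm_L2 l) q w t" using D w by blast
  then have *: "L2_time_deriv l q t \<in> L2 l \<and> has_curve_deriv (norm_L2 l) q (L2_time_deriv l q t) t"
    unfolding L2_time_deriv_def curve_deriv_def by (rule someI_ex)
  then show "L2_time_deriv l q t \<in> L2 l" by simp
  show "AE \<xi> in lebesgue_on (Omega l). L2_time_deriv l q t \<xi> = w \<xi>"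
    using curve_deriv_L2_unique[OF _ D q _ w t] * by blast
qed

text \<open>
  Boundedness of a functional makes the supremum in \<^const>\<open>norm_dual\<close> meaningful.  A test function
  of norm 0 cannot be normalised, but is annihilated by every element of the dual.
\<close>

lemma dual_bound:
  assumes F: "F \<in> dual_H2star l" and v: "v \<in> H2star l"
  shows "\<bar>F v\<bar> \<le> norm_dual l F * norm_H2star l v"
proof -
  obtain C where C: "\<forall>v\<in>H2star l. \<bar>F v\<bar> \<le> C * norm_H2star l v"
    and sc: "\<forall>c. \<forall>v\<in>H2star l. F (\<lambda>\<xi>. c * v \<xi>) = c * F v"
    using F by (auto simp: dual_H2star_def)
  have n0: "0 \<le> norm_H2star l z" if "z \<in> H2star l" for z
    using inner_H2star_nonneg[OF H2star_H2[OF that]] by (simp add: norm_H2star_def)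
  have bdd: "bdd_above {\<bar>F v\<bar> | v. v \<in> H2star l \<and> norm_H2star l v \<le> 1}"
  proof (rule bdd_aboveI[of _ "\<bar>C\<bar>"])
    fix x assume "x \<in> {\<bar>F v\<bar> | v. v \<in> H2star l \<and> norm_H2star l v \<le> 1}"
    then obtain z where z: "x = \<bar>F z\<bar>" "z \<in> H2star l" "norm_H2star l z \<le> 1" by blast
    have "x \<le> C * norm_H2star l z" using C z by simp
    also have "\<dots> \<le> \<bar>C\<bar> * norm_H2star l z" using n0[OF z(2)] by (intro mult_right_mono) auto
    also have "\<dots> \<le> \<bar>C\<bar>" using z(3) n0[OF z(2)] by (simp add: mult_left_le)
    finally show "x \<le> \<bar>C\<bar>" .
  qed
  show ?thesis
  proof (cases "norm_H2star l v = 0")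
    case True
    then show ?thesis using C v by force
  next
    case False
    define c where "c = norm_H2star l v"
    have c: "0 < c" using False n0[OF v] by (simp add: c_def)
    define z where "z = (\<lambda>\<xi>. (1 / c) * v \<xi>)"
    have zS: "z \<in> H2star l" using H2star_lincomb[OF v v, of "1 / c" 0] by (simp add: z_def)
    have v2: "v \<in> H2 l" by (rule H2star_H2[OF v])
    have "inner_H2star l z z = (1 / c)\<^sup>2 * inner_H2star l v v"
    proof -
      have w: "inner_L2 l (weak_partial l i j z) (weak_partial l k m z)
          = (1 / c)\<^sup>2 * inner_L2 l (weak_partial l i j v) (weak_partial l k m v)"
        if ij: "i + j \<le> 2" "k + m \<le> 2" for i j k m
      proof -
        have e: "AE \<xi> in lebesgue_on (Omega l). weak_partial l i j z \<xi> = (1 / c) * weak_partial l i j v \<xi>"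
          if "i + j \<le> 2" for i j
          using weak_partial_lincomb[OF v2 v2 that, of "1 / c" 0] by (simp add: z_def)
        have "inner_L2 l (weak_partial l i j z) (weak_partial l k m z)
            = inner_L2 l (\<lambda>\<xi>. (1 / c) * weak_partial l i j v \<xi>) (\<lambda>\<xi>. (1 / c) * weak_partial l k m v \<xi>)"
          by (intro inner_L2_cong e ij weak_partial_spec H2star_H2 zS v L2_scale)
        then show ?thesis
          by (simp only: inner_L2_scale inner_L2_commute[of l "weak_partial l i j v"] power2_eq_square mult.assoc)
      qed
      have z2: "z \<in> H2 l" by (rule H2star_H2[OF zS])
      show ?thesis unfolding inner_H2star_eq[OF z2 z2] inner_H2star_eq[OF v2 v2]
        by (simp add: w algebra_simps)
    qed
    also have "inner_H2star l v v = c\<^sup>2" by (simp add: c_def norm_H2star_sq[OF v2])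
    also have "(1 / c)\<^sup>2 * c\<^sup>2 = 1" using c by (simp add: power_divide)
    finally have "norm_H2star l z = 1" by (simp add: norm_H2star_def)
    then have "\<bar>F z\<bar> \<le> norm_dual l F"
      unfolding norm_dual_def using zS by (intro cSup_upper bdd) auto
    moreover have "F z = (1 / c) * F v" using sc v unfolding z_def by blast
    ultimately show ?thesis using c by (simp add: c_def abs_mult field_simps)
  qed
qed

lemma dual_difference_quotient:
  assumes "F \<in> dual_H2star l" "G \<in> dual_H2star l" "W \<in> dual_H2star l"
  shows "(\<lambda>v. (F v - G v) / c - W v) \<in> dual_H2star l"
proof -
  obtain A B C where A: "\<forall>v\<in>H2star l. \<bar>F v\<bar> \<le> A * norm_H2star l v"
    and B: "\<forall>v\<in>H2star l. \<bar>G v\<bar> \<le> B * norm_H2star l v"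
    and C: "\<forall>v\<in>H2star l. \<bar>W v\<bar> \<le> C * norm_H2star l v"
    using assms by (auto simp: dual_H2star_def)
  have "\<bar>(F v - G v) / c - W v\<bar> \<le> ((A + B) / \<bar>c\<bar> + C) * norm_H2star l v" if "v \<in> H2star l" for v
  proof -
    have "\<bar>(F v - G v) / c - W v\<bar> \<le> \<bar>F v - G v\<bar> / \<bar>c\<bar> + \<bar>W v\<bar>"
      by (metis abs_divide abs_triangle_ineq4)
    also have "\<dots> \<le> (A * norm_H2star l v + B * norm_H2star l v) / \<bar>c\<bar> + C * norm_H2star l v"
    proof (intro add_mono divide_right_mono)
      show "\<bar>F v - G v\<bar> \<le> A * norm_H2star l v + B * norm_H2star l v"
        using A B that by (meson abs_triangle_ineq4 add_mono order_trans)
    qed (use C that in auto)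
    finally show ?thesis by (simp add: algebra_simps add_divide_distrib)
  qed
  then show ?thesis using assms
    unfolding dual_H2star_def mem_Collect_eq
    by (intro conjI) (auto simp: algebra_simps add_divide_distrib diff_divide_distrib intro!: exI[of _ "(A + B) / \<bar>c\<bar> + C"])
qed

lemma has_curve_deriv_dual:
  assumes D: "has_curve_deriv (norm_dual l) U W t" and U: "\<And>s. 0 \<le> s \<Longrightarrow> U s \<in> dual_H2star l"
    and W: "W \<in> dual_H2star l" and v: "v \<in> H2star l" and t: "0 \<le> t"
  shows "((\<lambda>s. (U s v - U t v) / (s - t)) \<longlongrightarrow> W v) (at t within {0..})"
proof -
  have "((\<lambda>s. (U s v - U t v) / (s - t) - W v) \<longlongrightarrow> 0) (at t within {0..})"
  proof (rule Lim_null_comparison)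
    show "((\<lambda>s. norm_dual l (\<lambda>z. (U s z - U t z) / (s - t) - W z) * norm_H2star l v) \<longlongrightarrow> 0) (at t within {0..})"
      using D unfolding has_curve_deriv_def by (auto intro!: tendsto_eq_intros)
    have "eventually (\<lambda>s. s \<in> {0..}) (at t within {0..})" by (simp add: eventually_at_filter)
    then show "eventually (\<lambda>s. norm ((U s v - U t v) / (s - t) - W v)
        \<le> norm_dual l (\<lambda>z. (U s z - U t z) / (s - t) - W z) * norm_H2star l v) (at t within {0..})"
    proof eventually_elim
      case (elim s)
      show ?case
        using dual_bound[OF dual_difference_quotient[OF U U W] v, of s t "s - t"] elim t by simp
    qed
  qed
  then show ?thesis by (simp add: LIM_zero_iff)
qed

text \<open>
  Derivatives in the dual space are only selected, but on a fixed element of \<open>H\<^sup>2\<^sub>*\<close> they are limits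
  of scalar difference quotients and therefore determined: the first one is \<open>(u', \<cdot>)\<close>.
\<close>

lemma second_dual_derivative:
  assumes C2: "C_curve 2 (dual_H2star l) (norm_dual l) (\<lambda>t. inner_L2 l (u t))"
    and u: "\<And>t. 0 \<le> t \<Longrightarrow> u t \<in> L2 l" and u': "\<And>t. 0 \<le> t \<Longrightarrow> u' t \<in> L2 l"
    and D: "\<And>t. 0 \<le> t \<Longrightarrow> has_curve_deriv (norm_L2 l) u (u' t) t"
    and v: "v \<in> H2star l" and t: "0 < t"
  shows "((\<lambda>s. inner_L2 l (u' s) v) has_real_derivative
      dual_time_deriv l (dual_time_deriv l (\<lambda>s. inner_L2 l (u s))) t v) (at t)"
proof -
  let ?U = "\<lambda>s. inner_L2 l (u s)"
  obtain U' U'' where U: "\<forall>t\<ge>0. ?U t \<in> dual_H2star l"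
    and U': "\<forall>t\<ge>0. has_curve_deriv (norm_dual l) ?U (U' t) t" "\<forall>t\<ge>0. U' t \<in> dual_H2star l"
    and U'': "\<forall>t\<ge>0. has_curve_deriv (norm_dual l) U' (U'' t) t" "\<forall>t\<ge>0. U'' t \<in> dual_H2star l"
    using C2 by (auto simp: numeral_2_eq_2 C0_curve_def)
  have vL: "z \<in> L2 l" if "z \<in> H2star l" for z using that by (intro H2_L2 H2star_H2)
  define D1 where "D1 = dual_time_deriv l ?U"
  have D1: "D1 s \<in> dual_H2star l" "has_curve_deriv (norm_dual l) ?U (D1 s) s" if "0 \<le> s" for s
  proof -
    have "\<exists>w. w \<in> dual_H2star l \<and> has_curve_deriv (norm_dual l) ?U w s" using U' that by blast
    then have "D1 s \<in> dual_H2star l \<and> has_curve_deriv (norm_dual l) ?U (D1 s) s"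
      unfolding D1_def dual_time_deriv_def curve_deriv_def by (rule someI_ex)
    then show "D1 s \<in> dual_H2star l" "has_curve_deriv (norm_dual l) ?U (D1 s) s" by auto
  qed
  have val: "W z = inner_L2 l (u' s) z"
    if s: "0 \<le> s" and W: "W \<in> dual_H2star l" "has_curve_deriv (norm_dual l) ?U W s" and z: "z \<in> H2star l" for s W z
  proof (rule tendsto_unique[OF at_within_nonneg_nontrivial[OF s]])
    show "((\<lambda>r. (inner_L2 l (u r) z - inner_L2 l (u s) z) / (r - s)) \<longlongrightarrow> W z) (at s within {0..})"
      by (rule has_curve_deriv_dual[OF W(2) _ W(1) z s]) (use U in auto)
    show "((\<lambda>r. (inner_L2 l (u r) z - inner_L2 l (u s) z) / (r - s)) \<longlongrightarrow> inner_L2 l (u' s) z) (at s within {0..})"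
      using has_curve_deriv_inner[OF D[OF s] u u'[OF s] vL[OF z] s] by (simp add: inner_L2_commute[of l z])
  qed
  have agree: "D1 s z = U' s z" if "0 \<le> s" "z \<in> H2star l" for s z
    using val[OF that(1) D1[OF that(1)] that(2)] val[OF that(1) _ _ that(2), of "U' s"] U' that(1) by simp
  have "has_curve_deriv (norm_dual l) D1 (U'' t) t"
    unfolding has_curve_deriv_def
  proof (rule Lim_transform_eventually)
    show "((\<lambda>s. norm_dual l (\<lambda>z. (U' s z - U' t z) / (s - t) - U'' t z)) \<longlongrightarrow> 0) (at t within {0..})"
      using U''(1) t unfolding has_curve_deriv_def by auto
    have "eventually (\<lambda>s. s \<in> {0..}) (at t within {0..})" by (simp add: eventually_at_filter)
    then show "eventually (\<lambda>s. norm_dual l (\<lambda>z. (U' s z - U' t z) / (s - t) - U'' t z)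
        = norm_dual l (\<lambda>z. (D1 s z - D1 t z) / (s - t) - U'' t z)) (at t within {0..})"
    proof eventually_elim
      case (elim s)
      have "{\<bar>(U' s v - U' t v) / (s - t) - U'' t v\<bar> |v. v \<in> H2star l \<and> norm_H2star l v \<le> 1}
          = {\<bar>(D1 s v - D1 t v) / (s - t) - U'' t v\<bar> |v. v \<in> H2star l \<and> norm_H2star l v \<le> 1}"
        using agree elim t by (intro Collect_cong ex_cong1) auto
      then show ?case by (simp add: norm_dual_def)
    qed
  qed
  then have "\<exists>w. w \<in> dual_H2star l \<and> has_curve_deriv (norm_dual l) D1 w t"
    using U''(2)[rule_format, OF less_imp_le[OF t]] by blast
  then have D2: "dual_time_deriv l D1 t \<in> dual_H2star l \<and> has_curve_deriv (norm_dual l) D1 (dual_time_deriv l D1 t) t"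
    unfolding dual_time_deriv_def[of l] curve_deriv_def by (rule someI_ex)
  have "((\<lambda>s. (D1 s v - D1 t v) / (s - t)) \<longlongrightarrow> dual_time_deriv l D1 t v) (at t within {0..})"
    by (rule has_curve_deriv_dual[OF _ D1(1) _ v]) (use D2 t in auto)
  moreover have "eventually (\<lambda>s. (D1 s v - D1 t v) / (s - t) = (inner_L2 l (u' s) v - inner_L2 l (u' t) v) / (s - t)) (at t within {0..})"
  proof -
    have "eventually (\<lambda>s. s \<in> {0..}) (at t within {0..})" by (simp add: eventually_at_filter)
    then show ?thesis
    proof eventually_elim
      case (elim s)
      then show ?case using val[OF _ D1 v] t by simp
    qed
  qed
  ultimately have "((\<lambda>s. (inner_L2 l (u' s) v - inner_L2 l (u' t) v) / (s - t)) \<longlongrightarrow> dual_time_deriv l D1 t v) (at t within {0..})"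
    by (rule Lim_transform_eventually)
  then show ?thesis
    using t by (simp add: has_field_derivative_iff at_within_nonneg D1_def)
qed

section \<open>The torsional component\<close>

text \<open>
  Orthogonal projection onto functions of fixed parity in \<open>y\<close>: odd for \<open>c = -1\<close>, even for
  \<open>c = 1\<close>.  Differentiation in \<open>y\<close> exchanges the two.
\<close>

definition parity :: "real \<Rightarrow> (real \<times> real \<Rightarrow> real) \<Rightarrow> real \<times> real \<Rightarrow> real" where
  "parity c f = (\<lambda>\<xi>. 1 / 2 * f \<xi> + c / 2 * reflect f \<xi>)"

lemma torsional_parity: "torsional f = parity (- 1) f"
  by (simp add: torsional_eq parity_def)

lemma parity_L2: "f \<in> L2 l \<Longrightarrow> parity c f \<in> L2 l"
  unfolding parity_def by (intro L2_lincomb reflect_L2)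

lemma inner_parity:
  assumes f: "f \<in> L2 l" and g: "g \<in> L2 l" and c: "c\<^sup>2 = 1"
  shows "inner_L2 l f (parity c g) = inner_L2 l (parity c f) (parity c g)"
proof -
  note rf = reflect_L2[OF f] and rg = reflect_L2[OF g]
  have "inner_L2 l (reflect f) g = inner_L2 l f (reflect g)"
    using inner_L2_reflect[OF f rg] by simp
  moreover have "inner_L2 l (parity c f) (parity c g)
      = 1 / 2 * (1 / 2 * inner_L2 l f g + c / 2 * inner_L2 l f (reflect g))
      + c / 2 * (1 / 2 * inner_L2 l (reflect f) g + c / 2 * inner_L2 l (reflect f) (reflect g))"
    unfolding parity_def
    by (simp only: inner_L2_lincomb[OF f rf L2_lincomb[OF g rg]] inner_L2_lincomb_right[OF g rg f]
        inner_L2_lincomb_right[OF g rg rf])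
  moreover have "inner_L2 l f (parity c g) = 1 / 2 * inner_L2 l f g + c / 2 * inner_L2 l f (reflect g)"
    unfolding parity_def by (rule inner_L2_lincomb_right[OF g rg f])
  moreover have "c * (c * x) = x" for x using c by (simp add: power2_eq_square flip: mult.assoc)
  ultimately show ?thesis
    by (simp add: inner_L2_reflect[OF f g] algebra_simps)
qed

lemma norm_parity_le:
  assumes f: "f \<in> L2 l" and c: "c\<^sup>2 = 1"
  shows "norm_L2 l (parity c f) \<le> norm_L2 l f"
proof -
  have "norm_L2 l (reflect f) = norm_L2 l f" by (simp add: norm_L2_def inner_L2_reflect[OF f f])
  moreover have "\<bar>c\<bar> = 1" using c by (simp add: power2_eq_1_iff abs_if split: if_splits) auto
  ultimately show ?thesis
    using norm_L2_triangle[OF f reflect_L2[OF f], of "1 / 2" "c / 2"] by (simp add: parity_def)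
qed

lemma weak_partial_torsional:
  assumes u: "u \<in> H2 l" and ij: "i + j \<le> 2"
  shows "AE \<xi> in lebesgue_on (Omega l).
    weak_partial l i j (torsional u) \<xi> = parity (- ((- 1) ^ j)) (weak_partial l i j u) \<xi>"
  using weak_partial_lincomb[OF u H2_reflect[OF u] ij, of "1 / 2" "- 1 / 2"] weak_partial_reflect[OF u ij]
  unfolding torsional_eq parity_def by eventually_elim simp

lemma H2_torsional: "u \<in> H2 l \<Longrightarrow> torsional u \<in> H2 l"
  unfolding torsional_eq by (intro H2_lincomb H2_reflect)

lemma inner_weak_partial_torsional:
  assumes u: "u \<in> H2 l" and v: "v \<in> H2 l" and ij: "i + j \<le> 2" "k + m \<le> 2" and par: "even j = even m"
  shows "inner_L2 l (weak_partial l i j u) (weak_partial l k m (torsional v))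
    = inner_L2 l (weak_partial l i j (torsional u)) (weak_partial l k m (torsional v))"
proof -
  define c :: real where "c = - ((- 1) ^ j)"
  have c: "c\<^sup>2 = 1" and cm: "- ((- 1) ^ m) = c" using par by (simp_all add: c_def minus_one_power_iff)
  note L = weak_partial_spec(1)[OF u ij(1)] weak_partial_spec(1)[OF v ij(2)]
    weak_partial_spec(1)[OF H2_torsional[OF u] ij(1)] weak_partial_spec(1)[OF H2_torsional[OF v] ij(2)]
  note e = weak_partial_torsional[OF u ij(1), folded c_def] weak_partial_torsional[OF v ij(2), unfolded cm]
  have "inner_L2 l (weak_partial l i j u) (weak_partial l k m (torsional v))
      = inner_L2 l (weak_partial l i j u) (parity c (weak_partial l k m v))"
    by (intro inner_L2_cong L parity_L2 e AE_I2) simp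
  also have "\<dots> = inner_L2 l (parity c (weak_partial l i j u)) (parity c (weak_partial l k m v))"
    by (rule inner_parity[OF L(1,2) c])
  also have "\<dots> = inner_L2 l (weak_partial l i j (torsional u)) (weak_partial l k m (torsional v))"
    by (intro inner_L2_cong[symmetric] L parity_L2 e)
  finally show ?thesis .
qed

lemma norm_weak_partial_torsional_le:
  assumes u: "u \<in> H2 l" and ij: "i + j \<le> 2"
  shows "norm_L2 l (weak_partial l i j (torsional u)) \<le> norm_L2 l (weak_partial l i j u)"
proof -
  note L = weak_partial_spec(1)[OF u ij] weak_partial_spec(1)[OF H2_torsional[OF u] ij]
  note e = weak_partial_torsional[OF u ij]
  have "norm_L2 l (weak_partial l i j (torsional u)) = norm_L2 l (parity (- ((- 1) ^ j)) (weak_partial l i j u))"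
    unfolding norm_L2_def by (simp only: inner_L2_cong[OF L(2) parity_L2[OF L(1)] L(2) parity_L2[OF L(1)] e e])
  also have "\<dots> \<le> norm_L2 l (weak_partial l i j u)"
    by (rule norm_parity_le[OF L(1)]) (simp add: power2_eq_square flip: power_mult_distrib)
  finally show ?thesis .
qed

text \<open>
  Continuity of the coefficient \<open>\<parallel>u\<^sub>x\<parallel>\<^sup>2\<close> concerns all of \<open>u\<close>, not only its odd part, so this cruder
  bound comes without parity; \<open>u\<^sub>x\<close> is interpolated between \<open>u\<close> and \<open>u\<^sub>x\<^sub>x\<close>.
\<close>

lemma norm_weak_partial_le:
  assumes l: "0 < l" and lam: "0 < lambda1 l" and ij: "(i, j) \<in> {(2, 0), (0, 2), (1, 1), (1, 0)}"
    and v: "v \<in> H2star l"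
  shows "norm_L2 l (weak_partial l i j v) \<le> sqrt (1 / lambda1 l + 2) * norm_H2star l v"
proof -
  note v2 = H2star_H2[OF v]
  have L: "v \<in> L2 l" "weak_partial l 2 0 v \<in> L2 l" by (rule H2_L2[OF v2]) (auto intro: weak_partial_spec v2)
  define H where "H = inner_H2star l v v"
  have H: "0 \<le> H" unfolding H_def by (rule inner_H2star_nonneg[OF v2])
  have nn: "0 \<le> inner_L2 l (weak_partial l 2 0 v) (weak_partial l 2 0 v)"
    "0 \<le> inner_L2 l (weak_partial l 0 2 v) (weak_partial l 0 2 v)"
    "0 \<le> inner_L2 l (weak_partial l 1 1 v) (weak_partial l 1 1 v)"
    by (rule inner_L2_nonneg)+
  note low = inner_H2star_lower[OF v2, folded H_def]
  have 20: "inner_L2 l (weak_partial l 2 0 v) (weak_partial l 2 0 v) \<le> 2 * H" using low nn H by linarith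
  have "inner_L2 l v v \<le> H / lambda1 l"
    using lambda1_le[OF v] lam by (simp add: H_def field_simps)
  moreover have "inner_L2 l (weak_partial l 1 0 v) (weak_partial l 1 0 v)
      \<le> inner_L2 l (weak_partial l 2 0 v) (weak_partial l 2 0 v) + inner_L2 l v v"
  proof -
    have "inner_L2 l (weak_partial l 1 0 v) (weak_partial l 1 0 v)
        \<le> norm_L2 l (weak_partial l 2 0 v) * norm_L2 l v"
      using inner_x_by_parts[OF l v v] inner_L2_Cauchy_Schwarz[OF L(2,1)] by linarith
    also have "\<dots> \<le> (norm_L2 l (weak_partial l 2 0 v))\<^sup>2 + (norm_L2 l v)\<^sup>2"
      using abs_mult_le_sum_squares[of "norm_L2 l (weak_partial l 2 0 v)" "norm_L2 l v"] by simp
    finally show ?thesis by (simp add: norm_L2_sq)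
  qed
  moreover have "0 \<le> H / lambda1 l" using H lam by simp
  ultimately have "inner_L2 l (weak_partial l i j v) (weak_partial l i j v) \<le> (1 / lambda1 l + 2) * H"
    using ij low nn 20 H unfolding distrib_right by auto
  then have "sqrt (inner_L2 l (weak_partial l i j v) (weak_partial l i j v)) \<le> sqrt ((1 / lambda1 l + 2) * H)"
    by (rule real_sqrt_le_mono)
  then show ?thesis by (simp only: norm_L2_def norm_H2star_def H_def real_sqrt_mult)
qed

text \<open>
  Taking parity parts is a contraction and commutes with differentiation up to the choice of the
  parity, so the increments of both curves are bounded by those of \<open>u\<close>.
\<close>

lemma C0_curve_weak_partial:
  assumes l: "0 < l" and lam: "0 < lambda1 l" and ij: "(i, j) \<in> {(2, 0), (0, 2), (1, 1), (1, 0)}"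
    and u: "C0_curve (H2star l) (norm_H2star l) u"
  shows "C0_curve (L2 l) (norm_L2 l) (\<lambda>t. weak_partial l i j (u t))"
    and "C0_curve (L2 l) (norm_L2 l) (\<lambda>t. weak_partial l i j (torsional (u t)))"
proof -
  have ij2: "i + j \<le> 2" using ij by auto
  define K where "K = sqrt (1 / lambda1 l + 2)"
  have bounds: "norm_L2 l (\<lambda>z. weak_partial l i j (u s) z - weak_partial l i j (u t) z) \<le> K * norm_H2star l (\<lambda>z. u s z - u t z)"
    "norm_L2 l (\<lambda>z. weak_partial l i j (torsional (u s)) z - weak_partial l i j (torsional (u t)) z) \<le> K * norm_H2star l (\<lambda>z. u s z - u t z)"
    if st: "0 \<le> s" "0 \<le> t" for s t
  proof -
    have us: "u s \<in> H2star l" "u t \<in> H2star l" using u st by (auto simp: C0_curve_def)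
    define d where "d = (\<lambda>z. u s z - u t z)"
    have d: "d \<in> H2star l" using H2star_lincomb[OF us, of 1 "- 1"] by (simp add: d_def)
    have diff: "norm_L2 l (\<lambda>z. weak_partial l i j a z - weak_partial l i j b z) = norm_L2 l (weak_partial l i j (\<lambda>z. a z - b z))"
      if a: "a \<in> H2 l" and b: "b \<in> H2 l" for a b
    proof -
      have e: "AE z in lebesgue_on (Omega l). weak_partial l i j a z - weak_partial l i j b z = weak_partial l i j (\<lambda>z. a z - b z) z"
        using weak_partial_lincomb[OF a b ij2, of 1 "- 1"] by eventually_elim simp
      have "(\<lambda>z. a z - b z) \<in> H2 l" using H2_lincomb[OF a b, of 1 "- 1"] by simp
      note L2 = weak_partial_spec(1)[OF this ij2]
      have L1: "(\<lambda>z. weak_partial l i j a z - weak_partial l i j b z) \<in> L2 l"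
        using L2_lincomb[OF weak_partial_spec(1)[OF a ij2] weak_partial_spec(1)[OF b ij2], of 1 "- 1"] by simp
      show ?thesis unfolding norm_L2_def by (simp only: inner_L2_cong[OF L1 L2 L1 L2 e e])
    qed
    note h = H2star_H2[OF us(1)] H2star_H2[OF us(2)]
    have K: "norm_L2 l (weak_partial l i j d) \<le> K * norm_H2star l d"
      unfolding K_def by (rule norm_weak_partial_le[OF l lam ij d])
    then show "norm_L2 l (\<lambda>z. weak_partial l i j (u s) z - weak_partial l i j (u t) z) \<le> K * norm_H2star l (\<lambda>z. u s z - u t z)"
      using diff[OF h] by (simp add: d_def)
    have "(\<lambda>z. torsional (u s) z - torsional (u t) z) = torsional d"
      by (auto simp: torsional_def d_def fun_eq_iff diff_divide_distrib)
    then have "norm_L2 l (\<lambda>z. weak_partial l i j (torsional (u s)) z - weak_partial l i j (torsional (u t)) z)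
        = norm_L2 l (weak_partial l i j (torsional d))"
      using diff[OF H2_torsional[OF h(1)] H2_torsional[OF h(2)]] by simp
    also have "\<dots> \<le> norm_L2 l (weak_partial l i j d)"
      by (rule norm_weak_partial_torsional_le[OF H2star_H2[OF d] ij2])
    also note K
    finally show "norm_L2 l (\<lambda>z. weak_partial l i j (torsional (u s)) z - weak_partial l i j (torsional (u t)) z)
      \<le> K * norm_H2star l (\<lambda>z. u s z - u t z)" by (simp add: d_def)
  qed
  have main: "C0_curve (L2 l) (norm_L2 l) p"
    if p: "\<And>t. 0 \<le> t \<Longrightarrow> p t \<in> L2 l"
      and b: "\<And>s t. 0 \<le> s \<Longrightarrow> 0 \<le> t \<Longrightarrow> norm_L2 l (\<lambda>z. p s z - p t z) \<le> K * norm_H2star l (\<lambda>z. u s z - u t z)" for p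
    unfolding C0_curve_def
  proof (intro allI impI conjI p)
    fix t :: real assume t: "0 \<le> t"
    have e: "eventually (\<lambda>s. s \<in> {0..}) (at t within {0..})" by (simp add: eventually_at_filter)
    show "((\<lambda>s. norm_L2 l (\<lambda>z. p s z - p t z)) \<longlongrightarrow> 0) (at t within {0..})"
    proof (rule Lim_null_comparison)
      show "((\<lambda>s. K * norm_H2star l (\<lambda>z. u s z - u t z)) \<longlongrightarrow> 0) (at t within {0..})"
        using u t unfolding C0_curve_def by (auto intro!: tendsto_eq_intros)
      show "eventually (\<lambda>s. norm (norm_L2 l (\<lambda>z. p s z - p t z)) \<le> K * norm_H2star l (\<lambda>z. u s z - u t z)) (at t within {0..})"
        using e by eventually_elim (simp add: b t)
    qed
  qed
  have h: "u t \<in> H2 l" if "0 \<le> t" for t using u that by (auto simp: C0_curve_def intro: H2star_H2)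
  show "C0_curve (L2 l) (norm_L2 l) (\<lambda>t. weak_partial l i j (u t))"
    by (rule main[OF _ bounds(1)]) (auto intro!: weak_partial_spec h ij2)
  show "C0_curve (L2 l) (norm_L2 l) (\<lambda>t. weak_partial l i j (torsional (u t)))"
    by (rule main[OF _ bounds(2)]) (auto intro!: weak_partial_spec h ij2 H2_torsional)
qed

lemma C0_curve_torsional:
  assumes u: "C0_curve (L2 l) (norm_L2 l) u"
  shows "C0_curve (L2 l) (norm_L2 l) (\<lambda>t. torsional (u t))"
  unfolding C0_curve_def
proof (intro allI impI conjI)
  fix t :: real assume t: "0 \<le> t"
  have uL: "u s \<in> L2 l" if "0 \<le> s" for s using u that by (auto simp: C0_curve_def)
  show "torsional (u t) \<in> L2 l" unfolding torsional_parity by (intro parity_L2 uL t)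
  have e: "eventually (\<lambda>s. s \<in> {0..}) (at t within {0..})" by (simp add: eventually_at_filter)
  show "((\<lambda>s. norm_L2 l (\<lambda>z. torsional (u s) z - torsional (u t) z)) \<longlongrightarrow> 0) (at t within {0..})"
  proof (rule Lim_null_comparison)
    show "((\<lambda>s. norm_L2 l (\<lambda>z. u s z - u t z)) \<longlongrightarrow> 0) (at t within {0..})"
      using u t by (auto simp: C0_curve_def)
    show "eventually (\<lambda>s. norm (norm_L2 l (\<lambda>z. torsional (u s) z - torsional (u t) z)) \<le> norm_L2 l (\<lambda>z. u s z - u t z)) (at t within {0..})"
      using e
    proof eventually_elim
      case (elim s)
      have "(\<lambda>z. u s z - u t z) \<in> L2 l" using L2_lincomb[OF uL[of s] uL[OF t], of 1 "- 1"] elim by simp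
      moreover have "(\<lambda>z. torsional (u s) z - torsional (u t) z) = parity (- 1) (\<lambda>z. u s z - u t z)"
        by (auto simp: torsional_def parity_def reflect_def fun_eq_iff field_simps)
      ultimately show ?case using norm_parity_le[of "\<lambda>z. u s z - u t z" l "- 1"] by simp
    qed
  qed
qed

lemma has_curve_deriv_torsional:
  assumes D: "has_curve_deriv (norm_L2 l) u w t" and u: "\<And>s. 0 \<le> s \<Longrightarrow> u s \<in> L2 l"
    and w: "w \<in> L2 l" and t: "0 \<le> t"
  shows "has_curve_deriv (norm_L2 l) (\<lambda>t. torsional (u t)) (torsional w) t"
  unfolding has_curve_deriv_def
proof (rule Lim_null_comparison)
  show "((\<lambda>s. norm_L2 l (\<lambda>z. (u s z - u t z) / (s - t) - w z)) \<longlongrightarrow> 0) (at t within {0..})"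
    using D by (simp add: has_curve_deriv_def)
  have e: "eventually (\<lambda>s. s \<in> {0..}) (at t within {0..})" by (simp add: eventually_at_filter)
  then show "eventually (\<lambda>s. norm (norm_L2 l (\<lambda>z. (torsional (u s) z - torsional (u t) z) / (s - t) - torsional w z))
      \<le> norm_L2 l (\<lambda>z. (u s z - u t z) / (s - t) - w z)) (at t within {0..})"
  proof eventually_elim
    case (elim s)
    have "(\<lambda>z. (u s z - u t z) / (s - t) - w z) \<in> L2 l"
      using elim t by (intro difference_quotient_L2(1) u w) auto
    moreover have "(\<lambda>z. (torsional (u s) z - torsional (u t) z) / (s - t) - torsional w z)
        = parity (- 1) (\<lambda>z. (u s z - u t z) / (s - t) - w z)"
    proof
      fix z :: "real \<times> real"
      have "((x - x') / 2 - (y - y') / 2) / c - (r - r') / 2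
          = 1 / 2 * ((x - y) / c - r) + - 1 / 2 * ((x' - y') / c - r')" for x x' y y' c r r' :: real
        by (cases "c = 0") (simp_all add: field_simps)
      then show "(torsional (u s) z - torsional (u t) z) / (s - t) - torsional w z
          = parity (- 1) (\<lambda>z. (u s z - u t z) / (s - t) - w z) z"
        by (cases z) (simp only: torsional_def parity_def reflect_def prod.case)
    qed
    ultimately show ?case using norm_parity_le[of "\<lambda>z. (u s z - u t z) / (s - t) - w z" l "- 1"] by simp
  qed
qed


section \<open>Decay of the torsional energy\<close>

text \<open>
  The scalar inequalities behind the Lyapunov function \<open>Y = (N + A)/2 + \<delta>/4 M + \<delta>\<^sup>2/8 K\<close>, where
  \<open>N = \<parallel>w\<^sub>t\<parallel>\<^sup>2\<close>, \<open>K = \<parallel>w\<parallel>\<^sup>2\<close>, \<open>M = (w\<^sub>t, w)\<close>, \<open>H = \<parallel>w\<parallel>\<^sup>2\<close> in the energy space, \<open>X = \<parallel>w\<^sub>x\<parallel>\<^sup>2\<close>,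
  \<open>A = H - P X\<close>, \<open>Q = (w\<^sub>x\<^sub>x, w\<^sub>t)\<close>, and \<open>r = S \<parallel>u\<^sub>x\<parallel>\<^sup>2\<close> is the coefficient of the nonlinearity.
\<close>

lemma Lyapunov_estimates:
  fixes \<delta> A N H K M X Q r lam :: real
  assumes \<delta>: "0 < \<delta>" and lam: "0 < lam" and nn: "0 \<le> N" "0 \<le> H" "0 \<le> K" "0 \<le> X" "0 \<le> r"
    and A: "H / 50 \<le> A" "A \<le> H" and K: "lam * K \<le> H" and M: "M\<^sup>2 \<le> N * K"
    and Q: "Q\<^sup>2 \<le> 25 / 24 * H * N" and r: "r \<le> \<delta> / 25"
  shows "N / 4 + H / 100 \<le> (N + A) / 2 + \<delta> / 4 * M + \<delta>\<^sup>2 / 8 * K"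
    and "(N + A) / 2 + \<delta> / 4 * M + \<delta>\<^sup>2 / 8 * K
      \<le> (1 / 2 + \<delta> / 4 + \<delta> / (4 * lam) + \<delta>\<^sup>2 / (8 * lam)) * (N + H)"
    and "- (\<delta> * N - r * Q) + \<delta> / 4 * (N - A - r * X) \<le> - (\<delta> / 500) * (N + H)"
proof -
  have KH: "K \<le> H / lam" using K lam by (simp add: field_simps)
  have amgm: "2 * \<bar>a\<bar> \<le> c * x + y / c" if "a\<^sup>2 \<le> x * y" "0 \<le> x" "0 \<le> y" "0 < c" for a c x y :: real
  proof (rule power2_le_imp_le)
    have "(2 * \<bar>a\<bar>)\<^sup>2 \<le> 4 * (x * y)" using that(1) by (simp add: power_mult_distrib)
    also have "\<dots> = (c * x + y / c)\<^sup>2 - (c * x - y / c)\<^sup>2"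
      using that(4) by (simp add: power2_eq_square field_simps)
    also have "\<dots> \<le> (c * x + y / c)\<^sup>2" by simp
    finally show "(2 * \<bar>a\<bar>)\<^sup>2 \<le> (c * x + y / c)\<^sup>2" .
  qed (use that in simp)
  \<comment> \<open>With this weight \<open>\<delta>/4 M\<close> costs half of \<open>N/2\<close> and half of \<open>\<delta>\<^sup>2/8 K\<close>.\<close>
  have "2 * \<bar>M\<bar> \<le> (2 / \<delta>) * N + K / (2 / \<delta>)" by (rule amgm[OF M nn(1,3)]) (use \<delta> in simp)
  then have "\<delta> / 8 * (2 * \<bar>M\<bar>) \<le> \<delta> / 8 * ((2 / \<delta>) * N + K / (2 / \<delta>))" using \<delta> by (intro mult_left_mono) auto
  also have "\<dots> = N / 4 + \<delta>\<^sup>2 / 16 * K" using \<delta> by (simp add: field_simps power2_eq_square)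
  finally have M1: "\<delta> / 4 * \<bar>M\<bar> \<le> N / 4 + \<delta>\<^sup>2 / 16 * K" by simp
  have "\<delta> / 4 * M \<ge> - (\<delta> / 4 * \<bar>M\<bar>)"
    using \<delta> abs_ge_minus_self[of M] mult_left_mono[of "- M" "\<bar>M\<bar>" "\<delta> / 4"] by simp
  moreover have "0 \<le> \<delta>\<^sup>2 / 16 * K" using nn by simp
  moreover have "N / 4 + H / 100 \<le> (N + A) / 2 + m + 2 * k"
    if "- m' \<le> m" "0 \<le> k" "m' \<le> N / 4 + k" for m m' k :: real
    using that A(1) by (simp add: field_simps)
  ultimately have "N / 4 + H / 100 \<le> (N + A) / 2 + \<delta> / 4 * M + 2 * (\<delta>\<^sup>2 / 16 * K)"
    using M1 by blast
  then show "N / 4 + H / 100 \<le> (N + A) / 2 + \<delta> / 4 * M + \<delta>\<^sup>2 / 8 * K" by (simp add: mult.commute)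
  have "2 * \<bar>M\<bar> \<le> 1 * N + K / 1" by (rule amgm[OF M nn(1,3)]) simp
  then have "2 * M \<le> N + K" by simp
  then have "\<delta> / 4 * M \<le> \<delta> / 4 * (N + H / lam)"
    using \<delta> KH nn(1,3) by (intro mult_left_mono) auto
  moreover have "\<delta>\<^sup>2 / 8 * K \<le> \<delta>\<^sup>2 / 8 * (H / lam)" using KH by (intro mult_left_mono) auto
  ultimately have "(N + A) / 2 + \<delta> / 4 * M + \<delta>\<^sup>2 / 8 * K
      \<le> (N + H) / 2 + \<delta> / 4 * (N + H / lam) + \<delta>\<^sup>2 / 8 * (H / lam)"
    using A(2) by (intro add_mono) simp_all
  also have "\<dots> \<le> (1 / 2 + \<delta> / 4 + \<delta> / (4 * lam) + \<delta>\<^sup>2 / (8 * lam)) * (N + H)"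
  proof -
    have "(1 / 2 + \<delta> / 4 + \<delta> / (4 * lam) + \<delta>\<^sup>2 / (8 * lam)) * (N + H)
        - ((N + H) / 2 + \<delta> / 4 * (N + H / lam) + \<delta>\<^sup>2 / 8 * (H / lam))
        = \<delta> / 4 * H + \<delta> / (4 * lam) * N + \<delta>\<^sup>2 / (8 * lam) * N"
      by (simp add: algebra_simps add_divide_distrib)
    moreover have "0 \<le> \<delta> / 4 * H + \<delta> / (4 * lam) * N + \<delta>\<^sup>2 / (8 * lam) * N"
      using \<delta> lam nn by (intro add_nonneg_nonneg mult_nonneg_nonneg) auto
    ultimately show ?thesis by linarith
  qed
  finally show "(N + A) / 2 + \<delta> / 4 * M + \<delta>\<^sup>2 / 8 * K
      \<le> (1 / 2 + \<delta> / 4 + \<delta> / (4 * lam) + \<delta>\<^sup>2 / (8 * lam)) * (N + H)" .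
  \<comment> \<open>The weight 10 splits \<open>r Q\<close> between the dissipation \<open>\<delta> N\<close> and the potential part \<open>\<delta>/4 A\<close>.\<close>
  have "2 * \<bar>Q\<bar> \<le> 10 * N + (25 / 24 * H) / 10"
    by (rule amgm) (use Q nn in \<open>auto simp: mult.commute\<close>)
  then have "\<bar>Q\<bar> \<le> 5 * N + 5 / 96 * H" by simp
  then have "r * Q \<le> \<delta> / 25 * (5 * N + 5 / 96 * H)"
    using mult_mono[OF r _ _ abs_ge_zero, of Q "5 * N + 5 / 96 * H"] \<delta> nn(5) abs_ge_self[of Q]
      mult_left_mono[of Q "\<bar>Q\<bar>" r] by linarith
  moreover have "\<delta> / 4 * (H / 50) \<le> \<delta> / 4 * A" using A(1) \<delta> by (intro mult_left_mono) auto
  moreover have "0 \<le> \<delta> / 4 * (r * X)" using \<delta> nn by simp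
  moreover have "0 \<le> \<delta> * N" "0 \<le> \<delta> * H" using \<delta> nn by simp_all
  moreover have "q + (h + n) / 500 \<le> 3 / 4 * n + a / 4 + x / 4"
    if "q \<le> n / 5 + h / 480" "h \<le> 50 * a" "0 \<le> x" "0 \<le> n" "0 \<le> h" for q h n a x :: real
    using that by argo
  from this[of "r * Q" "\<delta> * N" "\<delta> * H" "\<delta> * A" "\<delta> * (r * X)"]
  have "r * Q \<le> \<delta> * N / 5 + \<delta> * H / 480 \<Longrightarrow> \<delta> * H \<le> 50 * (\<delta> * A) \<Longrightarrow> 0 \<le> \<delta> * (r * X) \<Longrightarrow>
      0 \<le> \<delta> * N \<Longrightarrow> 0 \<le> \<delta> * H \<Longrightarrow>
      r * Q + (\<delta> * H + \<delta> * N) / 500 \<le> 3 / 4 * (\<delta> * N) + \<delta> * A / 4 + \<delta> * (r * X) / 4" .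
  ultimately show "- (\<delta> * N - r * Q) + \<delta> / 4 * (N - A - r * X) \<le> - (\<delta> / 500) * (N + H)"
    by (simp add: algebra_simps add_divide_distrib diff_divide_distrib)
qed

text \<open>
  The odd part \<open>w\<close> solves the equation without the forcing, with \<open>S \<parallel>u\<^sub>x\<parallel>\<^sup>2\<close> as a given coefficient.
  Once that coefficient is at most \<open>\<delta>/25\<close>, the function \<open>Y\<close> satisfies \<open>Y' \<le> - \<kappa> Y\<close> and controls
  the energy of \<open>w\<close>.
\<close>

theorem torsional_decay:
  fixes l \<delta> S P :: real
  assumes l: "0 < l" "l < pi" and \<delta>: "0 < \<delta>" and S: "0 < S" and P: "0 \<le> P" "P < lambda1 l"
    and g: "C_curve 0 (L2 l) (norm_L2 l) g" "\<forall>t\<ge>0. even_in_y l (g t)"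
    and sol: "weak_solution l \<delta> S P g u"
    and small: "Limsup at_top (\<lambda>t. ereal ((norm_L2 l (weak_partial l 1 0 (u t)))\<^sup>2)) < ereal (\<delta> / (25 * S))"
  shows "\<exists>\<eta>>0. ((\<lambda>t. exp (\<eta> * t) *
             ((norm_H2star l (torsional (u t)))\<^sup>2
              + (norm_L2 l (L2_time_deriv l (\<lambda>s. torsional (u s)) t))\<^sup>2)) \<longlongrightarrow> 0) at_top"
proof -
  have lam: "0 < lambda1 l" using P by simp
  have u0: "C0_curve (H2star l) (norm_H2star l) u"
    and C1: "C_curve 1 (L2 l) (norm_L2 l) u"
    and C2: "C_curve 2 (dual_H2star l) (norm_dual l) (\<lambda>t. inner_L2 l (u t))"
    and eqn: "\<And>t v. 0 \<le> t \<Longrightarrow> v \<in> H2star l \<Longrightarrow>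
        dual_time_deriv l (dual_time_deriv l (\<lambda>s. inner_L2 l (u s))) t v
        + \<delta> * inner_L2 l (L2_time_deriv l u t) v
        + inner_H2star l (u t) v
        + (S * (norm_L2 l (weak_partial l 1 0 (u t)))\<^sup>2 - P)
            * inner_L2 l (weak_partial l 1 0 (u t)) (weak_partial l 1 0 v)
        = inner_L2 l (g t) v"
    using sol by (auto simp: weak_solution_def)
  obtain u' where uc: "C0_curve (L2 l) (norm_L2 l) u" and uD: "\<And>t. 0 \<le> t \<Longrightarrow> has_curve_deriv (norm_L2 l) u (u' t) t"
    and u'c: "C0_curve (L2 l) (norm_L2 l) u'"
    using C1 by auto
  have uL: "u t \<in> L2 l" "u' t \<in> L2 l" "g t \<in> L2 l" and uS: "u t \<in> H2star l" if "0 \<le> t" for t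
    using uc u'c u0 g(1) that by (auto simp: C0_curve_def)
  define w where "w t = torsional (u t)" for t
  define w' where "w' t = torsional (u' t)" for t
  have wc: "C0_curve (L2 l) (norm_L2 l) w" and w'c: "C0_curve (L2 l) (norm_L2 l) w'"
    unfolding w_def[abs_def] w'_def[abs_def] by (intro C0_curve_torsional uc u'c)+
  have wL: "w t \<in> L2 l" "w' t \<in> L2 l" if "0 \<le> t" for t using wc w'c that by (auto simp: C0_curve_def)
  have wS: "w t \<in> H2star l" if "0 \<le> t" for t unfolding w_def by (intro H2star_torsional l uS that)
  have wD: "has_curve_deriv (norm_L2 l) w (w' t) t" if "0 \<le> t" for t
    unfolding w_def[abs_def] w'_def by (intro has_curve_deriv_torsional uD uL that)
  have odd: "reflect (w t) = (\<lambda>\<xi>. - w t \<xi>)" for t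
    by (auto simp: w_def torsional_def reflect_def fun_eq_iff field_simps)
  have pc: "C0_curve (L2 l) (norm_L2 l) (\<lambda>t. weak_partial l i j (w t))"
    and puc: "C0_curve (L2 l) (norm_L2 l) (\<lambda>t. weak_partial l i j (u t))"
    if "(i, j) \<in> {(2, 0), (0, 2), (1, 1), (1, 0)}" for i j
    unfolding w_def using C0_curve_weak_partial[OF l(1) lam that u0] by auto
  define b where "b t = (norm_L2 l (weak_partial l 1 0 (u t)))\<^sup>2" for t
  define H where "H s t = inner_H2star l (w s) (w t)" for s t
  define X where "X s t = inner_L2 l (weak_partial l 1 0 (w s)) (weak_partial l 1 0 (w t))" for s t
  define A where "A s t = H s t - P * X s t" for s t
  define N where "N s t = inner_L2 l (w' s) (w' t)" for s t
  define K where "K s t = inner_L2 l (w s) (w t)" for s t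
  define M where "M s t = inner_L2 l (w' s) (w t)" for s t
  define R where "R s t = inner_L2 l (weak_partial l 2 0 (w s)) (w t)" for s t
  define Q where "Q s t = inner_L2 l (weak_partial l 2 0 (w s)) (w' t)" for s t
  define J where "J s t = \<delta> * M s t - S * b s * R s t" for s t
  define L where "L s t = \<delta> * N s t - S * b s * Q s t" for s t
  have pL: "weak_partial l i j (w t) \<in> L2 l" if "0 \<le> t" "i + j \<le> 2" for i j t
    by (intro weak_partial_spec H2star_H2 wS that)
  have sub: "{0<..} \<times> {0<..} \<subseteq> {0::real..} \<times> {0::real..}" by auto
  have cont: "continuous_on ({0<..} \<times> {0<..}) (\<lambda>(s, t). inner_L2 l (p s) (q t))"
    if "C0_curve (L2 l) (norm_L2 l) p" "C0_curve (L2 l) (norm_L2 l) q" for p q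
    by (rule continuous_on_subset[OF C0_curve_inner_continuous[OF that] sub])
  have cX: "continuous_on ({0<..} \<times> {0<..}) (\<lambda>(s, t). X s t)"
    and cN: "continuous_on ({0<..} \<times> {0<..}) (\<lambda>(s, t). N s t)"
    and cQ: "continuous_on ({0<..} \<times> {0<..}) (\<lambda>(s, t). Q s t)"
    and cK': "continuous_on ({0<..} \<times> {0<..}) (\<lambda>(s, t). inner_L2 l (w s) (w' t))"
    unfolding X_def N_def Q_def by (intro cont pc wc w'c; simp)+
  have H_eq: "H s t = inner_L2 l (weak_partial l 2 0 (w s)) (weak_partial l 2 0 (w t))
      + inner_L2 l (weak_partial l 0 2 (w s)) (weak_partial l 0 2 (w t))
      + 1 / 5 * (inner_L2 l (weak_partial l 2 0 (w s)) (weak_partial l 0 2 (w t))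
               + inner_L2 l (weak_partial l 0 2 (w s)) (weak_partial l 2 0 (w t)))
      + 8 / 5 * inner_L2 l (weak_partial l 1 1 (w s)) (weak_partial l 1 1 (w t))"
    if "0 \<le> s" "0 \<le> t" for s t
    unfolding H_def by (intro inner_H2star_eq H2star_H2 wS that)
  have cH: "continuous_on ({0<..} \<times> {0<..}) (\<lambda>(s, t). H s t)"
  proof -
    have "continuous_on ({0<..} \<times> {0<..}) (\<lambda>\<xi>.
        (case \<xi> of (s, t) \<Rightarrow> inner_L2 l (weak_partial l 2 0 (w s)) (weak_partial l 2 0 (w t)))
      + (case \<xi> of (s, t) \<Rightarrow> inner_L2 l (weak_partial l 0 2 (w s)) (weak_partial l 0 2 (w t)))
      + 1 / 5 * ((case \<xi> of (s, t) \<Rightarrow> inner_L2 l (weak_partial l 2 0 (w s)) (weak_partial l 0 2 (w t)))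
               + (case \<xi> of (s, t) \<Rightarrow> inner_L2 l (weak_partial l 0 2 (w s)) (weak_partial l 2 0 (w t))))
      + 8 / 5 * (case \<xi> of (s, t) \<Rightarrow> inner_L2 l (weak_partial l 1 1 (w s)) (weak_partial l 1 1 (w t))))"
      by (intro continuous_on_add continuous_on_mult continuous_on_const cont pc; simp)
    then show ?thesis
      by (rule continuous_on_eq) (auto simp: H_eq)
  qed
  have cA: "continuous_on ({0<..} \<times> {0<..}) (\<lambda>(s, t). A s t)"
    using continuous_on_diff[OF cH continuous_on_mult[OF continuous_on_const cX, of P]]
    by (simp add: A_def case_prod_unfold)
  have cb: "continuous_on ({0<..} \<times> {0<..}) (\<lambda>\<xi>. b (fst \<xi>))"
  proof -
    have "continuous_on ({0<..} \<times> {0<..}) (\<lambda>(s, t). inner_L2 l (weak_partial l 1 0 (u s)) (weak_partial l 1 0 (u t)))"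
      by (intro cont puc; simp)
    then have "continuous_on ({0<..} \<times> {0<..}) (\<lambda>\<xi>. (\<lambda>(s, t). inner_L2 l (weak_partial l 1 0 (u s)) (weak_partial l 1 0 (u t))) (fst \<xi>, fst \<xi> :: real))"
      by (rule continuous_on_compose2) (auto intro!: continuous_intros)
    then show ?thesis by (simp add: b_def norm_L2_sq)
  qed
  have cL: "continuous_on ({0<..} \<times> {0<..}) (\<lambda>(s, t). L s t)"
  proof -
    have "continuous_on ({0<..} \<times> {0<..}) (\<lambda>\<xi>. \<delta> * (\<lambda>(s, t). N s t) \<xi> - S * b (fst \<xi>) * (\<lambda>(s, t). Q s t) \<xi>)"
      by (intro continuous_on_diff continuous_on_mult continuous_on_const cN cQ cb)
    then show ?thesis by (simp add: L_def case_prod_unfold)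
  qed
  have symA: "A s t = A t s" and symN: "N s t = N t s" for s t
  proof -
    have "inner_H2star l a c = inner_H2star l c a" for a c
      unfolding inner_H2star_def Let_def by (intro Bochner_Integration.integral_cong refl) (simp add: algebra_simps)
    then show "A s t = A t s" by (simp add: A_def H_def X_def inner_L2_commute)
    show "N s t = N t s" by (simp add: N_def inner_L2_commute)
  qed
  have XR: "X s t = - R s t" if "0 \<le> s" "0 \<le> t" for s t
    unfolding X_def R_def by (intro inner_x_by_parts l wS that)
  have D2: "((\<lambda>t. M s t) has_real_derivative N s t) (at t)" if "0 < s" "0 < t" for s t
    unfolding M_def N_def using that
    by (intro has_curve_deriv_inner_DERIV[OF wD]) (auto intro: wL)
  have D3: "((\<lambda>t. J s t) has_real_derivative L s t) (at t)" if "0 < s" "0 < t" for s t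
  proof -
    have "((\<lambda>t. R s t) has_real_derivative Q s t) (at t)"
      unfolding R_def Q_def using that
      by (intro has_curve_deriv_inner_DERIV[OF wD]) (auto intro: wL pL)
    then show ?thesis unfolding J_def L_def by (intro DERIV_diff DERIV_cmult D2 that)
  qed
  \<comment> \<open>The equation tested with the odd function \<open>w t\<close> only sees the odd part of \<open>u\<close>.\<close>
  have D1: "((\<lambda>s. M s t) has_real_derivative - A s t - J s t) (at s)" if s: "0 < s" and t: "0 < t" for s t
  proof -
    have s0: "0 \<le> s" and t0: "0 \<le> t" using s t by auto
    have "(- 1 :: real)\<^sup>2 = 1" by simp
    note ip = inner_parity[OF _ uL(1)[OF t0] this, folded torsional_parity, folded w_def]
    note wp = inner_weak_partial_torsional[OF H2star_H2[OF uS[OF s0]] H2star_H2[OF uS[OF t0]], folded w_def]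
    have "((\<lambda>s. inner_L2 l (u' s) (w t)) has_real_derivative
        dual_time_deriv l (dual_time_deriv l (\<lambda>s. inner_L2 l (u s))) s (w t)) (at s)"
      by (rule second_dual_derivative[OF C2 uL(1,2) uD wS[OF t0] s])
    moreover have "eventually (\<lambda>s. inner_L2 l (u' s) (w t) = M s t) (nhds s)"
    proof -
      have "eventually (\<lambda>s. s \<in> {0<..}) (nhds s)" using s by (intro eventually_nhds_in_open) auto
      then show ?thesis
        by eventually_elim (simp add: ip[OF uL(2)] M_def w'_def torsional_parity)
    qed
    ultimately have D: "((\<lambda>s. M s t) has_real_derivative
        dual_time_deriv l (dual_time_deriv l (\<lambda>s. inner_L2 l (u s))) s (w t)) (at s)"
      by (subst (asm) DERIV_cong_ev[OF refl _ refl])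
    note td = L2_time_deriv_eq[OF uD[OF s0] uL(1) uL(2)[OF s0] s0]
    have t1: "inner_L2 l (L2_time_deriv l u s) (w t) = M s t"
    proof -
      have "inner_L2 l (L2_time_deriv l u s) (w t) = inner_L2 l (u' s) (w t)"
        by (intro inner_L2_cong td uL s0 wL t0 AE_I2 refl)
      then show ?thesis using ip[OF uL(2)[OF s0]] by (simp add: M_def w'_def torsional_parity)
    qed
    have t2: "inner_H2star l (u s) (w t) = H s t"
      unfolding H_eq[OF s0 t0] inner_H2star_eq[OF H2star_H2[OF uS[OF s0]] H2star_H2[OF wS[OF t0]]]
      by (simp add: wp)
    have t3: "inner_L2 l (weak_partial l 1 0 (u s)) (weak_partial l 1 0 (w t)) = X s t"
      unfolding X_def by (intro wp) simp_all
    have t4: "inner_L2 l (g s) (w t) = 0"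
    proof -
      have "AE \<xi> in lebesgue_on (Omega l). g s (mirror \<xi>) = g s \<xi>"
        using g(2) s0 by (simp add: even_in_y_def case_prod_unfold)
      then have z: "AE \<xi> in lebesgue_on (Omega l). parity (- 1) (g s) \<xi> = 0"
        by eventually_elim (simp add: parity_def reflect_apply)
      have "inner_L2 l (g s) (w t) = inner_L2 l (parity (- 1) (g s)) (w t)"
        using ip[OF uL(3)[OF s0]] by (simp add: torsional_parity)
      also have "\<dots> = inner_L2 l (\<lambda>_. 0) (w t)"
        by (intro inner_L2_cong z parity_L2 uL s0 wL t0 AE_I2 refl L2_bounded[where C = 0]) auto
      finally show ?thesis by (simp add: inner_L2_def)
    qed
    have "dual_time_deriv l (dual_time_deriv l (\<lambda>s. inner_L2 l (u s))) s (w t) = - A s t - J s t"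
      using eqn[OF s0 wS[OF t0]] XR[OF s0 t0]
      unfolding t1 t2 t3 t4 b_def[symmetric] by (simp add: A_def J_def algebra_simps)
    then show ?thesis using D by simp
  qed
  have DE: "((\<lambda>t. (N t t + A t t) / 2) has_real_derivative - L t t) (at t)" if "0 < t" for t
    by (rule two_time_energy_identity[OF cA cN cL symA symN D1 D2 D3 that])
  have DM: "((\<lambda>t. M t t) has_real_derivative - A t t - J t t + N t t) (at t)" if "0 < t" for t
    using diagonal_deriv[OF D1 D2 cN, of t 0] that by simp
  have DK: "((\<lambda>t. K t t) has_real_derivative 2 * M t t) (at t)" if t: "0 < t" for t
  proof -
    have k2: "((\<lambda>t. K s t) has_real_derivative inner_L2 l (w s) (w' t)) (at t)" if "0 < s" "0 < t" for s t
      unfolding K_def using that by (intro has_curve_deriv_inner_DERIV[OF wD]) (auto intro: wL)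
    have k1: "((\<lambda>s. K s t) has_real_derivative M s t) (at s)" if "0 < s" "0 < t" for s t
      using k2[OF that(2,1)] by (simp add: K_def M_def inner_L2_commute)
    show ?thesis using diagonal_deriv[OF k1 k2 cK', of t 0] t by (simp add: M_def inner_L2_commute)
  qed
  define Y where "Y t = (N t t + A t t) / 2 + \<delta> / 4 * M t t + \<delta>\<^sup>2 / 8 * K t t" for t
  define Y' where "Y' t = - (\<delta> * N t t - S * b t * Q t t) + \<delta> / 4 * (N t t - A t t - S * b t * X t t)" for t
  have DY: "(Y has_real_derivative Y' t) (at t)" if t: "0 < t" for t
  proof -
    have "(Y has_real_derivative - L t t + \<delta> / 4 * (- A t t - J t t + N t t) + \<delta>\<^sup>2 / 8 * (2 * M t t)) (at t)"
      unfolding Y_def[abs_def] by (intro DERIV_add DERIV_cmult DE DM DK t)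
    moreover have "- L t t + \<delta> / 4 * (- A t t - J t t + N t t) + \<delta>\<^sup>2 / 8 * (2 * M t t) = Y' t"
      using XR[of t t] t by (simp add: Y'_def L_def J_def power2_eq_square algebra_simps)
    ultimately show ?thesis by simp
  qed
  have "eventually (\<lambda>t. ereal (b t) < ereal (\<delta> / (25 * S))) at_top"
    unfolding b_def by (rule Limsup_lessD[OF small])
  then obtain T0 where T0: "\<And>t. T0 \<le> t \<Longrightarrow> b t < \<delta> / (25 * S)"
    by (auto simp: eventually_at_top_linorder)
  define T where "T = max T0 1"
  define C where "C = 1 / 2 + \<delta> / 4 + \<delta> / (4 * lambda1 l) + \<delta>\<^sup>2 / (8 * lambda1 l)"
  have C: "0 < C" unfolding C_def using \<delta> lam by (intro add_pos_nonneg) auto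
  define \<kappa> where "\<kappa> = \<delta> / 500 / C"
  have \<kappa>: "0 < \<kappa>" using \<delta> C by (simp add: \<kappa>_def)
  have est: "N t t / 4 + H t t / 100 \<le> Y t" "Y t \<le> C * (N t t + H t t)"
    "Y' t \<le> - (\<delta> / 500) * (N t t + H t t)" "0 \<le> N t t" "0 \<le> H t t" if t: "T \<le> t" for t
  proof -
    have t0: "0 \<le> t" and bt: "b t < \<delta> / (25 * S)" using t T0 by (auto simp: T_def)
    have CS: "(inner_L2 l a c)\<^sup>2 \<le> inner_L2 l a a * inner_L2 l c c" if "a \<in> L2 l" "c \<in> L2 l" for a c
    proof -
      have "\<bar>inner_L2 l a c\<bar>\<^sup>2 \<le> (norm_L2 l a * norm_L2 l c)\<^sup>2"
        by (intro power_mono inner_L2_Cauchy_Schwarz that) simp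
      then show ?thesis by (simp add: power_mult_distrib norm_L2_sq)
    qed
    have nn: "0 \<le> N t t" "0 \<le> K t t" "0 \<le> X t t" unfolding N_def K_def X_def by (rule inner_L2_nonneg)+
    have H0: "0 \<le> H t t" unfolding H_def by (intro inner_H2star_nonneg H2star_H2 wS t0)
    have r: "0 \<le> S * b t" "S * b t \<le> \<delta> / 25"
      using S bt by (auto simp: b_def field_simps)
    have "lambda1 l * X t t \<le> 49 / 50 * H t t"
      unfolding X_def H_def using lam by (intro odd_coercivity l wS t0 odd) auto
    moreover have "P * X t t \<le> lambda1 l * X t t" using P nn(3) by (intro mult_right_mono) auto
    moreover have "0 \<le> P * X t t" using P nn(3) by simp
    ultimately have Ab: "H t t / 50 \<le> A t t" "A t t \<le> H t t" by (simp_all add: A_def)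
    have Kb: "lambda1 l * K t t \<le> H t t" unfolding K_def H_def by (intro lambda1_le wS t0)
    have Mb: "(M t t)\<^sup>2 \<le> N t t * K t t" unfolding M_def N_def K_def by (intro CS wL t0)
    have Qb: "(Q t t)\<^sup>2 \<le> 25 / 24 * H t t * N t t"
    proof -
      have "inner_L2 l (weak_partial l 2 0 (w t)) (weak_partial l 2 0 (w t)) \<le> 25 / 24 * H t t"
        using inner_H2star_lower(1)[OF H2star_H2[OF wS[OF t0]]] inner_L2_nonneg[of l "weak_partial l 1 1 (w t)"]
        unfolding H_def by linarith
      then have "inner_L2 l (weak_partial l 2 0 (w t)) (weak_partial l 2 0 (w t)) * N t t \<le> 25 / 24 * H t t * N t t"
        using nn(1) by (rule mult_right_mono)
      moreover have "(Q t t)\<^sup>2 \<le> inner_L2 l (weak_partial l 2 0 (w t)) (weak_partial l 2 0 (w t)) * N t t"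
        unfolding Q_def N_def using t0 by (intro CS wL pL) auto
      ultimately show ?thesis by linarith
    qed
    note E = Lyapunov_estimates[OF \<delta> lam nn(1) H0 nn(2,3) r(1) Ab Kb Mb Qb r(2)]
    show "N t t / 4 + H t t / 100 \<le> Y t" "Y t \<le> C * (N t t + H t t)"
      "Y' t \<le> - (\<delta> / 500) * (N t t + H t t)" "0 \<le> N t t" "0 \<le> H t t"
      using E nn(1) H0 by (simp_all add: Y_def Y'_def C_def)
  qed
  have "((\<lambda>t. exp (\<kappa> / 2 * t) * (H t t + N t t)) \<longlongrightarrow> 0) at_top"
  proof (rule exponential_decay[OF \<kappa>])
    fix t assume t: "T \<le> t"
    show "(Y has_real_derivative Y' t) (at t)" using t by (intro DY) (simp add: T_def)
    have "\<kappa> * Y t \<le> \<kappa> * (C * (N t t + H t t))" using est(2)[OF t] \<kappa> by (intro mult_left_mono) auto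
    also have "\<dots> = \<delta> / 500 * (N t t + H t t)" using C by (simp add: \<kappa>_def)
    finally show "Y' t \<le> - \<kappa> * Y t" using est(3)[OF t] by simp
    show "0 \<le> H t t + N t t" using est(4,5)[OF t] by simp
    show "H t t + N t t \<le> 100 * Y t" using est(1,4)[OF t] by simp
  qed simp
  moreover have "eventually (\<lambda>t. exp (\<kappa> / 2 * t) * (H t t + N t t) = exp (\<kappa> / 2 * t) *
      ((norm_H2star l (torsional (u t)))\<^sup>2 + (norm_L2 l (L2_time_deriv l (\<lambda>s. torsional (u s)) t))\<^sup>2)) at_top"
    using eventually_ge_at_top[of 0]
  proof eventually_elim
    case (elim t)
    note td = L2_time_deriv_eq[OF wD[OF elim] wL(1) wL(2)[OF elim] elim]
    have "(norm_L2 l (L2_time_deriv l w t))\<^sup>2 = N t t"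
      unfolding norm_L2_sq N_def by (intro inner_L2_cong td wL elim)
    moreover have "(norm_H2star l (w t))\<^sup>2 = H t t"
      unfolding H_def by (intro norm_H2star_sq H2star_H2 wS elim)
    ultimately show ?case by (simp add: w_def[abs_def])
  qed
  ultimately have "((\<lambda>t. exp (\<kappa> / 2 * t) *
      ((norm_H2star l (torsional (u t)))\<^sup>2 + (norm_L2 l (L2_time_deriv l (\<lambda>s. torsional (u s)) t))\<^sup>2)) \<longlongrightarrow> 0) at_top"
    by (rule Lim_transform_eventually)
  then show ?thesis using \<kappa> by (intro exI[of _ "\<kappa> / 2"]) simp
qed

theorem theorem12:
  shows "\<exists>chi :: real \<Rightarrow> real \<Rightarrow> real \<Rightarrow> real \<Rightarrow> real.
    \<forall>l \<delta> S P. 0 < l \<and> l < pi \<and> \<delta> > 0 \<and> S > 0 \<and> 0 \<le> P \<and> P < lambda1 l \<longrightarrow>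
      chi \<delta> S P (lambda1 l) > 0 \<and>
      (\<forall>g u. C_curve 0 (L2 l) (norm_L2 l) g \<and> (\<forall>t\<ge>0. even_in_y l (g t)) \<and>
             weak_solution l \<delta> S P g u \<and>
             Limsup at_top (\<lambda>t. ereal ((norm_L2 l (weak_partial l 1 0 (u t)))\<^sup>2))
               < ereal (chi \<delta> S P (lambda1 l)) \<longrightarrow>
        (\<exists>\<eta>>0. ((\<lambda>t. exp (\<eta> * t) *
             ((norm_H2star l (torsional (u t)))\<^sup>2
              + (norm_L2 l (L2_time_deriv l (\<lambda>s. torsional (u s)) t))\<^sup>2))
           \<longlongrightarrow> 0) at_top))"
proof (rule exI[of _ "\<lambda>\<delta> S P lam. \<delta> / (25 * S)"], intro allI impI conjI)
  fix l \<delta> S P :: real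
  assume h: "0 < l \<and> l < pi \<and> \<delta> > 0 \<and> S > 0 \<and> 0 \<le> P \<and> P < lambda1 l"
  then show "0 < \<delta> / (25 * S)" by simp
  fix g u
  assume "C_curve 0 (L2 l) (norm_L2 l) g \<and> (\<forall>t\<ge>0. even_in_y l (g t)) \<and>
    weak_solution l \<delta> S P g u \<and>
    Limsup at_top (\<lambda>t. ereal ((norm_L2 l (weak_partial l 1 0 (u t)))\<^sup>2)) < ereal (\<delta> / (25 * S))"
  with h show "\<exists>\<eta>>0. ((\<lambda>t. exp (\<eta> * t) *
      ((norm_H2star l (torsional (u t)))\<^sup>2
        + (norm_L2 l (L2_time_deriv l (\<lambda>s. torsional (u s)) t))\<^sup>2)) \<longlongrightarrow> 0) at_top"
    by (intro torsional_decay[of l \<delta> S P g u]) auto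
qed

end
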